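(* Let $K$ be a field. An affine functor $\mathbb G$ is a functor of monoids if and only if $\mathbb A_{\mathbb G}$ is a functor of bialgebras; that is, giving a structure of functor of monoids on $\mathbb G$ is equivalent to giving a structure of functor of bialgebras on $\mathbb A_{\mathbb G}$. Moreover, given two affine functors of monoids $\mathbb G_1$ and $\mathbb G_2$, $$\operatorname{Hom}_{mon}(\mathbb G_1,\mathbb G_2)=\operatorname{Hom}_{bialg}(\mathbb A_{\mathbb G_2},\mathbb A_{\mathbb G_1}),$$ where a morphism $h:\mathbb G_1\to\mathbb G_2$ corresponds to the induced morphism $\mathbb A_{\mathbb G_2}\to\mathbb A_{\mathbb G_1}$, $f\mapsto f\circ h$.
   Context: All functors are covariant functors on the category of commutative (associative, unital) $K$-algebras. $\mathcal K(S)=S$. A functor of $\mathcal K$-modules is a functor $\mathbb M$ with functorial $S$-module structures on $\mathbb M(S)$; functors of $\mathcal K$-algebras (associative, unital) analogously; tensor products are objectwise. $\mathbb{H}om_{\mathcal K}(\mathbb M,\mathbb M')(S):=\operatorname{Hom}_{\mathcal S}(\mathbb M_{|S},\mathbb M'_{|S})$ where $|S$ denotes restriction to commutative $S$-algebras, and $\mathbb M^*:=\mathbb{H}om_{\mathcal K}(\mathbb M,\mathcal K)$. $\mathbb M$ is reflexive if the canonical morphism $\mathbb M\to\mathbb M^{**}$ is an isomorphism. For a functor of commutative $\mathcal K$-algebras $\mathbb A$, $(\operatorname{Spec}\mathbb A)(S):=\operatorname{Hom}_{\mathcal K\text{-alg}}(\mathbb A,\mathcal S)$. For a functor of sets $\mathbb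 X$, $\mathbb A_{\mathbb X}(S):=\operatorname{Hom}(\mathbb X_{|S},\mathcal K_{|S})$ is its functor of functions (a functor of commutative algebras). $\mathbb X$ is an affine functor if $\mathbb A_{\mathbb X}$ is reflexive and the canonical morphism $\mathbb X\to\operatorname{Spec}\mathbb A_{\mathbb X}$ is an isomorphism. An affine functor of monoids is an affine functor which is a functor of monoids. For $\mathbb X$ affine, the morphism $\mathbb X\times\mathbb X\to\mathbb A_{\mathbb X}^*\otimes\mathbb A_{\mathbb X}^*$ induces an identification $(\mathbb A_{\mathbb X}^*\otimes\mathbb A_{\mathbb X}^* )^*=\mathbb A_{\mathbb X\times\mathbb X}$, which gives $(\mathbb A_{\mathbb X}^*\otimes\mathbb A_{\mathbb X}^* )^*$ a structure of functor of algebras. A structure of functor of bialgebras on $\mathbb A_{\mathbb X}$ (with its algebra structure of functions) is a structure of functor of $\mathcal K$-algebras on $\mathbb A_{\mathbb X}^*$ such that the dual morphisms $m^*:\mathbb A_{\mathbb X}\to(\mathbb A_{\mathbb X}^*\otimes\mathbb A_{\mathbb X}^* )^*$ and $u^*:\mathbb A_{\mathbb X}\to\mathcal K$ of the multiplication $m:\mathbb A_{\mathbb X}^*\otimes\mathbb A_{\mathbb X}^*\to\mathbb A_{\mathbb X}^*$ and the unit $u:\mathcal K\to\mathbb A_{\mathbb X}^*$ are morphisms of functors of $\mathcal K$-algebras. A morphism of functors of bialgebras $f:\mathbb B\to\mathbb B'$ is a morphism of $\mathcal K$-modules such that $f$ and $f^*:\mathbb B'^*\to\mathbb B^*$ are morphisms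 of functors of $\mathcal K$-algebras. *)

theory Defs
  imports
    "HOL-Algebra.Module"
    "HOL-Algebra.Coset"
    "HOL-Algebra.Generated_Groups"
    "HOL-Algebra.Free_Abelian_Groups"
begin

text \<open>
  Size convention: \<open>K\<close> has its carrier in a type \<open>'u\<close>, and the category of commutative
  \<open>K\<close>-algebras consists of all commutative \<open>K\<close>-algebras with carrier in \<open>'u\<close>.
  The type \<open>'u\<close> plays the role of the universe and stays arbitrary. The values of functors
  lie in other types, which are arbitrary as well.

  Functions that belong to Hom sets are \<^const>\<open>extensional\<close>, so that two of them are equal in HOL
  iff they agree on their domain.
\<close>


section \<open>Commutative algebras\<close>

type_synonym 'u alg = "('u, 'u) module"

definition calg_homs :: "'u ring \<Rightarrow> 'u alg \<Rightarrow> 'u alg \<Rightarrow> ('u \<Rightarrow> 'u) set" where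
  "calg_homs K R R' =
     {\<phi> \<in> ring_hom R R' \<inter> extensional (carrier R).
        \<forall>k\<in>carrier K. \<forall>r\<in>carrier R. \<phi> (k \<odot>\<^bsub>R\<^esub> r) = k \<odot>\<^bsub>R'\<^esub> \<phi> r}"

definition id_on :: "'u alg \<Rightarrow> 'u \<Rightarrow> 'u" where
  "id_on R = (\<lambda>r\<in>carrier R. r)"

text \<open>
  A category whose objects have an underlying commutative \<open>K\<close>-algebra and whose arrows are
  certain homomorphisms of these. There are two instances: commutative
  \<open>K\<close>-algebras, and commutative \<open>S\<close>-algebras, the latter as commutative \<open>K\<close>-algebras \<open>R\<close> together
  with a structure morphism \<open>S \<rightarrow> R\<close> of \<open>K\<close>-algebras.
\<close>

record ('i, 'u) algcat =
  Obj :: "'i set"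
  Arr :: "'i \<Rightarrow> 'i \<Rightarrow> ('u \<Rightarrow> 'u) set"
  und :: "'i \<Rightarrow> 'u alg"

definition algs :: "'u ring \<Rightarrow> ('u alg, 'u) algcat" where
  "algs K = \<lparr>Obj = {R. algebra K R}, Arr = calg_homs K, und = (\<lambda>R. R)\<rparr>"

definition algs_under :: "'u ring \<Rightarrow> 'u alg \<Rightarrow> ('u alg \<times> ('u \<Rightarrow> 'u), 'u) algcat" where
  "algs_under K S =
     \<lparr>Obj = {(R, \<phi>). algebra K R \<and> \<phi> \<in> calg_homs K S R},
      Arr = (\<lambda>(R, \<phi>) (R', \<phi>'). {\<psi> \<in> calg_homs K R R'. compose (carrier S) \<psi> \<phi> = \<phi>'}),
      und = fst\<rparr>"


section \<open>Functors of sets\<close>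

record ('i, 'u, 'x) sfun =
  obj :: "'i \<Rightarrow> 'x set"
  mor :: "'i \<Rightarrow> 'i \<Rightarrow> ('u \<Rightarrow> 'u) \<Rightarrow> 'x \<Rightarrow> 'x"

definition set_functor :: "('i, 'u) algcat \<Rightarrow> ('i, 'u, 'x) sfun \<Rightarrow> bool" where
  "set_functor C X \<longleftrightarrow>
     (\<forall>i\<in>Obj C. \<forall>j\<in>Obj C. \<forall>\<phi>\<in>Arr C i j. mor X i j \<phi> \<in> obj X i \<rightarrow> obj X j) \<and>
     (\<forall>i\<in>Obj C. \<forall>x\<in>obj X i. mor X i i (id_on (und C i)) x = x) \<and>
     (\<forall>i\<in>Obj C. \<forall>j\<in>Obj C. \<forall>k\<in>Obj C. \<forall>\<phi>\<in>Arr C i j. \<forall>\<psi>\<in>Arr C j k. \<forall>x\<in>obj X i.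
        mor X i k (compose (carrier (und C i)) \<psi> \<phi>) x = mor X j k \<psi> (mor X i j \<phi> x))"

definition set_homs ::
  "('i, 'u) algcat \<Rightarrow> ('i, 'u, 'x) sfun \<Rightarrow> ('i, 'u, 'y) sfun \<Rightarrow> ('i \<Rightarrow> 'x \<Rightarrow> 'y) set" where
  "set_homs C X Y =
     {\<eta> \<in> extensional (Obj C).
        (\<forall>i\<in>Obj C. \<eta> i \<in> obj X i \<rightarrow>\<^sub>E obj Y i) \<and>
        (\<forall>i\<in>Obj C. \<forall>j\<in>Obj C. \<forall>\<phi>\<in>Arr C i j. \<forall>x\<in>obj X i.
           \<eta> j (mor X i j \<phi> x) = mor Y i j \<phi> (\<eta> i x))}"

definition set_iso ::
  "('i, 'u) algcat \<Rightarrow> ('i, 'u, 'x) sfun \<Rightarrow> ('i, 'u, 'y) sfun \<Rightarrow> ('i \<Rightarrow> 'x \<Rightarrow> 'y) \<Rightarrow> bool" where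
  "set_iso C X Y \<eta> \<longleftrightarrow>
     \<eta> \<in> set_homs C X Y \<and>
     (\<exists>\<theta>\<in>set_homs C Y X. \<forall>i\<in>Obj C.
        (\<forall>x\<in>obj X i. \<theta> i (\<eta> i x) = x) \<and> (\<forall>y\<in>obj Y i. \<eta> i (\<theta> i y) = y))"

definition srestr :: "('u alg, 'u, 'x) sfun \<Rightarrow> ('u alg \<times> ('u \<Rightarrow> 'u), 'u, 'x) sfun" where
  "srestr X = \<lparr>obj = (\<lambda>i. obj X (fst i)), mor = (\<lambda>i j. mor X (fst i) (fst j))\<rparr>"

definition sprod :: "('i, 'u, 'x) sfun \<Rightarrow> ('i, 'u, 'y) sfun \<Rightarrow> ('i, 'u, 'x \<times> 'y) sfun" where
  "sprod X Y = \<lparr>obj = (\<lambda>i. obj X i \<times> obj Y i),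
                mor = (\<lambda>i j \<phi>. map_prod (mor X i j \<phi>) (mor Y i j \<phi>))\<rparr>"

definition spoint :: "('i, 'u, unit) sfun" where
  "spoint = \<lparr>obj = (\<lambda>i. {()}), mor = (\<lambda>i j \<phi> x. x)\<rparr>"


section \<open>Functors of modules and of algebras\<close>

text \<open>
  The values are \<^typ>\<open>('u, 'm) module\<close> records. For a mere functor of modules their
  fields \<^const>\<open>monoid.mult\<close> and \<^const>\<open>one\<close> carry no meaning.
\<close>

record ('i, 'u, 'm) mfun =
  mobj :: "'i \<Rightarrow> ('u, 'm) module"
  mmor :: "'i \<Rightarrow> 'i \<Rightarrow> ('u \<Rightarrow> 'u) \<Rightarrow> 'm \<Rightarrow> 'm"

definition sets_of :: "('i, 'u, 'm) mfun \<Rightarrow> ('i, 'u, 'm) sfun" where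
  "sets_of M = \<lparr>obj = (\<lambda>i. carrier (mobj M i)), mor = mmor M\<rparr>"

definition mrestr :: "('u alg, 'u, 'm) mfun \<Rightarrow> ('u alg \<times> ('u \<Rightarrow> 'u), 'u, 'm) mfun" where
  "mrestr M = \<lparr>mobj = (\<lambda>i. mobj M (fst i)), mmor = (\<lambda>i j. mmor M (fst i) (fst j))\<rparr>"

definition module_functor :: "('i, 'u) algcat \<Rightarrow> ('i, 'u, 'm) mfun \<Rightarrow> bool" where
  "module_functor C M \<longleftrightarrow>
     set_functor C (sets_of M) \<and>
     (\<forall>i\<in>Obj C. module (und C i) (mobj M i)) \<and>
     (\<forall>i\<in>Obj C. \<forall>j\<in>Obj C. \<forall>\<phi>\<in>Arr C i j.
        (\<forall>x\<in>carrier (mobj M i). \<forall>y\<in>carrier (mobj M i).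
           mmor M i j \<phi> (x \<oplus>\<^bsub>mobj M i\<^esub> y) = mmor M i j \<phi> x \<oplus>\<^bsub>mobj M j\<^esub> mmor M i j \<phi> y) \<and>
        (\<forall>r\<in>carrier (und C i). \<forall>x\<in>carrier (mobj M i).
           mmor M i j \<phi> (r \<odot>\<^bsub>mobj M i\<^esub> x) = \<phi> r \<odot>\<^bsub>mobj M j\<^esub> mmor M i j \<phi> x))"

text \<open>Associative unital algebras; the library locale \<^locale>\<open>algebra\<close> is the commutative case.\<close>

definition assoc_algebra :: "'u alg \<Rightarrow> ('u, 'm) module \<Rightarrow> bool" where
  "assoc_algebra R A \<longleftrightarrow>
     module R A \<and> ring A \<and>
     (\<forall>r\<in>carrier R. \<forall>x\<in>carrier A. \<forall>y\<in>carrier A.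
        (r \<odot>\<^bsub>A\<^esub> x) \<otimes>\<^bsub>A\<^esub> y = r \<odot>\<^bsub>A\<^esub> (x \<otimes>\<^bsub>A\<^esub> y) \<and>
        x \<otimes>\<^bsub>A\<^esub> (r \<odot>\<^bsub>A\<^esub> y) = r \<odot>\<^bsub>A\<^esub> (x \<otimes>\<^bsub>A\<^esub> y))"

definition algebra_functor :: "('i, 'u) algcat \<Rightarrow> ('i, 'u, 'm) mfun \<Rightarrow> bool" where
  "algebra_functor C A \<longleftrightarrow>
     module_functor C A \<and>
     (\<forall>i\<in>Obj C. assoc_algebra (und C i) (mobj A i)) \<and>
     (\<forall>i\<in>Obj C. \<forall>j\<in>Obj C. \<forall>\<phi>\<in>Arr C i j. mmor A i j \<phi> \<in> ring_hom (mobj A i) (mobj A j))"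

definition module_homs ::
  "('i, 'u) algcat \<Rightarrow> ('i, 'u, 'm) mfun \<Rightarrow> ('i, 'u, 'n) mfun \<Rightarrow> ('i \<Rightarrow> 'm \<Rightarrow> 'n) set" where
  "module_homs C M N =
     {\<eta> \<in> set_homs C (sets_of M) (sets_of N). \<forall>i\<in>Obj C.
        (\<forall>x\<in>carrier (mobj M i). \<forall>y\<in>carrier (mobj M i).
           \<eta> i (x \<oplus>\<^bsub>mobj M i\<^esub> y) = \<eta> i x \<oplus>\<^bsub>mobj N i\<^esub> \<eta> i y) \<and>
        (\<forall>r\<in>carrier (und C i). \<forall>x\<in>carrier (mobj M i).
           \<eta> i (r \<odot>\<^bsub>mobj M i\<^esub> x) = r \<odot>\<^bsub>mobj N i\<^esub> \<eta> i x)}"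

definition algebra_homs ::
  "('i, 'u) algcat \<Rightarrow> ('i, 'u, 'm) mfun \<Rightarrow> ('i, 'u, 'n) mfun \<Rightarrow> ('i \<Rightarrow> 'm \<Rightarrow> 'n) set" where
  "algebra_homs C A B =
     {\<eta> \<in> module_homs C A B. \<forall>i\<in>Obj C.
        (\<forall>x\<in>carrier (mobj A i). \<forall>y\<in>carrier (mobj A i).
           \<eta> i (x \<otimes>\<^bsub>mobj A i\<^esub> y) = \<eta> i x \<otimes>\<^bsub>mobj B i\<^esub> \<eta> i y) \<and>
        \<eta> i \<one>\<^bsub>mobj A i\<^esub> = \<one>\<^bsub>mobj B i\<^esub>}"

definition module_iso ::
  "('i, 'u) algcat \<Rightarrow> ('i, 'u, 'm) mfun \<Rightarrow> ('i, 'u, 'n) mfun \<Rightarrow> ('i \<Rightarrow> 'm \<Rightarrow> 'n) \<Rightarrow> bool" where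
  "module_iso C M N \<eta> \<longleftrightarrow>
     \<eta> \<in> module_homs C M N \<and>
     (\<exists>\<theta>\<in>module_homs C N M. \<forall>i\<in>Obj C.
        (\<forall>x\<in>carrier (mobj M i). \<theta> i (\<eta> i x) = x) \<and>
        (\<forall>y\<in>carrier (mobj N i). \<eta> i (\<theta> i y) = y))"

text \<open>The functor \<open>\<K>\<close>, i.e. \<open>\<K>(S) = S\<close>, with \<open>S\<close> regarded as an \<open>S\<close>-algebra.\<close>

definition Kfun :: "('u alg, 'u, 'u) mfun" where
  "Kfun = \<lparr>mobj = (\<lambda>S. S\<lparr>smult := monoid.mult S\<rparr>), mmor = (\<lambda>S S' \<phi>. \<phi>)\<rparr>"


section \<open>Internal Hom, duals, functions and spectra\<close>

text \<open>
  In the following functors of families, an arrow \<open>\<theta> : S \<rightarrow> S'\<close> acts by restricting scalars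
  along \<open>\<theta>\<close>: the new family at \<open>\<phi> : S' \<rightarrow> R\<close> is the old family at \<open>\<phi> \<circ> \<theta> : S \<rightarrow> R\<close>.
\<close>

definition base_change ::
  "'u ring \<Rightarrow> 'u alg \<Rightarrow> 'u alg \<Rightarrow> ('u \<Rightarrow> 'u) \<Rightarrow>
   ('u alg \<times> ('u \<Rightarrow> 'u) \<Rightarrow> 'a) \<Rightarrow> ('u alg \<times> ('u \<Rightarrow> 'u) \<Rightarrow> 'a)" where
  "base_change K S S' \<theta> \<eta> =
     (\<lambda>(R, \<phi>)\<in>Obj (algs_under K S'). \<eta> (R, compose (carrier S) \<phi> \<theta>))"

definition ihom ::
  "'u ring \<Rightarrow> ('u alg, 'u, 'm) mfun \<Rightarrow> ('u alg, 'u, 'n) mfun \<Rightarrow>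
   ('u alg, 'u, 'u alg \<times> ('u \<Rightarrow> 'u) \<Rightarrow> 'm \<Rightarrow> 'n) mfun" where
  "ihom K M N =
     \<lparr>mobj = (\<lambda>S.
        \<lparr>carrier = module_homs (algs_under K S) (mrestr M) (mrestr N),
         monoid.mult = undefined,
         one = undefined,
         ring.zero = (\<lambda>(R, \<phi>)\<in>Obj (algs_under K S). \<lambda>x\<in>carrier (mobj M R). \<zero>\<^bsub>mobj N R\<^esub>),
         ring.add = (\<lambda>\<eta> \<theta>. \<lambda>(R, \<phi>)\<in>Obj (algs_under K S). \<lambda>x\<in>carrier (mobj M R).
                  \<eta> (R, \<phi>) x \<oplus>\<^bsub>mobj N R\<^esub> \<theta> (R, \<phi>) x),
         smult = (\<lambda>s \<eta>. \<lambda>(R, \<phi>)\<in>Obj (algs_under K S). \<lambda>x\<in>carrier (mobj M R).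
                  \<phi> s \<odot>\<^bsub>mobj N R\<^esub> \<eta> (R, \<phi>) x)\<rparr>),
      mmor = base_change K\<rparr>"

definition dual ::
  "'u ring \<Rightarrow> ('u alg, 'u, 'm) mfun \<Rightarrow>
   ('u alg, 'u, 'u alg \<times> ('u \<Rightarrow> 'u) \<Rightarrow> 'm \<Rightarrow> 'u) mfun" where
  "dual K M = ihom K M Kfun"

definition dual_hom ::
  "'u ring \<Rightarrow> ('u alg, 'u, 'm) mfun \<Rightarrow> ('u alg, 'u, 'n) mfun \<Rightarrow> ('u alg \<Rightarrow> 'm \<Rightarrow> 'n) \<Rightarrow>
   'u alg \<Rightarrow> ('u alg \<times> ('u \<Rightarrow> 'u) \<Rightarrow> 'n \<Rightarrow> 'u) \<Rightarrow> ('u alg \<times> ('u \<Rightarrow> 'u) \<Rightarrow> 'm \<Rightarrow> 'u)" where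
  "dual_hom K M N f =
     (\<lambda>S\<in>Obj (algs K). \<lambda>\<omega>\<in>carrier (mobj (dual K N) S).
        \<lambda>(R, \<phi>)\<in>Obj (algs_under K S). \<lambda>x\<in>carrier (mobj M R). \<omega> (R, \<phi>) (f R x))"

definition bidual_map ::
  "'u ring \<Rightarrow> ('u alg, 'u, 'm) mfun \<Rightarrow>
   'u alg \<Rightarrow> 'm \<Rightarrow> 'u alg \<times> ('u \<Rightarrow> 'u) \<Rightarrow> ('u alg \<times> ('u \<Rightarrow> 'u) \<Rightarrow> 'm \<Rightarrow> 'u) \<Rightarrow> 'u" where
  "bidual_map K M =
     (\<lambda>S\<in>Obj (algs K). \<lambda>x\<in>carrier (mobj M S).
        \<lambda>(R, \<phi>)\<in>Obj (algs_under K S). \<lambda>\<omega>\<in>carrier (mobj (dual K M) R).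
          \<omega> (R, id_on R) (mmor M S R \<phi> x))"

definition reflexive :: "'u ring \<Rightarrow> ('u alg, 'u, 'm) mfun \<Rightarrow> bool" where
  "reflexive K M \<longleftrightarrow> module_iso (algs K) M (dual K (dual K M)) (bidual_map K M)"

text \<open>The functor of functions \<open>\<A>\<^sub>X\<close>.\<close>

definition funs ::
  "'u ring \<Rightarrow> ('u alg, 'u, 'x) sfun \<Rightarrow>
   ('u alg, 'u, 'u alg \<times> ('u \<Rightarrow> 'u) \<Rightarrow> 'x \<Rightarrow> 'u) mfun" where
  "funs K X =
     \<lparr>mobj = (\<lambda>S.
        \<lparr>carrier = set_homs (algs_under K S) (srestr X) (sets_of (mrestr Kfun)),
         monoid.mult = (\<lambda>f g. \<lambda>(R, \<phi>)\<in>Obj (algs_under K S). \<lambda>x\<in>obj X R.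
                  f (R, \<phi>) x \<otimes>\<^bsub>R\<^esub> g (R, \<phi>) x),
         one = (\<lambda>(R, \<phi>)\<in>Obj (algs_under K S). \<lambda>x\<in>obj X R. \<one>\<^bsub>R\<^esub>),
         ring.zero = (\<lambda>(R, \<phi>)\<in>Obj (algs_under K S). \<lambda>x\<in>obj X R. \<zero>\<^bsub>R\<^esub>),
         ring.add = (\<lambda>f g. \<lambda>(R, \<phi>)\<in>Obj (algs_under K S). \<lambda>x\<in>obj X R.
                  f (R, \<phi>) x \<oplus>\<^bsub>R\<^esub> g (R, \<phi>) x),
         smult = (\<lambda>s f. \<lambda>(R, \<phi>)\<in>Obj (algs_under K S). \<lambda>x\<in>obj X R.
                  \<phi> s \<otimes>\<^bsub>R\<^esub> f (R, \<phi>) x)\<rparr>),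
      mmor = base_change K\<rparr>"

text \<open>The morphism \<open>\<A>\<^sub>Y \<rightarrow> \<A>\<^sub>X\<close>, \<open>f \<mapsto> f \<circ> h\<close>, induced by \<open>h : X \<rightarrow> Y\<close>.\<close>

definition pullback ::
  "'u ring \<Rightarrow> ('u alg, 'u, 'x) sfun \<Rightarrow> ('u alg, 'u, 'y) sfun \<Rightarrow> ('u alg \<Rightarrow> 'x \<Rightarrow> 'y) \<Rightarrow>
   'u alg \<Rightarrow> ('u alg \<times> ('u \<Rightarrow> 'u) \<Rightarrow> 'y \<Rightarrow> 'u) \<Rightarrow> ('u alg \<times> ('u \<Rightarrow> 'u) \<Rightarrow> 'x \<Rightarrow> 'u)" where
  "pullback K X Y h =
     (\<lambda>S\<in>Obj (algs K). \<lambda>f\<in>carrier (mobj (funs K Y) S).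
        \<lambda>(R, \<phi>)\<in>Obj (algs_under K S). \<lambda>x\<in>obj X R. f (R, \<phi>) (h R x))"

text \<open>
  \<open>(Spec A)(S)\<close> consists of the algebra morphisms from \<open>A\<close> to \<open>\<S>\<close>; here, as in the internal Hom,
  \<open>\<S>\<close> is the restriction of \<open>\<K>\<close> to commutative \<open>S\<close>-algebras, and \<open>A\<close> is restricted accordingly.
\<close>

definition Spec ::
  "'u ring \<Rightarrow> ('u alg, 'u, 'm) mfun \<Rightarrow>
   ('u alg, 'u, 'u alg \<times> ('u \<Rightarrow> 'u) \<Rightarrow> 'm \<Rightarrow> 'u) sfun" where
  "Spec K A = \<lparr>obj = (\<lambda>S. algebra_homs (algs_under K S) (mrestr A) (mrestr Kfun)),
               mor = base_change K\<rparr>"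

text \<open>
  Evaluation at points, \<open>x \<mapsto> (f \<mapsto> f(x))\<close>: it is the canonical morphism \<open>X \<rightarrow> Spec \<A>\<^sub>X\<close>
  and, composed with the inclusion \<open>Spec \<A>\<^sub>X \<subseteq> \<A>\<^sub>X\<^sup>*\<close>, the canonical morphism \<open>X \<rightarrow> \<A>\<^sub>X\<^sup>*\<close>.
\<close>

definition eval_map ::
  "'u ring \<Rightarrow> ('u alg, 'u, 'x) sfun \<Rightarrow>
   'u alg \<Rightarrow> 'x \<Rightarrow> 'u alg \<times> ('u \<Rightarrow> 'u) \<Rightarrow> ('u alg \<times> ('u \<Rightarrow> 'u) \<Rightarrow> 'x \<Rightarrow> 'u) \<Rightarrow> 'u" where
  "eval_map K X =
     (\<lambda>S\<in>Obj (algs K). \<lambda>x\<in>obj X S.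
        \<lambda>(R, \<phi>)\<in>Obj (algs_under K S). \<lambda>f\<in>carrier (mobj (funs K X) R).
          f (R, id_on R) (mor X S R \<phi> x))"

definition affine :: "'u ring \<Rightarrow> ('u alg, 'u, 'x) sfun \<Rightarrow> bool" where
  "affine K X \<longleftrightarrow>
     set_functor (algs K) X \<and>
     reflexive K (funs K X) \<and>
     set_iso (algs K) X (Spec K (funs K X)) (eval_map K X)"


section \<open>Tensor products\<close>

text \<open>
  \<open>M \<otimes>\<^sub>R N\<close> is the free abelian group on \<open>M \<times> N\<close> modulo the usual relations; its elements are
  cosets. A map of generators induces a map of tensor products by sending a coset to the coset
  that contains its image (\<open>coset_map\<close>).
\<close>

definition tensor_free :: "('u, 'm) module \<Rightarrow> ('u, 'n) module \<Rightarrow> ('m \<times> 'n \<Rightarrow>\<^sub>0 int) monoid" where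
  "tensor_free M N = free_Abelian_group (carrier M \<times> carrier N)"

definition tensor_rel ::
  "'u alg \<Rightarrow> ('u, 'm) module \<Rightarrow> ('u, 'n) module \<Rightarrow> ('m \<times> 'n \<Rightarrow>\<^sub>0 int) set" where
  "tensor_rel R M N = generate (tensor_free M N)
     ({frag_of (x \<oplus>\<^bsub>M\<^esub> x', y) - frag_of (x, y) - frag_of (x', y) | x x' y.
         x \<in> carrier M \<and> x' \<in> carrier M \<and> y \<in> carrier N} \<union>
      {frag_of (x, y \<oplus>\<^bsub>N\<^esub> y') - frag_of (x, y) - frag_of (x, y') | x y y'.
         x \<in> carrier M \<and> y \<in> carrier N \<and> y' \<in> carrier N} \<union>
      {frag_of (r \<odot>\<^bsub>M\<^esub> x, y) - frag_of (x, r \<odot>\<^bsub>N\<^esub> y) | r x y.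
         r \<in> carrier R \<and> x \<in> carrier M \<and> y \<in> carrier N})"

definition pure_tensor ::
  "'u alg \<Rightarrow> ('u, 'm) module \<Rightarrow> ('u, 'n) module \<Rightarrow> 'm \<Rightarrow> 'n \<Rightarrow> ('m \<times> 'n \<Rightarrow>\<^sub>0 int) set" where
  "pure_tensor R M N x y = tensor_rel R M N #>\<^bsub>tensor_free M N\<^esub> frag_of (x, y)"

definition coset_map ::
  "'u alg \<Rightarrow> ('u, 'm) module \<Rightarrow> ('u, 'n) module \<Rightarrow> ('p \<Rightarrow> 'm \<times> 'n) \<Rightarrow>
   ('p \<Rightarrow>\<^sub>0 int) set \<Rightarrow> ('m \<times> 'n \<Rightarrow>\<^sub>0 int) set" where
  "coset_map R M N h t =
     tensor_rel R M N <#>\<^bsub>tensor_free M N\<^esub> (frag_extend (\<lambda>p. frag_of (h p)) ` t)"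

definition tensor ::
  "'u alg \<Rightarrow> ('u, 'm) module \<Rightarrow> ('u, 'n) module \<Rightarrow> ('u, ('m \<times> 'n \<Rightarrow>\<^sub>0 int) set) module" where
  "tensor R M N =
     \<lparr>carrier = carrier (tensor_free M N Mod tensor_rel R M N),
      monoid.mult = undefined,
      one = undefined,
      ring.zero = \<one>\<^bsub>tensor_free M N Mod tensor_rel R M N\<^esub>,
      ring.add = monoid.mult (tensor_free M N Mod tensor_rel R M N),
      smult = (\<lambda>r. coset_map R M N (\<lambda>(x, y). (r \<odot>\<^bsub>M\<^esub> x, y)))\<rparr>"

definition tensor_fun ::
  "('u alg, 'u, 'm) mfun \<Rightarrow> ('u alg, 'u, 'n) mfun \<Rightarrow>
   ('u alg, 'u, ('m \<times> 'n \<Rightarrow>\<^sub>0 int) set) mfun" where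
  "tensor_fun M N =
     \<lparr>mobj = (\<lambda>S. tensor S (mobj M S) (mobj N S)),
      mmor = (\<lambda>S S' \<phi>. coset_map S' (mobj M S') (mobj N S')
                (map_prod (mmor M S S' \<phi>) (mmor N S S' \<phi>)))\<rparr>"


section \<open>Structures of functor of monoids\<close>

definition monoid_at ::
  "('u alg, 'u, 'x) sfun \<Rightarrow> ('u alg \<Rightarrow> 'x \<times> 'x \<Rightarrow> 'x) \<times> ('u alg \<Rightarrow> unit \<Rightarrow> 'x) \<Rightarrow>
   'u alg \<Rightarrow> 'x monoid" where
  "monoid_at X s S =
     \<lparr>carrier = obj X S, monoid.mult = (\<lambda>x y. fst s S (x, y)), one = snd s S ()\<rparr>"

definition monoid_structures ::
  "'u ring \<Rightarrow> ('u alg, 'u, 'x) sfun \<Rightarrow>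
   (('u alg \<Rightarrow> 'x \<times> 'x \<Rightarrow> 'x) \<times> ('u alg \<Rightarrow> unit \<Rightarrow> 'x)) set" where
  "monoid_structures K X =
     {s \<in> set_homs (algs K) (sprod X X) X \<times> set_homs (algs K) spoint X.
        \<forall>S\<in>Obj (algs K). monoid (monoid_at X s S)}"

definition monoid_homs ::
  "'u ring \<Rightarrow>
   ('u alg, 'u, 'x) sfun \<Rightarrow> ('u alg \<Rightarrow> 'x \<times> 'x \<Rightarrow> 'x) \<times> ('u alg \<Rightarrow> unit \<Rightarrow> 'x) \<Rightarrow>
   ('u alg, 'u, 'y) sfun \<Rightarrow> ('u alg \<Rightarrow> 'y \<times> 'y \<Rightarrow> 'y) \<times> ('u alg \<Rightarrow> unit \<Rightarrow> 'y) \<Rightarrow>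
   ('u alg \<Rightarrow> 'x \<Rightarrow> 'y) set" where
  "monoid_homs K X s Y t =
     {h \<in> set_homs (algs K) X Y. \<forall>S\<in>Obj (algs K).
        h S \<in> hom (monoid_at X s S) (monoid_at Y t S) \<and>
        h S \<one>\<^bsub>monoid_at X s S\<^esub> = \<one>\<^bsub>monoid_at Y t S\<^esub>}"


section \<open>Structures of functor of bialgebras\<close>

text \<open>
  A structure of functor of algebras on a functor of modules \<open>M\<close> is a pair of morphisms
  \<open>m : M \<otimes> M \<rightarrow> M\<close> and \<open>u : \<K> \<rightarrow> M\<close> of functors of modules for which \<open>with_mult M (m, u)\<close>
  is a functor of algebras.
\<close>

type_synonym ('u, 'm) mult_unit =
  "('u alg \<Rightarrow> ('m \<times> 'm \<Rightarrow>\<^sub>0 int) set \<Rightarrow> 'm) \<times> ('u alg \<Rightarrow> 'u \<Rightarrow> 'm)"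

definition with_mult ::
  "('u alg, 'u, 'm) mfun \<Rightarrow> ('u, 'm) mult_unit \<Rightarrow> ('u alg, 'u, 'm) mfun" where
  "with_mult M b =
     M\<lparr>mobj := (\<lambda>S. mobj M S
         \<lparr>monoid.mult := (\<lambda>x y. fst b S (pure_tensor S (mobj M S) (mobj M S) x y)),
          one := snd b S \<one>\<^bsub>S\<^esub>\<rparr>)\<rparr>"

definition algebra_structures ::
  "'u ring \<Rightarrow> ('u alg, 'u, 'm) mfun \<Rightarrow> ('u, 'm) mult_unit set" where
  "algebra_structures K M =
     {b \<in> module_homs (algs K) (tensor_fun M M) M \<times> module_homs (algs K) Kfun M.
        algebra_functor (algs K) (with_mult M b)}"

abbreviation funs_dual ::
  "'u ring \<Rightarrow> ('u alg, 'u, 'x) sfun \<Rightarrow>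
   ('u alg, 'u,
    'u alg \<times> ('u \<Rightarrow> 'u) \<Rightarrow> ('u alg \<times> ('u \<Rightarrow> 'u) \<Rightarrow> 'x \<Rightarrow> 'u) \<Rightarrow> 'u) mfun" where
  "funs_dual K X \<equiv> dual K (funs K X)"

text \<open>
  The identification \<open>(\<A>\<^sub>X\<^sup>* \<otimes> \<A>\<^sub>X\<^sup>*)\<^sup>* = \<A>\<^bsub>X \<times> X\<^esub>\<close>, which sends \<open>\<omega>\<close> to the function
  \<open>(x, y) \<mapsto> \<omega>(x \<otimes> y)\<close>.
\<close>

definition tensor_dual_to_funs ::
  "'u ring \<Rightarrow> ('u alg, 'u, 'x) sfun \<Rightarrow> 'u alg \<Rightarrow>
   ('u alg \<times> ('u \<Rightarrow> 'u) \<Rightarrow>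
     (('u alg \<times> ('u \<Rightarrow> 'u) \<Rightarrow> ('u alg \<times> ('u \<Rightarrow> 'u) \<Rightarrow> 'x \<Rightarrow> 'u) \<Rightarrow> 'u) \<times>
      ('u alg \<times> ('u \<Rightarrow> 'u) \<Rightarrow> ('u alg \<times> ('u \<Rightarrow> 'u) \<Rightarrow> 'x \<Rightarrow> 'u) \<Rightarrow> 'u) \<Rightarrow>\<^sub>0 int) set \<Rightarrow> 'u) \<Rightarrow>
   'u alg \<times> ('u \<Rightarrow> 'u) \<Rightarrow> 'x \<times> 'x \<Rightarrow> 'u" where
  "tensor_dual_to_funs K X =
     (\<lambda>S\<in>Obj (algs K).
      \<lambda>\<omega>\<in>carrier (mobj (dual K (tensor_fun (funs_dual K X) (funs_dual K X))) S).
      \<lambda>(R, \<phi>)\<in>Obj (algs_under K S). \<lambda>(x, y)\<in>obj X R \<times> obj X R.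
        \<omega> (R, \<phi>) (pure_tensor R (mobj (funs_dual K X) R) (mobj (funs_dual K X) R)
                   (eval_map K X R x) (eval_map K X R y)))"

text \<open>\<open>(\<A>\<^sub>X\<^sup>* \<otimes> \<A>\<^sub>X\<^sup>*)\<^sup>*\<close> with the algebra structure transported from \<open>\<A>\<^bsub>X \<times> X\<^esub>\<close>.\<close>

definition tensor_dual_alg where
  "tensor_dual_alg K X =
     (let T = dual K (tensor_fun (funs_dual K X) (funs_dual K X));
          F = funs K (sprod X X);
          to = tensor_dual_to_funs K X;
          back = (\<lambda>S. inv_into (carrier (mobj T S)) (to S))
      in T\<lparr>mobj := (\<lambda>S. mobj T S
             \<lparr>monoid.mult := (\<lambda>\<omega> \<omega>'. back S (to S \<omega> \<otimes>\<^bsub>mobj F S\<^esub> to S \<omega>')),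
              one := back S \<one>\<^bsub>mobj F S\<^esub>\<rparr>)\<rparr>)"

text \<open>
  \<open>m\<^sup>*\<close> and \<open>u\<^sup>*\<close> as morphisms on \<open>\<A>\<^sub>X\<close> itself: compose the dual morphisms with the canonical
  \<open>\<A>\<^sub>X \<rightarrow> \<A>\<^sub>X\<^sup>*\<^sup>*\<close> and, for \<open>u\<^sup>*\<close>, with the identification \<open>\<K>\<^sup>* = \<K>\<close>, \<open>\<omega> \<mapsto> \<omega>(1)\<close>.
\<close>

definition comult where
  "comult K X m =
     (\<lambda>S\<in>Obj (algs K). \<lambda>f\<in>carrier (mobj (funs K X) S).
        dual_hom K (tensor_fun (funs_dual K X) (funs_dual K X)) (funs_dual K X) m S
          (bidual_map K (funs K X) S f))"

definition counit where
  "counit K X u =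
     (\<lambda>S\<in>Obj (algs K). \<lambda>f\<in>carrier (mobj (funs K X) S).
        dual_hom K Kfun (funs_dual K X) u S (bidual_map K (funs K X) S f) (S, id_on S) \<one>\<^bsub>S\<^esub>)"

definition bialgebra_structures where
  "bialgebra_structures K X =
     {b \<in> algebra_structures K (funs_dual K X).
        comult K X (fst b) \<in> algebra_homs (algs K) (funs K X) (tensor_dual_alg K X) \<and>
        counit K X (snd b) \<in> algebra_homs (algs K) (funs K X) Kfun}"

text \<open>Morphisms of functors of bialgebras \<open>\<A>\<^sub>Y \<rightarrow> \<A>\<^sub>X\<close>.\<close>

definition bialgebra_homs where
  "bialgebra_homs K Y c X b =
     {f \<in> algebra_homs (algs K) (funs K Y) (funs K X).
        dual_hom K (funs K Y) (funs K X) f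
          \<in> algebra_homs (algs K) (with_mult (funs_dual K X) b) (with_mult (funs_dual K Y) c)}"

text \<open>
  The monoid structure \<open>s = (\<mu>, e)\<close> on \<open>X\<close> and the bialgebra structure \<open>b = (m, u)\<close> on \<open>\<A>\<^sub>X\<close>
  correspond to each other if, under \<open>(\<A>\<^sub>X\<^sup>* \<otimes> \<A>\<^sub>X\<^sup>*)\<^sup>* = \<A>\<^bsub>X \<times> X\<^esub>\<close>, the comultiplication \<open>m\<^sup>*\<close>
  is \<open>f \<mapsto> f \<circ> \<mu>\<close> and the counit \<open>u\<^sup>*\<close> is \<open>f \<mapsto> f(e)\<close>.
\<close>

definition corresponding where
  "corresponding K X s b \<longleftrightarrow>
     (\<forall>S\<in>Obj (algs K). \<forall>f\<in>carrier (mobj (funs K X) S).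
        tensor_dual_to_funs K X S (comult K X (fst b) S f) =
          pullback K (sprod X X) X (fst s) S f \<and>
        counit K X (snd b) S f = f (S, id_on S) (snd s S ()))"

end

theory Submission
  imports Defs
begin

text \<open>
  Reflexivity of \<open>A = \<A>\<^sub>X\<close> says that a linear form on \<open>A\<^sup>*\<close> is evaluation at a function \<open>f\<close>, and \<open>f\<close> is recovered
  from the values of the form at the points \<open>ev\<^sub>x\<close>. Hence linear maps from \<open>A\<^sup>*\<close> to a dual are determined by
  their values at points, and so are bilinear ones, one variable at a time. Conversely a function \<open>F\<close> on
  \<open>X \<times> X\<close> extends to the bilinear form \<open>(u, v) \<mapsto> u(x \<mapsto> v(y \<mapsto> F(x, y)))\<close> on \<open>A\<^sup>*\<close>, which gives
  \<open>(A\<^sup>* \<otimes> A\<^sup>*)\<^sup>* = \<A>\<^bsub>X \<times> X\<^esub>\<close>.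

  A monoid structure and a bialgebra structure correspond to each other iff \<open>ev\<^sub>x * ev\<^sub>y = ev\<^bsub>xy\<^esub>\<close> and the unit of
  \<open>A\<^sup>*\<close> is \<open>ev\<^sub>e\<close>. Given a monoid, all algebra laws of the convolution product need only be checked at points.
  Given an algebra structure on \<open>A\<^sup>*\<close>, the maps \<open>m\<^sup>*\<close> and \<open>u\<^sup>*\<close> are multiplicative iff the products \<open>ev\<^sub>x * ev\<^sub>y\<close>
  and the unit lie in \<open>Spec A = X\<close>, so that multiplication restricts to \<open>X\<close>. Likewise the transpose of a
  bialgebra morphism maps \<open>Spec\<close> to \<open>Spec\<close> and restricts to a monoid morphism.
\<close>


section \<open>Tensor products\<close>

text \<open>Elements of Hom sets are extensional, so constructions are carried out on plain families
  \<open>P R \<phi> x\<close>, whose naturality and linearity compose freely, and are cut down to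
  extensional functions at the end. A value over a structure morphism \<phi> : S \<rightarrow> R is
  reduced, where possible, to a value over \<open>id_on R\<close> after base change to R. That
  points determine a linear map has to be formulated over every base S: freezing one argument of a
  bilinear map at an element defined over R replaces the base S by R. The multiplication m belonging
  to a product \<mu> on X is not written down directly. With D the dual of A, morphisms from A to
  the dual of D \<otimes> D and morphisms from D \<otimes> D to D are exchanged by swapping the two
  arguments of the pairing, so m is obtained from the comultiplication that f \<mapsto> f \<circ>
  \<mu> prescribes.\<close>

definition tensor_gens ::
  "'u alg \<Rightarrow> ('u, 'm) module \<Rightarrow> ('u, 'n) module \<Rightarrow> ('m \<times> 'n \<Rightarrow>\<^sub>0 int) set" where
  "tensor_gens R M N =
     {frag_of (x \<oplus>\<^bsub>M\<^esub> x', y) - frag_of (x, y) - frag_of (x', y) | x x' y.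
         x \<in> carrier M \<and> x' \<in> carrier M \<and> y \<in> carrier N} \<union>
      {frag_of (x, y \<oplus>\<^bsub>N\<^esub> y') - frag_of (x, y) - frag_of (x, y') | x y y'.
         x \<in> carrier M \<and> y \<in> carrier N \<and> y' \<in> carrier N} \<union>
      {frag_of (r \<odot>\<^bsub>M\<^esub> x, y) - frag_of (x, r \<odot>\<^bsub>N\<^esub> y) | r x y.
         r \<in> carrier R \<and> x \<in> carrier M \<and> y \<in> carrier N}"

lemma tensor_rel_generate: "tensor_rel R M N = generate (tensor_free M N) (tensor_gens R M N)"
  unfolding tensor_rel_def tensor_gens_def ..

lemma tensor_gens_cases:
  assumes "g \<in> tensor_gens R M N"
  obtains (left) x x' y where "x \<in> carrier M" "x' \<in> carrier M" "y \<in> carrier N"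
      "g = frag_of (x \<oplus>\<^bsub>M\<^esub> x', y) - frag_of (x, y) - frag_of (x', y)"
    | (right) x y y' where "x \<in> carrier M" "y \<in> carrier N" "y' \<in> carrier N"
      "g = frag_of (x, y \<oplus>\<^bsub>N\<^esub> y') - frag_of (x, y) - frag_of (x, y')"
    | (smult) r x y where "r \<in> carrier R" "x \<in> carrier M" "y \<in> carrier N"
      "g = frag_of (r \<odot>\<^bsub>M\<^esub> x, y) - frag_of (x, r \<odot>\<^bsub>N\<^esub> y)"
  using assms unfolding tensor_gens_def by blast

lemma keys_diff_subset: "Poly_Mapping.keys a \<subseteq> A \<Longrightarrow> Poly_Mapping.keys b \<subseteq> A \<Longrightarrow> Poly_Mapping.keys (a - b) \<subseteq> A"
  for a b :: "'a \<Rightarrow>\<^sub>0 int"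
  using keys_diff[of a b] by blast

context
  fixes R :: "'u alg" and M :: "('u, 'm) module" and N :: "('u, 'n) module"
  assumes M: "module R M" and N: "module R N"
begin

interpretation M: module R M by (rule M)
interpretation N: module R N by (rule N)

lemma tensor_gens_subset: "tensor_gens R M N \<subseteq> carrier (tensor_free M N)"
proof
  fix g assume "g \<in> tensor_gens R M N"
  then show "g \<in> carrier (tensor_free M N)"
    by (cases rule: tensor_gens_cases) (simp_all add: tensor_free_def, (intro keys_diff_subset; simp)+)
qed

text \<open>In a commutative group every subgroup is normal, so the quotient by the relations is a
  group and cosets can be added through representatives.\<close>

lemma tensor_rel_normal: "tensor_rel R M N \<lhd> tensor_free M N"
proof -
  interpret F: comm_group "tensor_free M N"
    unfolding tensor_free_def by (rule abelian_free_Abelian_group)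
  show ?thesis
    unfolding tensor_rel_generate
    by (rule F.subgroup_imp_normal[OF F.generate_is_subgroup[OF tensor_gens_subset]])
qed

text \<open>The group operation is addition of finitely supported maps, so \<open>a\<close> is
  \<open>(a - b) + b\<close> and lies in the coset of \<open>b\<close>. Each relation between pure
  tensors is derived by exhibiting such a difference.\<close>

lemma tensor_rcoset_eqI:
  assumes "a - b \<in> tensor_rel R M N" "b \<in> carrier (tensor_free M N)"
  shows "tensor_rel R M N #>\<^bsub>tensor_free M N\<^esub> a = tensor_rel R M N #>\<^bsub>tensor_free M N\<^esub> b"
proof -
  have "a = (a - b) \<otimes>\<^bsub>tensor_free M N\<^esub> b" by (simp add: tensor_free_def)
  with assms(1) have "a \<in> tensor_rel R M N #>\<^bsub>tensor_free M N\<^esub> b"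
    unfolding r_coset_def by blast
  then show ?thesis
    using group.repr_independence[OF _ _ assms(2) normal_imp_subgroup[OF tensor_rel_normal]]
    by (simp add: tensor_free_def)
qed

lemma tensor_gens_rel: "g \<in> tensor_gens R M N \<Longrightarrow> g \<in> tensor_rel R M N"
  unfolding tensor_rel_generate by (rule generate.incl)

lemma carrier_tensor:
  "carrier (tensor R M N) =
    (\<lambda>a. tensor_rel R M N #>\<^bsub>tensor_free M N\<^esub> a) ` carrier (tensor_free M N)"
  by (simp add: tensor_def carrier_FactGroup)

lemma add_tensor_rcoset:
  assumes "a \<in> carrier (tensor_free M N)" "b \<in> carrier (tensor_free M N)"
  shows "(tensor_rel R M N #>\<^bsub>tensor_free M N\<^esub> a) \<oplus>\<^bsub>tensor R M N\<^esub>
      (tensor_rel R M N #>\<^bsub>tensor_free M N\<^esub> b) = tensor_rel R M N #>\<^bsub>tensor_free M N\<^esub> (a + b)"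
  using normal.rcos_sum[OF tensor_rel_normal assms] by (simp add: tensor_def tensor_free_def)

lemma pure_tensor_closed:
  "x \<in> carrier M \<Longrightarrow> y \<in> carrier N \<Longrightarrow> pure_tensor R M N x y \<in> carrier (tensor R M N)"
  by (simp add: pure_tensor_def carrier_tensor tensor_free_def)

lemma tensor_add_closed:
  assumes "s \<in> carrier (tensor R M N)" "t \<in> carrier (tensor R M N)"
  shows "s \<oplus>\<^bsub>tensor R M N\<^esub> t \<in> carrier (tensor R M N)"
proof -
  have "group (tensor_free M N Mod tensor_rel R M N)"
    by (rule normal.factorgroup_is_group[OF tensor_rel_normal])
  from monoid.m_closed[OF group.is_monoid[OF this]] show ?thesis
    using assms by (simp add: tensor_def)
qed

lemma pure_tensor_add_left:
  assumes "x \<in> carrier M" "x' \<in> carrier M" "y \<in> carrier N"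
  shows "pure_tensor R M N (x \<oplus>\<^bsub>M\<^esub> x') y =
    pure_tensor R M N x y \<oplus>\<^bsub>tensor R M N\<^esub> pure_tensor R M N x' y"
proof -
  \<comment> \<open>The generator is regrouped so that the difference is taken between one
    representative of each side; the bracket represents the sum of the two pure tensors.\<close>
  have "frag_of (x \<oplus>\<^bsub>M\<^esub> x', y) - (frag_of (x, y) + frag_of (x', y)) \<in> tensor_gens R M N"
    using assms unfolding tensor_gens_def diff_diff_eq[symmetric] by blast
  from tensor_rcoset_eqI[OF tensor_gens_rel[OF this]] show ?thesis
    using assms keys_add[of "frag_of (x, y)" "frag_of (x', y)"]
    by (subst (2 3) pure_tensor_def, subst add_tensor_rcoset)
       (auto simp: pure_tensor_def tensor_free_def)
qed

lemma pure_tensor_add_right: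
  assumes "x \<in> carrier M" "y \<in> carrier N" "y' \<in> carrier N"
  shows "pure_tensor R M N x (y \<oplus>\<^bsub>N\<^esub> y') =
    pure_tensor R M N x y \<oplus>\<^bsub>tensor R M N\<^esub> pure_tensor R M N x y'"
proof -
  have "frag_of (x, y \<oplus>\<^bsub>N\<^esub> y') - (frag_of (x, y) + frag_of (x, y')) \<in> tensor_gens R M N"
    using assms unfolding tensor_gens_def diff_diff_eq[symmetric] by blast
  from tensor_rcoset_eqI[OF tensor_gens_rel[OF this]] show ?thesis
    using assms keys_add[of "frag_of (x, y)" "frag_of (x, y')"]
    by (subst (2 3) pure_tensor_def, subst add_tensor_rcoset)
       (auto simp: pure_tensor_def tensor_free_def)
qed

lemma pure_tensor_smult_swap:
  assumes "r \<in> carrier R" "x \<in> carrier M" "y \<in> carrier N"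
  shows "pure_tensor R M N (r \<odot>\<^bsub>M\<^esub> x) y = pure_tensor R M N x (r \<odot>\<^bsub>N\<^esub> y)"
proof -
  have "frag_of (r \<odot>\<^bsub>M\<^esub> x, y) - frag_of (x, r \<odot>\<^bsub>N\<^esub> y) \<in> tensor_gens R M N"
    using assms unfolding tensor_gens_def by blast
  from tensor_rcoset_eqI[OF tensor_gens_rel[OF this]] show ?thesis
    using assms by (simp add: pure_tensor_def tensor_free_def)
qed

text \<open>Sums of pure tensors exhaust the tensor product, without cases for zero or negatives:
  zero is \<open>0 \<otimes> 0\<close>, and the negative of a pure tensor is again pure because the
  sign is absorbed into the first factor.\<close>

lemma tensor_induct [consumes 1, case_names pure add]:
  assumes t: "t \<in> carrier (tensor R M N)"
    and pure: "\<And>x y. x \<in> carrier M \<Longrightarrow> y \<in> carrier N \<Longrightarrow> P (pure_tensor R M N x y)"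
    and add: "\<And>s t. s \<in> carrier (tensor R M N) \<Longrightarrow> t \<in> carrier (tensor R M N) \<Longrightarrow> P s \<Longrightarrow> P t
      \<Longrightarrow> P (s \<oplus>\<^bsub>tensor R M N\<^esub> t)"
  shows "P t"
proof -
  let ?c = "\<lambda>a. tensor_rel R M N #>\<^bsub>tensor_free M N\<^esub> a"
  obtain a where a: "Poly_Mapping.keys a \<subseteq> carrier M \<times> carrier N" "t = ?c a"
    using t by (auto simp: carrier_tensor tensor_free_def)
  have cP: "P (?c (a + b))" if "Poly_Mapping.keys a \<subseteq> carrier M \<times> carrier N" 
      "Poly_Mapping.keys b \<subseteq> carrier M \<times> carrier N" "P (?c a)" "P (?c b)" for a b
  proof -
    have "?c a \<oplus>\<^bsub>tensor R M N\<^esub> ?c b = ?c (a + b)"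
      using that by (intro add_tensor_rcoset) (auto simp: tensor_free_def)
    moreover have "?c a \<in> carrier (tensor R M N)" "?c b \<in> carrier (tensor R M N)"
      using that by (auto simp: carrier_tensor tensor_free_def)
    ultimately show ?thesis using add that by metis
  qed
  \<comment> \<open>Left additivity with both summands zero: the generator
    \<open>(0 + 0, y) - (0, y) - (0, y)\<close> is minus one copy of \<open>(0, y)\<close>.\<close>
  have null: "- frag_of (\<zero>\<^bsub>M\<^esub>, y) \<in> tensor_rel R M N" if "y \<in> carrier N" for y
  proof (rule tensor_gens_rel)
    show "- frag_of (\<zero>\<^bsub>M\<^esub>, y) \<in> tensor_gens R M N"
      unfolding tensor_gens_def using that
      by (intro UnI1 CollectI exI[of _ "\<zero>\<^bsub>M\<^esub>"] exI[of _ y]) simp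
  qed
  have zero_coset: "?c 0 = pure_tensor R M N \<zero>\<^bsub>M\<^esub> \<zero>\<^bsub>N\<^esub>"
    using tensor_rcoset_eqI[of 0 "frag_of (\<zero>\<^bsub>M\<^esub>, \<zero>\<^bsub>N\<^esub>)"] null
    by (simp add: pure_tensor_def tensor_free_def)
  have neg: "?c (- frag_of (x, y)) = pure_tensor R M N (\<ominus>\<^bsub>M\<^esub> x) y"
    if xy: "x \<in> carrier M" "y \<in> carrier N" for x y
  proof -
    \<comment> \<open>Left additivity for x and its negative; adding \<open>null\<close> afterwards
      removes the leftover term at \<open>(0, y)\<close>.\<close>
    have "frag_of (x \<oplus>\<^bsub>M\<^esub> \<ominus>\<^bsub>M\<^esub> x, y) - frag_of (x, y) - frag_of (\<ominus>\<^bsub>M\<^esub> x, y) \<in> tensor_gens R M N"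
      unfolding tensor_gens_def using xy M.a_inv_closed by blast
    then have "frag_of (\<zero>\<^bsub>M\<^esub>, y) - frag_of (x, y) - frag_of (\<ominus>\<^bsub>M\<^esub> x, y) \<in> tensor_rel R M N"
      using tensor_gens_rel xy by (simp add: M.r_neg)
    note rel = this
    have "- frag_of (\<zero>\<^bsub>M\<^esub>, y) + (frag_of (\<zero>\<^bsub>M\<^esub>, y) - frag_of (x, y) - frag_of (\<ominus>\<^bsub>M\<^esub> x, y))
        \<in> tensor_rel R M N"
      using subgroup.m_closed[OF normal_imp_subgroup[OF tensor_rel_normal] null[OF xy(2)] rel]
      by (simp add: tensor_free_def)
    then show ?thesis
      using tensor_rcoset_eqI[of "- frag_of (x, y)" "frag_of (\<ominus>\<^bsub>M\<^esub> x, y)"] xy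
      by (simp add: pure_tensor_def tensor_free_def)
  qed
  \<comment> \<open>The claim is proved for \<open>a\<close> and \<open>- a\<close> together,
    because the induction principle builds combinations from differences, whereas the case
    \<open>add\<close> offers sums.\<close>
  have "P (?c a) \<and> P (?c (- a))" using a(1)
  proof (induction a rule: free_Abelian_group_induct[consumes 1, case_names zero diff frag])
    case zero
    then show ?case using zero_coset pure by simp
  next
    case (diff a b)
    have "P (?c (a + - b))" "P (?c (- a + b))"
      using diff by (intro cP; simp add: keys_minus)+
    then show ?case by simp
  next
    case (frag p)
    obtain x y where "p = (x, y)" by (cases p)
    with frag have p: "p = (x, y)" "x \<in> carrier M" "y \<in> carrier N" by auto
    have "P (?c (frag_of p))" using pure[OF p(2,3)] by (simp add: pure_tensor_def p(1))
    moreover have "P (?c (- frag_of p))" using pure[of "\<ominus>\<^bsub>M\<^esub> x" y] p neg by simp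
    ultimately show ?case ..
  qed
  then show ?thesis using a(2) by simp
qed

text \<open>The target is a bare abelian group and the map is only required to be balanced, so the
  induced map is merely additive. Compatibility with scalars is obtained later by induction on
  tensors, where the target is a ring of scalars.\<close>

lemma tensor_universal:
  assumes A: "abelian_group A"
    and closed: "\<And>x y. x \<in> carrier M \<Longrightarrow> y \<in> carrier N \<Longrightarrow> b x y \<in> carrier A"
    and left: "\<And>x x' y. x \<in> carrier M \<Longrightarrow> x' \<in> carrier M \<Longrightarrow> y \<in> carrier N \<Longrightarrow>
      b (x \<oplus>\<^bsub>M\<^esub> x') y = b x y \<oplus>\<^bsub>A\<^esub> b x' y"
    and right: "\<And>x y y'. x \<in> carrier M \<Longrightarrow> y \<in> carrier N \<Longrightarrow> y' \<in> carrier N \<Longrightarrow>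
      b x (y \<oplus>\<^bsub>N\<^esub> y') = b x y \<oplus>\<^bsub>A\<^esub> b x y'"
    and swap: "\<And>r x y. r \<in> carrier R \<Longrightarrow> x \<in> carrier M \<Longrightarrow> y \<in> carrier N \<Longrightarrow>
      b (r \<odot>\<^bsub>M\<^esub> x) y = b x (r \<odot>\<^bsub>N\<^esub> y)"
  obtains h where "h \<in> carrier (tensor R M N) \<rightarrow> carrier A"
    "\<And>s t. s \<in> carrier (tensor R M N) \<Longrightarrow> t \<in> carrier (tensor R M N) \<Longrightarrow>
      h (s \<oplus>\<^bsub>tensor R M N\<^esub> t) = h s \<oplus>\<^bsub>A\<^esub> h t"
    "\<And>x y. x \<in> carrier M \<Longrightarrow> y \<in> carrier N \<Longrightarrow> h (pure_tensor R M N x y) = b x y"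
proof -
  interpret A: abelian_group A by (rule A)
  have "(\<lambda>(x, y). b x y) ` (carrier M \<times> carrier N) \<subseteq> carrier (add_monoid A)"
    using closed by auto
  then obtain g where g: "g \<in> hom (tensor_free M N) (add_monoid A)"
    and g_of: "\<And>x y. x \<in> carrier M \<Longrightarrow> y \<in> carrier N \<Longrightarrow> g (frag_of (x, y)) = b x y"
    by (rule comm_group.free_Abelian_group_universal[OF A.a_comm_group]) (auto simp: tensor_free_def)
  interpret F: group "tensor_free M N" by (simp add: tensor_free_def)
  interpret g: group_hom "tensor_free M N" "add_monoid A" g
    by unfold_locales (rule g)
  have gdiff: "g (p - q) = g p \<ominus>\<^bsub>A\<^esub> g q"
    if "Poly_Mapping.keys p \<subseteq> carrier M \<times> carrier N" "Poly_Mapping.keys q \<subseteq> carrier M \<times> carrier N" for p q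
  proof -
    have "g (p - q) \<oplus>\<^bsub>A\<^esub> g q = g p"
      using g.hom_mult[of "p - q" q] keys_diff_subset[OF that] that by (simp add: tensor_free_def)
    moreover have "g (p - q) \<in> carrier A" "g q \<in> carrier A" "g p \<in> carrier A"
      using g.hom_closed keys_diff_subset[OF that] that by (auto simp: tensor_free_def)
    ultimately show ?thesis
      by (metis a_minus_def A.add.inv_solve_right')
  qed
  have cancel: "u \<oplus>\<^bsub>A\<^esub> v \<ominus>\<^bsub>A\<^esub> u \<ominus>\<^bsub>A\<^esub> v = \<zero>\<^bsub>A\<^esub>" if "u \<in> carrier A" "v \<in> carrier A" for u v
    using that A.a_assoc[of "u \<oplus>\<^bsub>A\<^esub> v" "\<ominus>\<^bsub>A\<^esub> u" "\<ominus>\<^bsub>A\<^esub> v"] A.r_neg[of "u \<oplus>\<^bsub>A\<^esub> v"]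
    by (simp add: a_minus_def A.minus_add)
  \<comment> \<open>The three kinds of generators vanish under g because of additivity in either
    argument and balancedness. The subgroup they generate then lies in the kernel, and g factors
    through the quotient.\<close>
  have "tensor_gens R M N \<subseteq> kernel (tensor_free M N) (add_monoid A) g"
  proof
    fix p assume p: "p \<in> tensor_gens R M N"
    then have "g p = \<zero>\<^bsub>A\<^esub>"
    proof (cases rule: tensor_gens_cases)
      case (left x x' y)
      then show ?thesis
        using closed[of x y] closed[of x' y] assms(3)[of x x' y]
        by (simp add: gdiff keys_diff_subset g_of cancel)
    next
      case (right x y y')
      then show ?thesis
        using closed[of x y] closed[of x y'] assms(4)[of x y y']
        by (simp add: gdiff keys_diff_subset g_of cancel)
    next
      case (smult r x y)
      then show ?thesis
        using closed[of x "r \<odot>\<^bsub>N\<^esub> y"] swap[of r x y]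
        by (simp add: gdiff g_of a_minus_def A.r_neg)
    qed
    then show "p \<in> kernel (tensor_free M N) (add_monoid A) g"
      using p tensor_gens_subset by (auto simp: kernel_def)
  qed
  then have "tensor_rel R M N \<subseteq> kernel (tensor_free M N) (add_monoid A) g"
    unfolding tensor_rel_generate
    by (rule F.generate_subgroup_incl) (rule g.subgroup_kernel)
  from g.FactGroup_universal_kernel[OF tensor_rel_normal this]
  obtain h where h: "h \<in> hom (tensor_free M N Mod tensor_rel R M N) (add_monoid A)"
    and h_coset: "\<And>a. a \<in> carrier (tensor_free M N) \<Longrightarrow> h (tensor_rel R M N #>\<^bsub>tensor_free M N\<^esub> a) = g a"
    by blast
  show thesis
  proof (rule that[of h])
    show "h \<in> carrier (tensor R M N) \<rightarrow> carrier A"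
      using h by (auto simp: hom_def tensor_def)
    show "h (s \<oplus>\<^bsub>tensor R M N\<^esub> t) = h s \<oplus>\<^bsub>A\<^esub> h t"
      if "s \<in> carrier (tensor R M N)" "t \<in> carrier (tensor R M N)" for s t
      using h that by (auto simp: hom_def tensor_def)
    show "h (pure_tensor R M N x y) = b x y" if "x \<in> carrier M" "y \<in> carrier N" for x y
      using that h_coset[of "frag_of (x, y)"] by (simp add: pure_tensor_def tensor_free_def g_of)
  qed
qed

end

section \<open>Maps between tensor products induced by semilinear maps\<close>

lemma coset_map_rcoset:
  assumes M: "module R M" and N: "module R N" and M': "module R' M'" and N': "module R' N'"
    and h: "h \<in> carrier M' \<times> carrier N' \<rightarrow> carrier M \<times> carrier N"
    and gens: "frag_extend (\<lambda>p. frag_of (h p)) ` tensor_gens R' M' N' \<subseteq> tensor_rel R M N"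
    and a: "a \<in> carrier (tensor_free M' N')"
  shows "coset_map R M N h (tensor_rel R' M' N' #>\<^bsub>tensor_free M' N'\<^esub> a) =
    tensor_rel R M N #>\<^bsub>tensor_free M N\<^esub> frag_extend (\<lambda>p. frag_of (h p)) a"
proof -
  let ?g = "frag_extend (\<lambda>p. frag_of (h p))"
  interpret H: subgroup "tensor_rel R M N" "tensor_free M N"
    by (rule normal_imp_subgroup[OF tensor_rel_normal[OF M N]])
  have Hadd: "p + q \<in> tensor_rel R M N" if "p \<in> tensor_rel R M N" "q \<in> tensor_rel R M N" for p q
    using H.m_closed[OF that] by (simp add: tensor_free_def)
  have Hneg: "- p \<in> tensor_rel R M N" if "p \<in> tensor_rel R M N" for p
    using H.m_inv_closed[OF that] H.mem_carrier[OF that] by (simp add: tensor_free_def)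
  have H0: "0 \<in> tensor_rel R M N" using H.one_closed by (simp add: tensor_free_def)
  have gens_in: "p \<in> tensor_gens R' M' N' \<Longrightarrow> Poly_Mapping.keys p \<subseteq> carrier M' \<times> carrier N'" for p
    using subsetD[OF tensor_gens_subset[OF M' N']] by (simp add: tensor_free_def)
  \<comment> \<open>The extension of h to the free group is additive, so sending generators to
    relations already sends the whole subgroup of relations to relations.\<close>
  have g: "?g p \<in> tensor_rel R M N" if "p \<in> tensor_rel R' M' N'" for p
    using that unfolding tensor_rel_generate[of R' M' N']
  proof (induction rule: generate.induct)
    case one then show ?case by (simp add: tensor_free_def H0)
  next
    case (incl p) then show ?case using gens by auto
  next
    case (inv p)
    then show ?case using gens gens_in Hneg by (auto simp: tensor_free_def frag_extend_minus)
  next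
    case (eng p q)
    then show ?case using Hadd by (simp add: tensor_free_def frag_extend_add)
  qed
  have zero': "0 \<in> tensor_rel R' M' N'"
    unfolding tensor_rel_generate using generate.one[of "tensor_free M' N'"] by (simp add: tensor_free_def)
  \<comment> \<open>The image of a coset under \<open>?g\<close> is in general only part of a coset.
    The factor \<open>tensor_rel R M N\<close> in \<open>coset_map\<close> fills it up, and the
    image of a source relation is absorbed into that factor.\<close>
  show ?thesis
  proof (intro equalityI subsetI)
    fix x assume "x \<in> coset_map R M N h (tensor_rel R' M' N' #>\<^bsub>tensor_free M' N'\<^esub> a)"
    then obtain p q where "p \<in> tensor_rel R M N" "q \<in> tensor_rel R' M' N'" "x = p + ?g (q + a)"
      by (auto simp: coset_map_def set_mult_def r_coset_def tensor_free_def)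
    then have "p + ?g q \<in> tensor_rel R M N" "x = (p + ?g q) + ?g a"
      using Hadd g by (auto simp: frag_extend_add)
    then show "x \<in> tensor_rel R M N #>\<^bsub>tensor_free M N\<^esub> ?g a"
      by (auto simp: r_coset_def tensor_free_def)
  next
    fix x assume "x \<in> tensor_rel R M N #>\<^bsub>tensor_free M N\<^esub> ?g a"
    then obtain p where p: "p \<in> tensor_rel R M N" "x = p + ?g (0 + a)"
      by (auto simp: r_coset_def tensor_free_def)
    have "0 + a \<in> tensor_rel R' M' N' #>\<^bsub>tensor_free M' N'\<^esub> a"
      unfolding r_coset_def using zero' by (auto simp: tensor_free_def)
    then show "x \<in> coset_map R M N h (tensor_rel R' M' N' #>\<^bsub>tensor_free M' N'\<^esub> a)"
      unfolding coset_map_def set_mult_def p(2) using p(1) by (auto simp: tensor_free_def)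
  qed
qed

text \<open>Both factors are semilinear along the same map \<phi> of scalars, which is what the
  balancing relation requires of the image. Two cases occur: an arrow of algebras, with \<phi>
  leading from one ring to another, and scalar multiplication over one ring, with \<phi> the
  identity.\<close>

locale semilinear_pair =
  fixes R' :: "'u alg" and M' :: "('u, 'm) module" and N' :: "('u, 'n) module"
    and R :: "'u alg" and M :: "('u, 'p) module" and N :: "('u, 'q) module"
    and \<phi> f g
  assumes modules: "module R' M'" "module R' N'" "module R M" "module R N"
    and closed: "\<phi> \<in> carrier R' \<rightarrow> carrier R" "f \<in> carrier M' \<rightarrow> carrier M" "g \<in> carrier N' \<rightarrow> carrier N"
    and add: "\<And>x y. x \<in> carrier M' \<Longrightarrow> y \<in> carrier M' \<Longrightarrow> f (x \<oplus>\<^bsub>M'\<^esub> y) = f x \<oplus>\<^bsub>M\<^esub> f y"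
      "\<And>x y. x \<in> carrier N' \<Longrightarrow> y \<in> carrier N' \<Longrightarrow> g (x \<oplus>\<^bsub>N'\<^esub> y) = g x \<oplus>\<^bsub>N\<^esub> g y"
    and smult: "\<And>r x. r \<in> carrier R' \<Longrightarrow> x \<in> carrier M' \<Longrightarrow> f (r \<odot>\<^bsub>M'\<^esub> x) = \<phi> r \<odot>\<^bsub>M\<^esub> f x"
      "\<And>r x. r \<in> carrier R' \<Longrightarrow> x \<in> carrier N' \<Longrightarrow> g (r \<odot>\<^bsub>N'\<^esub> x) = \<phi> r \<odot>\<^bsub>N\<^esub> g x"
begin

lemma coset_map_rcoset':
  assumes a: "a \<in> carrier (tensor_free M' N')"
  shows "coset_map R M N (map_prod f g) (tensor_rel R' M' N' #>\<^bsub>tensor_free M' N'\<^esub> a) =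
    tensor_rel R M N #>\<^bsub>tensor_free M N\<^esub> frag_extend (\<lambda>p. frag_of (map_prod f g p)) a"
proof (rule coset_map_rcoset[OF modules(3,4,1,2) _ _ a])
  show "map_prod f g \<in> carrier M' \<times> carrier N' \<rightarrow> carrier M \<times> carrier N"
    using closed by auto
  show "frag_extend (\<lambda>p. frag_of (map_prod f g p)) ` tensor_gens R' M' N' \<subseteq> tensor_rel R M N"
  proof
    fix q assume "q \<in> frag_extend (\<lambda>p. frag_of (map_prod f g p)) ` tensor_gens R' M' N'"
    then obtain p where p: "p \<in> tensor_gens R' M' N'" "q = frag_extend (\<lambda>p. frag_of (map_prod f g p)) p"
      by blast
    \<comment> \<open>Each generator goes to a generator of the same kind; in the balancing relation
      the scalar r becomes \<phi> r.\<close>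
    from p(1) have "q \<in> tensor_gens R M N"
    proof (cases rule: tensor_gens_cases)
      case (left x x' y)
      then have "q = frag_of (f x \<oplus>\<^bsub>M\<^esub> f x', g y) - frag_of (f x, g y) - frag_of (f x', g y)"
        by (simp add: p(2) frag_extend_diff add)
      then show ?thesis using left closed unfolding tensor_gens_def by blast
    next
      case (right x y y')
      then have "q = frag_of (f x, g y \<oplus>\<^bsub>N\<^esub> g y') - frag_of (f x, g y) - frag_of (f x, g y')"
        by (simp add: p(2) frag_extend_diff add)
      then show ?thesis using right closed unfolding tensor_gens_def by blast
    next
      case (smult r x y)
      then have "q = frag_of (\<phi> r \<odot>\<^bsub>M\<^esub> f x, g y) - frag_of (f x, \<phi> r \<odot>\<^bsub>N\<^esub> g y)"
        by (simp add: p(2) frag_extend_diff semilinear_pair.smult[OF semilinear_pair_axioms])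
      then show ?thesis using smult closed unfolding tensor_gens_def by blast
    qed
    then show "q \<in> tensor_rel R M N" by (rule tensor_gens_rel[OF modules(3,4)])
  qed
qed

lemma coset_map_pure:
  "x \<in> carrier M' \<Longrightarrow> y \<in> carrier N' \<Longrightarrow>
    coset_map R M N (map_prod f g) (pure_tensor R' M' N' x y) = pure_tensor R M N (f x) (g y)"
  unfolding pure_tensor_def by (subst coset_map_rcoset') (auto simp: tensor_free_def)

lemma keys_map_prod:
  assumes "Poly_Mapping.keys a \<subseteq> carrier M' \<times> carrier N'"
  shows "Poly_Mapping.keys (frag_extend (\<lambda>p. frag_of (map_prod f g p)) a) \<subseteq> carrier M \<times> carrier N"
proof -
  have "Poly_Mapping.keys (frag_extend (\<lambda>p. frag_of (map_prod f g p)) a) \<subseteq>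
      (\<Union>p \<in> Poly_Mapping.keys a. Poly_Mapping.keys (frag_of (map_prod f g p)))"
    by (rule keys_frag_extend)
  then show ?thesis using assms closed by fastforce
qed

lemma coset_map_closed:
  "t \<in> carrier (tensor R' M' N') \<Longrightarrow> coset_map R M N (map_prod f g) t \<in> carrier (tensor R M N)"
  using keys_map_prod coset_map_rcoset'
  by (auto simp: carrier_tensor modules) (auto simp: tensor_free_def)

lemma coset_map_add:
  assumes "s \<in> carrier (tensor R' M' N')" "t \<in> carrier (tensor R' M' N')"
  shows "coset_map R M N (map_prod f g) (s \<oplus>\<^bsub>tensor R' M' N'\<^esub> t) =
    coset_map R M N (map_prod f g) s \<oplus>\<^bsub>tensor R M N\<^esub> coset_map R M N (map_prod f g) t"
proof -
  obtain a b where a: "a \<in> carrier (tensor_free M' N')" "s = tensor_rel R' M' N' #>\<^bsub>tensor_free M' N'\<^esub> a"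
    and b: "b \<in> carrier (tensor_free M' N')" "t = tensor_rel R' M' N' #>\<^bsub>tensor_free M' N'\<^esub> b"
    using assms by (auto simp: carrier_tensor modules)
  have ab: "a + b \<in> carrier (tensor_free M' N')"
    using a b keys_add[of a b] by (auto simp: tensor_free_def)
  have "frag_extend (\<lambda>p. frag_of (map_prod f g p)) c \<in> carrier (tensor_free M N)"
    if "c \<in> carrier (tensor_free M' N')" for c
    using keys_map_prod that by (auto simp: tensor_free_def)
  then show ?thesis
    using a b ab
    by (simp add: add_tensor_rcoset modules coset_map_rcoset' frag_extend_add)
qed

end

section \<open>Scalar multiplication on the tensor product\<close>

context
  fixes R :: "'u alg" and M :: "('u, 'm) module" and N :: "('u, 'n) module"
  assumes M: "module R M" and N: "module R N"
begin

interpretation M: module R M by (rule M)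
interpretation N: module R N by (rule N)

lemma semilinear_pair_smult:
  assumes "r \<in> carrier R"
  shows "semilinear_pair R M N R M N (\<lambda>x. x) (\<lambda>x. r \<odot>\<^bsub>M\<^esub> x) (\<lambda>y. y)"
proof unfold_locales
  \<comment> \<open>Multiplication by r commutes with scalars because R is commutative; scalars
    themselves are left alone, so the companion map on R is the identity.\<close>
  show "r \<odot>\<^bsub>M\<^esub> (s \<odot>\<^bsub>M\<^esub> x) = s \<odot>\<^bsub>M\<^esub> (r \<odot>\<^bsub>M\<^esub> x)" if "s \<in> carrier R" "x \<in> carrier M" for s x
    using assms that by (metis M.smult_assoc1 M.R.m_comm)
qed (use assms M.smult_r_distr in auto)

lemma smult_tensor: "r \<odot>\<^bsub>tensor R M N\<^esub> t = coset_map R M N (map_prod (\<lambda>x. r \<odot>\<^bsub>M\<^esub> x) (\<lambda>y. y)) t"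
proof -
  have "(\<lambda>(x, y). (r \<odot>\<^bsub>M\<^esub> x, y)) = map_prod (\<lambda>x. r \<odot>\<^bsub>M\<^esub> x) (\<lambda>y::'n. y)"
    by (auto simp: fun_eq_iff)
  then show ?thesis by (simp add: tensor_def)
qed

lemma tensor_smult_closed:
  "r \<in> carrier R \<Longrightarrow> t \<in> carrier (tensor R M N) \<Longrightarrow> r \<odot>\<^bsub>tensor R M N\<^esub> t \<in> carrier (tensor R M N)"
  unfolding smult_tensor by (rule semilinear_pair.coset_map_closed[OF semilinear_pair_smult])

lemma tensor_smult_add:
  "r \<in> carrier R \<Longrightarrow> s \<in> carrier (tensor R M N) \<Longrightarrow> t \<in> carrier (tensor R M N) \<Longrightarrow>
    r \<odot>\<^bsub>tensor R M N\<^esub> (s \<oplus>\<^bsub>tensor R M N\<^esub> t) = r \<odot>\<^bsub>tensor R M N\<^esub> s \<oplus>\<^bsub>tensor R M N\<^esub> r \<odot>\<^bsub>tensor R M N\<^esub> t"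
  unfolding smult_tensor by (rule semilinear_pair.coset_map_add[OF semilinear_pair_smult])

lemma tensor_smult_pure:
  "r \<in> carrier R \<Longrightarrow> x \<in> carrier M \<Longrightarrow> y \<in> carrier N \<Longrightarrow>
    r \<odot>\<^bsub>tensor R M N\<^esub> pure_tensor R M N x y = pure_tensor R M N (r \<odot>\<^bsub>M\<^esub> x) y"
  unfolding smult_tensor by (rule semilinear_pair.coset_map_pure[OF semilinear_pair_smult])

end


section \<open>Families over algebras under a base\<close>

lemma algs_simps [simp]:
  "R \<in> Obj (algs K) \<longleftrightarrow> algebra K R"
  "Arr (algs K) = calg_homs K"
  "und (algs K) R = R"
  by (simp_all add: algs_def)

lemma under_simps [simp]:
  "(R, \<phi>) \<in> Obj (algs_under K S) \<longleftrightarrow> algebra K R \<and> \<phi> \<in> calg_homs K S R"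
  "\<psi> \<in> Arr (algs_under K S) (R, \<phi>) (R', \<phi>') \<longleftrightarrow>
    \<psi> \<in> calg_homs K R R' \<and> compose (carrier S) \<psi> \<phi> = \<phi>'"
  "und (algs_under K S) i = fst i"
  by (simp_all add: algs_under_def)

lemma ball_under:
  "(\<forall>i\<in>Obj (algs_under K S). P i) \<longleftrightarrow> (\<forall>R \<phi>. algebra K R \<longrightarrow> \<phi> \<in> calg_homs K S R \<longrightarrow> P (R, \<phi>))"
  by (auto simp: algs_under_def)

lemma Kfun_simps [simp]:
  "mobj Kfun R = R\<lparr>smult := monoid.mult R\<rparr>" "mmor Kfun R R' \<phi> = \<phi>"
  by (simp_all add: Kfun_def)

lemma sets_of_simps [simp]:
  "obj (sets_of M) i = carrier (mobj M i)" "mor (sets_of M) = mmor M"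
  by (simp_all add: sets_of_def)

lemma sprod_simps [simp]:
  "obj (sprod X Y) i = obj X i \<times> obj Y i"
  "mor (sprod X Y) i j \<phi> = map_prod (mor X i j \<phi>) (mor Y i j \<phi>)"
  by (simp_all add: sprod_def)

lemma restr_simps [simp]:
  "obj (srestr X) i = obj X (fst i)" "mor (srestr X) i j = mor X (fst i) (fst j)"
  "mobj (mrestr M) i = mobj M (fst i)" "mmor (mrestr M) i j = mmor M (fst i) (fst j)"
  by (simp_all add: srestr_def mrestr_def)

lemma algebra_cring: "algebra K R \<Longrightarrow> cring R"
  by (rule algebra.M_cring)

lemma algebra_closed:
  assumes "algebra K R"
  shows "\<one>\<^bsub>R\<^esub> \<in> carrier R" "\<zero>\<^bsub>R\<^esub> \<in> carrier R"
    and "r \<in> carrier R \<Longrightarrow> s \<in> carrier R \<Longrightarrow> r \<oplus>\<^bsub>R\<^esub> s \<in> carrier R"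
    and "r \<in> carrier R \<Longrightarrow> s \<in> carrier R \<Longrightarrow> r \<otimes>\<^bsub>R\<^esub> s \<in> carrier R"
proof -
  interpret cring R by (rule algebra_cring[OF assms])
  show "\<one>\<^bsub>R\<^esub> \<in> carrier R" "\<zero>\<^bsub>R\<^esub> \<in> carrier R"
    "r \<in> carrier R \<Longrightarrow> s \<in> carrier R \<Longrightarrow> r \<oplus>\<^bsub>R\<^esub> s \<in> carrier R"
    "r \<in> carrier R \<Longrightarrow> s \<in> carrier R \<Longrightarrow> r \<otimes>\<^bsub>R\<^esub> s \<in> carrier R"
    by simp_all
qed

lemma calg_closed: "\<phi> \<in> calg_homs K S R \<Longrightarrow> s \<in> carrier S \<Longrightarrow> \<phi> s \<in> carrier R"
  by (auto simp: calg_homs_def ring_hom_def)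

lemma calg_add:
  "\<phi> \<in> calg_homs K S R \<Longrightarrow> s \<in> carrier S \<Longrightarrow> t \<in> carrier S \<Longrightarrow> \<phi> (s \<oplus>\<^bsub>S\<^esub> t) = \<phi> s \<oplus>\<^bsub>R\<^esub> \<phi> t"
  by (auto simp: calg_homs_def ring_hom_def)

lemma calg_mult:
  "\<phi> \<in> calg_homs K S R \<Longrightarrow> s \<in> carrier S \<Longrightarrow> t \<in> carrier S \<Longrightarrow> \<phi> (s \<otimes>\<^bsub>S\<^esub> t) = \<phi> s \<otimes>\<^bsub>R\<^esub> \<phi> t"
  by (auto simp: calg_homs_def ring_hom_def)

lemma calg_one: "\<phi> \<in> calg_homs K S R \<Longrightarrow> \<phi> \<one>\<^bsub>S\<^esub> = \<one>\<^bsub>R\<^esub>"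
  by (auto simp: calg_homs_def ring_hom_def)

lemma calg_zero:
  "\<phi> \<in> calg_homs K S R \<Longrightarrow> algebra K S \<Longrightarrow> algebra K R \<Longrightarrow> \<phi> \<zero>\<^bsub>S\<^esub> = \<zero>\<^bsub>R\<^esub>"
  using ring_hom_zero[of \<phi> S R] by (auto simp: calg_homs_def cring.axioms algebra_cring)

lemma calg_extensional: "\<phi> \<in> calg_homs K S R \<Longrightarrow> \<phi> \<in> extensional (carrier S)"
  by (auto simp: calg_homs_def)

lemma id_on_apply [simp]: "r \<in> carrier R \<Longrightarrow> id_on R r = r"
  by (simp add: id_on_def)

lemma id_on_calg [simp, intro]: "algebra K R \<Longrightarrow> id_on R \<in> calg_homs K R R"
proof -
  assume "algebra K R"
  then interpret algebra K R .
  show ?thesis by (auto simp: calg_homs_def ring_hom_def id_on_def)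
qed

lemma compose_calg [simp, intro]:
  assumes "\<phi> \<in> calg_homs K S R" "\<psi> \<in> calg_homs K R R'" "algebra K S"
  shows "compose (carrier S) \<psi> \<phi> \<in> calg_homs K S R'"
proof -
  interpret algebra K S by (rule assms(3))
  show ?thesis
    using assms(1,2) by (auto simp: calg_homs_def ring_hom_def compose_def Pi_def)
qed

lemma compose_calg_apply [simp]: "s \<in> carrier S \<Longrightarrow> compose (carrier S) \<psi> \<phi> s = \<psi> (\<phi> s)"
  by (simp add: compose_def)

lemma compose_calg_assoc:
  assumes "\<phi> \<in> calg_homs K S R"
  shows "compose (carrier S) (compose (carrier R) \<chi> \<psi>) \<phi> = compose (carrier S) \<chi> (compose (carrier S) \<psi> \<phi>)"
  using calg_closed[OF assms] by (auto simp: compose_def fun_eq_iff restrict_def)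

lemma compose_id_left [simp]:
  assumes "\<phi> \<in> calg_homs K S R"
  shows "compose (carrier S) (id_on R) \<phi> = \<phi>"
  using calg_closed[OF assms] calg_extensional[OF assms]
  by (auto simp: compose_def id_on_def extensional_def fun_eq_iff)

lemma compose_id_right [simp]:
  assumes "\<phi> \<in> calg_homs K S R"
  shows "compose (carrier S) \<phi> (id_on S) = \<phi>"
  using calg_extensional[OF assms]
  by (auto simp: compose_def id_on_def extensional_def fun_eq_iff)

lemma set_functorD:
  assumes "set_functor (algs K) X"
  shows "algebra K R \<Longrightarrow> algebra K R' \<Longrightarrow> \<phi> \<in> calg_homs K R R' \<Longrightarrow> x \<in> obj X R \<Longrightarrow> mor X R R' \<phi> x \<in> obj X R'"
    and "algebra K R \<Longrightarrow> x \<in> obj X R \<Longrightarrow> mor X R R (id_on R) x = x"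
    and "algebra K R \<Longrightarrow> algebra K R' \<Longrightarrow> algebra K R'' \<Longrightarrow> \<phi> \<in> calg_homs K R R' \<Longrightarrow> \<psi> \<in> calg_homs K R' R''
      \<Longrightarrow> x \<in> obj X R \<Longrightarrow> mor X R' R'' \<psi> (mor X R R' \<phi> x) = mor X R R'' (compose (carrier R) \<psi> \<phi>) x"
  using assms unfolding set_functor_def by (auto simp: Pi_iff)

text \<open>
  Morphisms between restrictions to \<open>S\<close>-algebras, as functions of the algebra \<open>R\<close>, its structure morphism
  \<open>\<phi> : S \<rightarrow> R\<close> and a value, without the extensionality that membership in a Hom set requires.
\<close>

definition nat_family ::
  "'u ring \<Rightarrow> 'u alg \<Rightarrow> ('u alg, 'u, 'x) sfun \<Rightarrow> ('u alg, 'u, 'y) sfun \<Rightarrow>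
    ('u alg \<Rightarrow> ('u \<Rightarrow> 'u) \<Rightarrow> 'x \<Rightarrow> 'y) \<Rightarrow> bool" where
  "nat_family K S X Y P \<longleftrightarrow>
    (\<forall>R \<phi> x. algebra K R \<longrightarrow> \<phi> \<in> calg_homs K S R \<longrightarrow> x \<in> obj X R \<longrightarrow> P R \<phi> x \<in> obj Y R) \<and>
    (\<forall>R \<phi> R' \<psi> x. algebra K R \<longrightarrow> \<phi> \<in> calg_homs K S R \<longrightarrow> algebra K R' \<longrightarrow> \<psi> \<in> calg_homs K R R' \<longrightarrow>
      x \<in> obj X R \<longrightarrow> P R' (compose (carrier S) \<psi> \<phi>) (mor X R R' \<psi> x) = mor Y R R' \<psi> (P R \<phi> x))"

lemma nat_familyD:
  assumes "nat_family K S X Y P" "algebra K R" "\<phi> \<in> calg_homs K S R" "x \<in> obj X R"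
  shows "P R \<phi> x \<in> obj Y R"
    and "algebra K R' \<Longrightarrow> \<psi> \<in> calg_homs K R R' \<Longrightarrow>
      P R' (compose (carrier S) \<psi> \<phi>) (mor X R R' \<psi> x) = mor Y R R' \<psi> (P R \<phi> x)"
  using assms unfolding nat_family_def by blast+

text \<open>P may depend on the structure morphism \<phi> and not only on R. This leaves room for
  families that involve a fixed element of a value at S, transported to R along \<phi>.\<close>

definition linear_family ::
  "'u ring \<Rightarrow> 'u alg \<Rightarrow> ('u alg, 'u, 'm) mfun \<Rightarrow> ('u alg, 'u, 'n) mfun \<Rightarrow>
    ('u alg \<Rightarrow> ('u \<Rightarrow> 'u) \<Rightarrow> 'm \<Rightarrow> 'n) \<Rightarrow> bool" where
  "linear_family K S M N P \<longleftrightarrow> nat_family K S (sets_of M) (sets_of N) P \<and>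
    (\<forall>R \<phi>. algebra K R \<longrightarrow> \<phi> \<in> calg_homs K S R \<longrightarrow>
      (\<forall>x\<in>carrier (mobj M R). \<forall>y\<in>carrier (mobj M R).
        P R \<phi> (x \<oplus>\<^bsub>mobj M R\<^esub> y) = P R \<phi> x \<oplus>\<^bsub>mobj N R\<^esub> P R \<phi> y) \<and>
      (\<forall>r\<in>carrier R. \<forall>x\<in>carrier (mobj M R).
        P R \<phi> (r \<odot>\<^bsub>mobj M R\<^esub> x) = r \<odot>\<^bsub>mobj N R\<^esub> P R \<phi> x))"

lemma linear_familyI:
  assumes "\<And>R \<phi> x. algebra K R \<Longrightarrow> \<phi> \<in> calg_homs K S R \<Longrightarrow> x \<in> carrier (mobj M R) \<Longrightarrow> P R \<phi> x \<in> carrier (mobj N R)"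
    and "\<And>R \<phi> R' \<psi> x. algebra K R \<Longrightarrow> \<phi> \<in> calg_homs K S R \<Longrightarrow> algebra K R' \<Longrightarrow> \<psi> \<in> calg_homs K R R' \<Longrightarrow>
      x \<in> carrier (mobj M R) \<Longrightarrow> P R' (compose (carrier S) \<psi> \<phi>) (mmor M R R' \<psi> x) = mmor N R R' \<psi> (P R \<phi> x)"
    and "\<And>R \<phi> x y. algebra K R \<Longrightarrow> \<phi> \<in> calg_homs K S R \<Longrightarrow> x \<in> carrier (mobj M R) \<Longrightarrow> y \<in> carrier (mobj M R) \<Longrightarrow>
      P R \<phi> (x \<oplus>\<^bsub>mobj M R\<^esub> y) = P R \<phi> x \<oplus>\<^bsub>mobj N R\<^esub> P R \<phi> y"
    and "\<And>R \<phi> r x. algebra K R \<Longrightarrow> \<phi> \<in> calg_homs K S R \<Longrightarrow> r \<in> carrier R \<Longrightarrow> x \<in> carrier (mobj M R) \<Longrightarrow>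
      P R \<phi> (r \<odot>\<^bsub>mobj M R\<^esub> x) = r \<odot>\<^bsub>mobj N R\<^esub> P R \<phi> x"
  shows "linear_family K S M N P"
  using assms unfolding linear_family_def nat_family_def by simp

lemma linear_familyD:
  assumes "linear_family K S M N P" "algebra K R" "\<phi> \<in> calg_homs K S R" "x \<in> carrier (mobj M R)"
  shows "P R \<phi> x \<in> carrier (mobj N R)"
    and "algebra K R' \<Longrightarrow> \<psi> \<in> calg_homs K R R' \<Longrightarrow>
      P R' (compose (carrier S) \<psi> \<phi>) (mmor M R R' \<psi> x) = mmor N R R' \<psi> (P R \<phi> x)"
    and "y \<in> carrier (mobj M R) \<Longrightarrow> P R \<phi> (x \<oplus>\<^bsub>mobj M R\<^esub> y) = P R \<phi> x \<oplus>\<^bsub>mobj N R\<^esub> P R \<phi> y"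
    and "r \<in> carrier R \<Longrightarrow> P R \<phi> (r \<odot>\<^bsub>mobj M R\<^esub> x) = r \<odot>\<^bsub>mobj N R\<^esub> P R \<phi> x"
  using assms unfolding linear_family_def nat_family_def by auto

lemma linear_family_compose:
  assumes "linear_family K S M N P" "linear_family K S N L Q"
  shows "linear_family K S M L (\<lambda>R \<phi> x. Q R \<phi> (P R \<phi> x))"
  by (rule linear_familyI) (simp_all add: linear_familyD[OF assms(1)] linear_familyD[OF assms(2)])

text \<open>Along \<sigma> : S \<rightarrow> S' every S'-algebra becomes an S-algebra by composing
  structure morphisms, and the family is read there.\<close>

lemma linear_family_base_change:
  assumes "linear_family K S M N P" "\<sigma> \<in> calg_homs K S S'" "algebra K S" "algebra K S'"
  shows "linear_family K S' M N (\<lambda>R \<phi>. P R (compose (carrier S) \<phi> \<sigma>))"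
proof (rule linear_familyI)
  show "P R' (compose (carrier S) (compose (carrier S') \<psi> \<phi>) \<sigma>) (mmor M R R' \<psi> x)
    = mmor N R R' \<psi> (P R (compose (carrier S) \<phi> \<sigma>) x)"
    if "algebra K R" "\<phi> \<in> calg_homs K S' R" "algebra K R'" "\<psi> \<in> calg_homs K R R'" "x \<in> carrier (mobj M R)"
    for R \<phi> R' \<psi> x
    using that assms linear_familyD(2)[OF assms(1), of R "compose (carrier S) \<phi> \<sigma>" x R' \<psi>]
    by (simp add: compose_calg_assoc[OF assms(2)] compose_calg[OF assms(2)])
qed (use assms linear_familyD[OF assms(1)] compose_calg[OF assms(2)] in auto)

text \<open>Turns a plain family into the extensional function that represents it as an element of a
  value of \<open>funs\<close> or \<open>dual\<close>.\<close>

definition family_fun ::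
  "'u ring \<Rightarrow> 'u alg \<Rightarrow> ('u alg, 'u, 'x) sfun \<Rightarrow> ('u alg \<Rightarrow> ('u \<Rightarrow> 'u) \<Rightarrow> 'x \<Rightarrow> 'y) \<Rightarrow>
    'u alg \<times> ('u \<Rightarrow> 'u) \<Rightarrow> 'x \<Rightarrow> 'y" where
  "family_fun K S X P = (\<lambda>(R, \<phi>)\<in>Obj (algs_under K S). \<lambda>x\<in>obj X R. P R \<phi> x)"

lemma family_fun_apply [simp]:
  "algebra K R \<Longrightarrow> \<phi> \<in> calg_homs K S R \<Longrightarrow> x \<in> obj X R \<Longrightarrow> family_fun K S X P (R, \<phi>) x = P R \<phi> x"
  by (simp add: family_fun_def)

lemma extensional_pair_eqI:
  assumes "f \<in> extensional (Obj (algs_under K S))" "g \<in> extensional (Obj (algs_under K S))"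
    and "\<And>R \<phi>. algebra K R \<Longrightarrow> \<phi> \<in> calg_homs K S R \<Longrightarrow> f (R, \<phi>) \<in> extensional (A R)"
    and "\<And>R \<phi>. algebra K R \<Longrightarrow> \<phi> \<in> calg_homs K S R \<Longrightarrow> g (R, \<phi>) \<in> extensional (A R)"
    and "\<And>R \<phi> x. algebra K R \<Longrightarrow> \<phi> \<in> calg_homs K S R \<Longrightarrow> x \<in> A R \<Longrightarrow> f (R, \<phi>) x = g (R, \<phi>) x"
  shows "f = g"
proof (rule extensionalityI[OF assms(1,2)])
  fix i assume i: "i \<in> Obj (algs_under K S)"
  show "f i = g i"
  proof (cases i)
    case (Pair R \<phi>)
    with i show ?thesis
      by (metis under_simps(1) assms(3-5) extensionalityI)
  qed
qed

section \<open>The functor of functions and its pointwise operations\<close>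

lemma funs_carrier_iff:
  assumes S: "algebra K S"
  shows "f \<in> carrier (mobj (funs K X) S) \<longleftrightarrow>
    f \<in> extensional (Obj (algs_under K S)) \<and>
    (\<forall>R \<phi>. algebra K R \<longrightarrow> \<phi> \<in> calg_homs K S R \<longrightarrow> f (R, \<phi>) \<in> extensional (obj X R)) \<and>
    nat_family K S X (sets_of Kfun) (\<lambda>R \<phi>. f (R, \<phi>))"
  using S by (auto simp: funs_def nat_family_def set_homs_def ball_under PiE_iff)

lemma funsD:
  assumes "f \<in> carrier (mobj (funs K X) S)" "algebra K S"
  shows "algebra K R \<Longrightarrow> \<phi> \<in> calg_homs K S R \<Longrightarrow> x \<in> obj X R \<Longrightarrow> f (R, \<phi>) x \<in> carrier R"
    and "algebra K R \<Longrightarrow> \<phi> \<in> calg_homs K S R \<Longrightarrow> algebra K R' \<Longrightarrow> \<psi> \<in> calg_homs K R R' \<Longrightarrow>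
      x \<in> obj X R \<Longrightarrow> f (R', compose (carrier S) \<psi> \<phi>) (mor X R R' \<psi> x) = \<psi> (f (R, \<phi>) x)"
  using assms unfolding funs_carrier_iff[OF assms(2)] nat_family_def by simp_all

lemma funs_eqI:
  assumes "f \<in> carrier (mobj (funs K X) S)" "g \<in> carrier (mobj (funs K X) S)" "algebra K S"
    and "\<And>R \<phi> x. algebra K R \<Longrightarrow> \<phi> \<in> calg_homs K S R \<Longrightarrow> x \<in> obj X R \<Longrightarrow> f (R, \<phi>) x = g (R, \<phi>) x"
  shows "f = g"
  using assms by (intro extensional_pair_eqI[of f K S g "obj X"]) (auto simp: funs_carrier_iff)

lemma family_fun_in_funs:
  assumes X: "set_functor (algs K) X" and P: "nat_family K S X (sets_of Kfun) P" and S: "algebra K S"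
  shows "family_fun K S X P \<in> carrier (mobj (funs K X) S)"
proof -
  \<comment> \<open>Cutting down to the carriers does not disturb naturality, since arrows of X take
    points over R to points over R'.\<close>
  have "nat_family K S X (sets_of Kfun) (\<lambda>R \<phi>. family_fun K S X P (R, \<phi>))"
    using nat_familyD[OF P] set_functorD(1)[OF X] S
    unfolding nat_family_def by (simp add: compose_calg)
  then show ?thesis
    unfolding funs_carrier_iff[OF S] by (auto simp: family_fun_def)
qed

lemma base_change_apply [simp]:
  "algebra K R \<Longrightarrow> \<phi> \<in> calg_homs K S' R \<Longrightarrow>
    base_change K S S' \<theta> \<eta> (R, \<phi>) = \<eta> (R, compose (carrier S) \<phi> \<theta>)"
  by (simp add: base_change_def)

lemma base_change_extensional [simp]: "base_change K S S' \<theta> \<eta> \<in> extensional (Obj (algs_under K S'))"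
  by (simp add: base_change_def)

lemma mmor_funs [simp]: "mmor (funs K X) = base_change K"
  by (simp add: funs_def)

lemma funs_ops [simp]:
  assumes "algebra K R" "\<phi> \<in> calg_homs K S R" "x \<in> obj X R"
  shows "(f \<oplus>\<^bsub>mobj (funs K X) S\<^esub> g) (R, \<phi>) x = f (R, \<phi>) x \<oplus>\<^bsub>R\<^esub> g (R, \<phi>) x"
    and "(f \<otimes>\<^bsub>mobj (funs K X) S\<^esub> g) (R, \<phi>) x = f (R, \<phi>) x \<otimes>\<^bsub>R\<^esub> g (R, \<phi>) x"
    and "(s \<odot>\<^bsub>mobj (funs K X) S\<^esub> f) (R, \<phi>) x = \<phi> s \<otimes>\<^bsub>R\<^esub> f (R, \<phi>) x"
    and "\<one>\<^bsub>mobj (funs K X) S\<^esub> (R, \<phi>) x = \<one>\<^bsub>R\<^esub>"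
    and "\<zero>\<^bsub>mobj (funs K X) S\<^esub> (R, \<phi>) x = \<zero>\<^bsub>R\<^esub>"
  using assms by (simp_all add: funs_def)

lemma funs_ops_family:
  "f \<oplus>\<^bsub>mobj (funs K X) S\<^esub> g = family_fun K S X (\<lambda>R \<phi> x. f (R, \<phi>) x \<oplus>\<^bsub>R\<^esub> g (R, \<phi>) x)"
  "f \<otimes>\<^bsub>mobj (funs K X) S\<^esub> g = family_fun K S X (\<lambda>R \<phi> x. f (R, \<phi>) x \<otimes>\<^bsub>R\<^esub> g (R, \<phi>) x)"
  "s \<odot>\<^bsub>mobj (funs K X) S\<^esub> f = family_fun K S X (\<lambda>R \<phi> x. \<phi> s \<otimes>\<^bsub>R\<^esub> f (R, \<phi>) x)"
  "\<one>\<^bsub>mobj (funs K X) S\<^esub> = family_fun K S X (\<lambda>R \<phi> x. \<one>\<^bsub>R\<^esub>)"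
  "\<zero>\<^bsub>mobj (funs K X) S\<^esub> = family_fun K S X (\<lambda>R \<phi> x. \<zero>\<^bsub>R\<^esub>)"
  by (simp_all add: funs_def family_fun_def)

lemma funs_base_change:
  assumes "f \<in> carrier (mobj (funs K X) S)" "algebra K R" "\<phi> \<in> calg_homs K S R"
    and S: "algebra K S"
  shows "base_change K S R \<phi> f \<in> carrier (mobj (funs K X) R)"
  using assms S unfolding funs_carrier_iff[OF S] funs_carrier_iff[OF assms(2)] nat_family_def
  by (auto simp: compose_calg compose_calg_assoc[OF assms(3)])

lemma base_change_id:
  "f \<in> extensional (Obj (algs_under K S)) \<Longrightarrow> base_change K S S (id_on S) f = f"
  by (auto simp: base_change_def extensional_def fun_eq_iff)

lemma base_change_compose:
  assumes "\<phi> \<in> calg_homs K S R" "\<psi> \<in> calg_homs K R R'" "algebra K R"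
  shows "base_change K R R' \<psi> (base_change K S R \<phi> f) = base_change K S R' (compose (carrier S) \<psi> \<phi>) f"
  using assms
  by (auto simp: base_change_def fun_eq_iff compose_calg_assoc[OF assms(1)] compose_calg[OF assms(2) _ assms(3)])

context
  fixes K :: "'u ring" and X :: "('u alg, 'u, 'x) sfun" and S :: "'u alg"
  assumes X: "set_functor (algs K) X" and S: "algebra K S"
begin

text \<open>The operations are pointwise, so naturality of the result is preservation of the
  operation by the homomorphisms \<psi>; for scalars, \<psi> is also applied to \<phi> s.\<close>

lemma funs_closed:
  shows "f \<in> carrier (mobj (funs K X) S) \<Longrightarrow> g \<in> carrier (mobj (funs K X) S) \<Longrightarrow>
      f \<oplus>\<^bsub>mobj (funs K X) S\<^esub> g \<in> carrier (mobj (funs K X) S)"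
    and "f \<in> carrier (mobj (funs K X) S) \<Longrightarrow> g \<in> carrier (mobj (funs K X) S) \<Longrightarrow>
      f \<otimes>\<^bsub>mobj (funs K X) S\<^esub> g \<in> carrier (mobj (funs K X) S)"
    and "s \<in> carrier S \<Longrightarrow> f \<in> carrier (mobj (funs K X) S) \<Longrightarrow>
      s \<odot>\<^bsub>mobj (funs K X) S\<^esub> f \<in> carrier (mobj (funs K X) S)"
    and "\<one>\<^bsub>mobj (funs K X) S\<^esub> \<in> carrier (mobj (funs K X) S)"
    and "\<zero>\<^bsub>mobj (funs K X) S\<^esub> \<in> carrier (mobj (funs K X) S)"
  unfolding funs_ops_family
  by (rule family_fun_in_funs[OF X _ S], unfold nat_family_def,
      simp add: funsD calg_closed calg_add calg_mult calg_one calg_zero algebra_closed S)+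

end


section \<open>Duals\<close>

lemma ball_algs: "(\<forall>i\<in>Obj (algs K). P i) \<longleftrightarrow> (\<forall>R. algebra K R \<longrightarrow> P R)"
  by (simp add: algs_def)

text \<open>Closure and compatibility with arrows are recorded. The dual of such a functor satisfies
  the full module axioms because its forms take values in commutative rings, so \<open>funs\<close>
  and \<open>tensor_fun\<close> are fed into duals through this notion.\<close>

definition linear_functor :: "'u ring \<Rightarrow> ('u alg, 'u, 'm) mfun \<Rightarrow> bool" where
  "linear_functor K M \<longleftrightarrow> set_functor (algs K) (sets_of M) \<and>
    (\<forall>R. algebra K R \<longrightarrow>
      (\<forall>x\<in>carrier (mobj M R). \<forall>y\<in>carrier (mobj M R). x \<oplus>\<^bsub>mobj M R\<^esub> y \<in> carrier (mobj M R)) \<and>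
      (\<forall>r\<in>carrier R. \<forall>x\<in>carrier (mobj M R). r \<odot>\<^bsub>mobj M R\<^esub> x \<in> carrier (mobj M R))) \<and>
    (\<forall>R R' \<phi>. algebra K R \<longrightarrow> algebra K R' \<longrightarrow> \<phi> \<in> calg_homs K R R' \<longrightarrow>
      (\<forall>x\<in>carrier (mobj M R). \<forall>y\<in>carrier (mobj M R).
        mmor M R R' \<phi> (x \<oplus>\<^bsub>mobj M R\<^esub> y) = mmor M R R' \<phi> x \<oplus>\<^bsub>mobj M R'\<^esub> mmor M R R' \<phi> y) \<and>
      (\<forall>r\<in>carrier R. \<forall>x\<in>carrier (mobj M R).
        mmor M R R' \<phi> (r \<odot>\<^bsub>mobj M R\<^esub> x) = \<phi> r \<odot>\<^bsub>mobj M R'\<^esub> mmor M R R' \<phi> x))"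

lemma linear_functorD:
  assumes "linear_functor K M"
  shows "set_functor (algs K) (sets_of M)"
    and "algebra K R \<Longrightarrow> x \<in> carrier (mobj M R) \<Longrightarrow> y \<in> carrier (mobj M R) \<Longrightarrow>
      x \<oplus>\<^bsub>mobj M R\<^esub> y \<in> carrier (mobj M R)"
    and "algebra K R \<Longrightarrow> r \<in> carrier R \<Longrightarrow> x \<in> carrier (mobj M R) \<Longrightarrow> r \<odot>\<^bsub>mobj M R\<^esub> x \<in> carrier (mobj M R)"
    and "algebra K R \<Longrightarrow> algebra K R' \<Longrightarrow> \<phi> \<in> calg_homs K R R' \<Longrightarrow> x \<in> carrier (mobj M R) \<Longrightarrow>
      y \<in> carrier (mobj M R) \<Longrightarrow>
      mmor M R R' \<phi> (x \<oplus>\<^bsub>mobj M R\<^esub> y) = mmor M R R' \<phi> x \<oplus>\<^bsub>mobj M R'\<^esub> mmor M R R' \<phi> y"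
    and "algebra K R \<Longrightarrow> algebra K R' \<Longrightarrow> \<phi> \<in> calg_homs K R R' \<Longrightarrow> r \<in> carrier R \<Longrightarrow>
      x \<in> carrier (mobj M R) \<Longrightarrow>
      mmor M R R' \<phi> (r \<odot>\<^bsub>mobj M R\<^esub> x) = \<phi> r \<odot>\<^bsub>mobj M R'\<^esub> mmor M R R' \<phi> x"
  using assms unfolding linear_functor_def by simp_all

lemma linear_functor_mor:
  assumes "linear_functor K M"
  shows "algebra K R \<Longrightarrow> algebra K R' \<Longrightarrow> \<phi> \<in> calg_homs K R R' \<Longrightarrow> x \<in> carrier (mobj M R) \<Longrightarrow>
      mmor M R R' \<phi> x \<in> carrier (mobj M R')"
    and "algebra K R \<Longrightarrow> x \<in> carrier (mobj M R) \<Longrightarrow> mmor M R R (id_on R) x = x"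
    and "algebra K R \<Longrightarrow> algebra K R' \<Longrightarrow> algebra K R'' \<Longrightarrow> \<phi> \<in> calg_homs K R R' \<Longrightarrow> \<psi> \<in> calg_homs K R' R''
      \<Longrightarrow> x \<in> carrier (mobj M R) \<Longrightarrow>
      mmor M R' R'' \<psi> (mmor M R R' \<phi> x) = mmor M R R'' (compose (carrier R) \<psi> \<phi>) x"
  using set_functorD[OF linear_functorD(1)[OF assms]] by simp_all

lemma module_functor_linear:
  assumes "module_functor (algs K) M"
  shows "linear_functor K M"
proof -
  have "module R (mobj M R)" if "algebra K R" for R
    using assms that by (simp add: module_functor_def)
  note mod = this
  have "r \<odot>\<^bsub>mobj M R\<^esub> x \<in> carrier (mobj M R)"
    if "algebra K R" "r \<in> carrier R" "x \<in> carrier (mobj M R)" for R r x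
    using module.smult_closed[OF mod] that by blast
  moreover have "x \<oplus>\<^bsub>mobj M R\<^esub> y \<in> carrier (mobj M R)"
    if "algebra K R" "x \<in> carrier (mobj M R)" "y \<in> carrier (mobj M R)" for R x y
    using abelian_groupE(1)[OF module.axioms(2)[OF mod]] that by blast
  ultimately show ?thesis
    using assms unfolding linear_functor_def module_functor_def ball_algs by simp
qed

text \<open>A morphism over K is a family over every base S that ignores the structure morphism. In
  this form morphisms and families compose with each other by the same rules.\<close>

lemma module_homs_iff:
  "f \<in> module_homs (algs K) M N \<longleftrightarrow>
    f \<in> extensional {S. algebra K S} \<and>
    (\<forall>S. algebra K S \<longrightarrow> f S \<in> extensional (carrier (mobj M S)) \<and> linear_family K S M N (\<lambda>R \<phi>. f R))"
    (is "_ \<longleftrightarrow> ?rhs")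
proof
  show "f \<in> module_homs (algs K) M N \<Longrightarrow> ?rhs"
    by (simp add: module_homs_def set_homs_def ball_algs linear_family_def nat_family_def PiE_iff)
       (simp add: algs_def)
  show "?rhs \<Longrightarrow> f \<in> module_homs (algs K) M N"
  proof -
    assume f: ?rhs
    \<comment> \<open>Every R occurs as an algebra over itself, with structure morphism
      \<open>id_on R\<close>, and this instance contains all that is asked of f at R.\<close>
    then have lin: "linear_family K R M N (\<lambda>R \<phi>. f R)" if "algebra K R" for R using that by simp
    note D = linear_familyD[OF lin _ id_on_calg]
    show ?thesis
      unfolding module_homs_def set_homs_def PiE_iff ball_algs
      using f by (simp add: D) (simp add: algs_def)
  qed
qed

lemma module_homs_linear:
  "f \<in> module_homs (algs K) M N \<Longrightarrow> algebra K S \<Longrightarrow> linear_family K S M N (\<lambda>R \<phi>. f R)"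
  by (simp add: module_homs_iff)

lemma module_homsD:
  assumes "f \<in> module_homs (algs K) M N" "algebra K R" "x \<in> carrier (mobj M R)"
  shows "f R x \<in> carrier (mobj N R)"
    and "algebra K R' \<Longrightarrow> \<psi> \<in> calg_homs K R R' \<Longrightarrow> f R' (mmor M R R' \<psi> x) = mmor N R R' \<psi> (f R x)"
    and "y \<in> carrier (mobj M R) \<Longrightarrow> f R (x \<oplus>\<^bsub>mobj M R\<^esub> y) = f R x \<oplus>\<^bsub>mobj N R\<^esub> f R y"
    and "r \<in> carrier R \<Longrightarrow> f R (r \<odot>\<^bsub>mobj M R\<^esub> x) = r \<odot>\<^bsub>mobj N R\<^esub> f R x"
  using linear_familyD[OF module_homs_linear[OF assms(1,2)] assms(2) id_on_calg[OF assms(2)] assms(3)]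
  by simp_all

lemma module_homs_eqI:
  fixes f g :: "'u alg \<Rightarrow> 'm \<Rightarrow> 'n"
  assumes "f \<in> module_homs (algs K) M N" "g \<in> module_homs (algs K) M N"
    and "\<And>S x. algebra K S \<Longrightarrow> x \<in> carrier (mobj M S) \<Longrightarrow> f S x = g S x"
  shows "f = g"
proof (rule extensionalityI)
  show "f \<in> extensional {S. algebra K S}" "g \<in> extensional {S. algebra K S}"
    using assms(1,2) by (auto simp: module_homs_iff)
  fix S :: "'u alg" assume S: "S \<in> {S. algebra K S}"
  show "f S = g S"
    by (rule extensionalityI[of _ "carrier (mobj M S)"]) (use S assms in \<open>auto simp: module_homs_iff\<close>)
qed

text \<open>Counterpart of \<open>family_fun\<close> for morphisms over K: there is no structure
  morphism, and the result is extensional over the class of all algebras.\<close>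

definition family_hom ::
  "'u ring \<Rightarrow> ('u alg, 'u, 'm) mfun \<Rightarrow> ('u alg \<Rightarrow> 'm \<Rightarrow> 'n) \<Rightarrow> 'u alg \<Rightarrow> 'm \<Rightarrow> 'n" where
  "family_hom K M P = (\<lambda>S\<in>Obj (algs K). \<lambda>x\<in>carrier (mobj M S). P S x)"

lemma family_hom_apply [simp]:
  "algebra K S \<Longrightarrow> x \<in> carrier (mobj M S) \<Longrightarrow> family_hom K M P S x = P S x"
  by (simp add: family_hom_def)

lemma family_hom_in:
  assumes M: "linear_functor K M"
    and P: "\<And>S. algebra K S \<Longrightarrow> linear_family K S M N (\<lambda>R \<phi>. P R)"
  shows "family_hom K M P \<in> module_homs (algs K) M N"
proof -
  have "linear_family K S M N (\<lambda>R \<phi>. family_hom K M P R)" if S: "algebra K S" for S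
    by (rule linear_familyI)
       (simp_all add: linear_familyD[OF P[OF S]] linear_functorD(2-)[OF M] linear_functor_mor[OF M])
  then show ?thesis
    unfolding module_homs_iff by (auto simp: family_hom_def algs_def)
qed

section \<open>Linear forms and the module structure of the dual\<close>

lemma dual_carrier_iff:
  assumes S: "algebra K S"
  shows "\<omega> \<in> carrier (mobj (dual K M) S) \<longleftrightarrow>
    \<omega> \<in> extensional (Obj (algs_under K S)) \<and>
    (\<forall>R \<phi>. algebra K R \<longrightarrow> \<phi> \<in> calg_homs K S R \<longrightarrow> \<omega> (R, \<phi>) \<in> extensional (carrier (mobj M R))) \<and>
    linear_family K S M Kfun (\<lambda>R \<phi>. \<omega> (R, \<phi>))"
  using S by (auto simp: dual_def ihom_def linear_family_def nat_family_def module_homs_def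
      set_homs_def ball_under PiE_iff)

lemma dual_linear:
  "\<omega> \<in> carrier (mobj (dual K M) S) \<Longrightarrow> algebra K S \<Longrightarrow> linear_family K S M Kfun (\<lambda>R \<phi>. \<omega> (R, \<phi>))"
  by (simp add: dual_carrier_iff)

lemma dualD:
  assumes "\<omega> \<in> carrier (mobj (dual K M) S)" "algebra K S" "algebra K R" "\<phi> \<in> calg_homs K S R"
    "x \<in> carrier (mobj M R)"
  shows "\<omega> (R, \<phi>) x \<in> carrier R"
    and "algebra K R' \<Longrightarrow> \<psi> \<in> calg_homs K R R' \<Longrightarrow>
      \<omega> (R', compose (carrier S) \<psi> \<phi>) (mmor M R R' \<psi> x) = \<psi> (\<omega> (R, \<phi>) x)"
    and "y \<in> carrier (mobj M R) \<Longrightarrow> \<omega> (R, \<phi>) (x \<oplus>\<^bsub>mobj M R\<^esub> y) = \<omega> (R, \<phi>) x \<oplus>\<^bsub>R\<^esub> \<omega> (R, \<phi>) y"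
    and "r \<in> carrier R \<Longrightarrow> \<omega> (R, \<phi>) (r \<odot>\<^bsub>mobj M R\<^esub> x) = r \<otimes>\<^bsub>R\<^esub> \<omega> (R, \<phi>) x"
  using linear_familyD[OF dual_linear[OF assms(1,2)] assms(3,4,5)] by simp_all

lemma dual_eqI:
  assumes "\<omega> \<in> carrier (mobj (dual K M) S)" "\<eta> \<in> carrier (mobj (dual K M) S)" "algebra K S"
    and "\<And>R \<phi> x. algebra K R \<Longrightarrow> \<phi> \<in> calg_homs K S R \<Longrightarrow> x \<in> carrier (mobj M R) \<Longrightarrow> \<omega> (R, \<phi>) x = \<eta> (R, \<phi>) x"
  shows "\<omega> = \<eta>"
  using assms by (intro extensional_pair_eqI[of \<omega> K S \<eta> "\<lambda>R. carrier (mobj M R)"]) (auto simp: dual_carrier_iff)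

lemma family_fun_in_dual:
  assumes M: "linear_functor K M" and P: "linear_family K S M Kfun P" and S: "algebra K S"
  shows "family_fun K S (sets_of M) P \<in> carrier (mobj (dual K M) S)"
proof -
  have "linear_family K S M Kfun (\<lambda>R \<phi>. family_fun K S (sets_of M) P (R, \<phi>))"
    by (rule linear_familyI)
       (use linear_familyD[OF P] linear_functorD(2-)[OF M] linear_functor_mor[OF M] S in
         \<open>simp_all add: compose_calg\<close>)
  then show ?thesis
    unfolding dual_carrier_iff[OF S] by (auto simp: family_fun_def)
qed

lemma mmor_dual [simp]: "mmor (dual K M) = base_change K"
  by (simp add: dual_def ihom_def)

lemma dual_ops_family:
  "\<omega> \<oplus>\<^bsub>mobj (dual K M) S\<^esub> \<eta> = family_fun K S (sets_of M) (\<lambda>R \<phi> x. \<omega> (R, \<phi>) x \<oplus>\<^bsub>R\<^esub> \<eta> (R, \<phi>) x)"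
  "s \<odot>\<^bsub>mobj (dual K M) S\<^esub> \<omega> = family_fun K S (sets_of M) (\<lambda>R \<phi> x. \<phi> s \<otimes>\<^bsub>R\<^esub> \<omega> (R, \<phi>) x)"
  "\<zero>\<^bsub>mobj (dual K M) S\<^esub> = family_fun K S (sets_of M) (\<lambda>R \<phi> x. \<zero>\<^bsub>R\<^esub>)"
  by (simp_all add: dual_def ihom_def family_fun_def)

lemma dual_ops [simp]:
  assumes "algebra K R" "\<phi> \<in> calg_homs K S R" "x \<in> carrier (mobj M R)"
  shows "(\<omega> \<oplus>\<^bsub>mobj (dual K M) S\<^esub> \<eta>) (R, \<phi>) x = \<omega> (R, \<phi>) x \<oplus>\<^bsub>R\<^esub> \<eta> (R, \<phi>) x"
    and "(s \<odot>\<^bsub>mobj (dual K M) S\<^esub> \<omega>) (R, \<phi>) x = \<phi> s \<otimes>\<^bsub>R\<^esub> \<omega> (R, \<phi>) x"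
    and "\<zero>\<^bsub>mobj (dual K M) S\<^esub> (R, \<phi>) x = \<zero>\<^bsub>R\<^esub>"
  using assms by (simp_all add: dual_ops_family)

text \<open>Over \<phi> the scalar s acts as \<phi> s, which is why a multiple of a form is natural;
  that it is still linear over R uses commutativity of R.\<close>

lemma dual_closed:
  assumes M: "linear_functor K M" and S: "algebra K S"
  shows "\<omega> \<in> carrier (mobj (dual K M) S) \<Longrightarrow> \<eta> \<in> carrier (mobj (dual K M) S) \<Longrightarrow>
      \<omega> \<oplus>\<^bsub>mobj (dual K M) S\<^esub> \<eta> \<in> carrier (mobj (dual K M) S)"
    and "s \<in> carrier S \<Longrightarrow> \<omega> \<in> carrier (mobj (dual K M) S) \<Longrightarrow>
      s \<odot>\<^bsub>mobj (dual K M) S\<^esub> \<omega> \<in> carrier (mobj (dual K M) S)"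
    and "\<zero>\<^bsub>mobj (dual K M) S\<^esub> \<in> carrier (mobj (dual K M) S)"
proof -
  show "\<omega> \<oplus>\<^bsub>mobj (dual K M) S\<^esub> \<eta> \<in> carrier (mobj (dual K M) S)"
    if \<omega>: "\<omega> \<in> carrier (mobj (dual K M) S)" and \<eta>: "\<eta> \<in> carrier (mobj (dual K M) S)"
    unfolding dual_ops_family
  proof (rule family_fun_in_dual[OF M _ S], rule linear_familyI)
    fix R \<phi> assume R: "algebra K R" "\<phi> \<in> calg_homs K S R"
    interpret cring R by (rule algebra_cring[OF R(1)])
    note facts = dualD[OF \<omega> S R] dualD[OF \<eta> S R]
    fix x assume x: "x \<in> carrier (mobj M R)"
    show "\<omega> (R, \<phi>) x \<oplus>\<^bsub>R\<^esub> \<eta> (R, \<phi>) x \<in> carrier (mobj Kfun R)"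
      using x by (simp add: facts)
    show "\<omega> (R', compose (carrier S) \<psi> \<phi>) (mmor M R R' \<psi> x) \<oplus>\<^bsub>R'\<^esub>
      \<eta> (R', compose (carrier S) \<psi> \<phi>) (mmor M R R' \<psi> x) =
      mmor Kfun R R' \<psi> (\<omega> (R, \<phi>) x \<oplus>\<^bsub>R\<^esub> \<eta> (R, \<phi>) x)"
      if "algebra K R'" "\<psi> \<in> calg_homs K R R'" for R' \<psi>
      using x that by (simp add: facts calg_add)
    show "\<omega> (R, \<phi>) (x \<oplus>\<^bsub>mobj M R\<^esub> y) \<oplus>\<^bsub>R\<^esub> \<eta> (R, \<phi>) (x \<oplus>\<^bsub>mobj M R\<^esub> y) =
      (\<omega> (R, \<phi>) x \<oplus>\<^bsub>R\<^esub> \<eta> (R, \<phi>) x) \<oplus>\<^bsub>mobj Kfun R\<^esub> (\<omega> (R, \<phi>) y \<oplus>\<^bsub>R\<^esub> \<eta> (R, \<phi>) y)"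
      if "y \<in> carrier (mobj M R)" for y
      using x that by (simp add: facts a_ac)
    show "\<omega> (R, \<phi>) (r \<odot>\<^bsub>mobj M R\<^esub> x) \<oplus>\<^bsub>R\<^esub> \<eta> (R, \<phi>) (r \<odot>\<^bsub>mobj M R\<^esub> x) =
      r \<odot>\<^bsub>mobj Kfun R\<^esub> (\<omega> (R, \<phi>) x \<oplus>\<^bsub>R\<^esub> \<eta> (R, \<phi>) x)"
      if "r \<in> carrier R" for r
      using x that by (simp add: facts r_distr)
  qed
  show "s \<odot>\<^bsub>mobj (dual K M) S\<^esub> \<omega> \<in> carrier (mobj (dual K M) S)"
    if s: "s \<in> carrier S" and \<omega>: "\<omega> \<in> carrier (mobj (dual K M) S)"
    unfolding dual_ops_family
  proof (rule family_fun_in_dual[OF M _ S], rule linear_familyI)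
    fix R \<phi> assume R: "algebra K R" "\<phi> \<in> calg_homs K S R"
    interpret cring R by (rule algebra_cring[OF R(1)])
    note facts = dualD[OF \<omega> S R] calg_closed[OF R(2)]
    fix x assume x: "x \<in> carrier (mobj M R)"
    show "\<phi> s \<otimes>\<^bsub>R\<^esub> \<omega> (R, \<phi>) x \<in> carrier (mobj Kfun R)"
      using x s by (simp add: facts)
    show "compose (carrier S) \<psi> \<phi> s \<otimes>\<^bsub>R'\<^esub> \<omega> (R', compose (carrier S) \<psi> \<phi>) (mmor M R R' \<psi> x) =
      mmor Kfun R R' \<psi> (\<phi> s \<otimes>\<^bsub>R\<^esub> \<omega> (R, \<phi>) x)"
      if "algebra K R'" "\<psi> \<in> calg_homs K R R'" for R' \<psi>
      using x s that by (simp add: facts calg_mult)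
    show "\<phi> s \<otimes>\<^bsub>R\<^esub> \<omega> (R, \<phi>) (x \<oplus>\<^bsub>mobj M R\<^esub> y) =
      \<phi> s \<otimes>\<^bsub>R\<^esub> \<omega> (R, \<phi>) x \<oplus>\<^bsub>mobj Kfun R\<^esub> \<phi> s \<otimes>\<^bsub>R\<^esub> \<omega> (R, \<phi>) y"
      if "y \<in> carrier (mobj M R)" for y
      using x s that by (simp add: facts r_distr)
    show "\<phi> s \<otimes>\<^bsub>R\<^esub> \<omega> (R, \<phi>) (r \<odot>\<^bsub>mobj M R\<^esub> x) =
      r \<odot>\<^bsub>mobj Kfun R\<^esub> (\<phi> s \<otimes>\<^bsub>R\<^esub> \<omega> (R, \<phi>) x)"
      if "r \<in> carrier R" for r
      using x s that by (simp add: facts m_lcomm)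
  qed
  show "\<zero>\<^bsub>mobj (dual K M) S\<^esub> \<in> carrier (mobj (dual K M) S)"
    unfolding dual_ops_family
    by (rule family_fun_in_dual[OF M _ S], rule linear_familyI)
       (simp_all add: algebra_closed calg_zero abelian_monoid.l_zero cring.cring_simprules algebra_cring)
qed

lemma dual_base_change:
  assumes M: "linear_functor K M" and "\<omega> \<in> carrier (mobj (dual K M) S)"
    and S: "algebra K S" "algebra K R" "\<phi> \<in> calg_homs K S R"
  shows "base_change K S R \<phi> \<omega> \<in> carrier (mobj (dual K M) R)"
proof -
  have "linear_family K R M Kfun (\<lambda>R' \<psi>. \<omega> (R', compose (carrier S) \<psi> \<phi>))"
    by (rule linear_family_base_change[OF dual_linear[OF assms(2) S(1)] S(3,1,2)])
  moreover have "base_change K S R \<phi> \<omega> =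
      family_fun K R (sets_of M) (\<lambda>R' \<psi>. \<omega> (R', compose (carrier S) \<psi> \<phi>))"
    using assms(2) S compose_calg[OF S(3)]
    by (intro extensional_pair_eqI[of _ K R _ "\<lambda>R. carrier (mobj M R)"])
       (auto simp: family_fun_def dual_carrier_iff)
  ultimately show ?thesis
    using family_fun_in_dual[OF M _ S(2)] by simp
qed

lemma dual_module:
  assumes M: "linear_functor K M" and S: "algebra K S"
  shows "module S (mobj (dual K M) S)"
proof -
  interpret S: cring S by (rule algebra_cring[OF S])
  let ?D = "mobj (dual K M) S"
  note closed = dual_closed[OF M S]
  \<comment> \<open>Equality of forms is tested on values, where each module axiom becomes an
    identity in a commutative ring R.\<close>
  have eqI: "\<omega> = \<eta>" if "\<omega> \<in> carrier ?D" "\<eta> \<in> carrier ?D"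
      "\<And>R \<phi> x. algebra K R \<Longrightarrow> cring R \<Longrightarrow> \<phi> \<in> calg_homs K S R \<Longrightarrow> x \<in> carrier (mobj M R) \<Longrightarrow>
        \<omega> (R, \<phi>) x = \<eta> (R, \<phi>) x" for \<omega> \<eta>
    using dual_eqI[OF that(1,2) S that(3)] algebra_cring by blast
  show ?thesis
  proof (rule moduleI)
    show "cring S" by (rule S.is_cring)
    show "abelian_group ?D"
    proof (rule abelian_groupI)
      fix \<omega> \<eta> \<theta> assume *: "\<omega> \<in> carrier ?D" "\<eta> \<in> carrier ?D"
      show "\<omega> \<oplus>\<^bsub>?D\<^esub> \<eta> \<in> carrier ?D" using * by (rule closed)
      show "\<omega> \<oplus>\<^bsub>?D\<^esub> \<eta> = \<eta> \<oplus>\<^bsub>?D\<^esub> \<omega>"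
        using * by (intro eqI) (simp_all add: closed dualD(1)[OF _ S] cring.cring_simprules)
      show "\<omega> \<oplus>\<^bsub>?D\<^esub> \<eta> \<oplus>\<^bsub>?D\<^esub> \<theta> = \<omega> \<oplus>\<^bsub>?D\<^esub> (\<eta> \<oplus>\<^bsub>?D\<^esub> \<theta>)" if "\<theta> \<in> carrier ?D"
        using * that by (intro eqI) (simp_all add: closed dualD(1)[OF _ S] cring.cring_simprules)
    next
      show "\<zero>\<^bsub>?D\<^esub> \<in> carrier ?D" by (rule closed)
      fix \<omega> assume *: "\<omega> \<in> carrier ?D"
      show "\<zero>\<^bsub>?D\<^esub> \<oplus>\<^bsub>?D\<^esub> \<omega> = \<omega>"
        using * by (intro eqI) (simp_all add: closed dualD(1)[OF _ S] cring.cring_simprules)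
      \<comment> \<open>The additive inverse is taken to be minus one times \<omega>, so that
        closure under scalars supplies its membership.\<close>
      have "(\<ominus>\<^bsub>S\<^esub> \<one>\<^bsub>S\<^esub>) \<odot>\<^bsub>?D\<^esub> \<omega> \<oplus>\<^bsub>?D\<^esub> \<omega> = \<zero>\<^bsub>?D\<^esub>"
      proof (rule eqI)
        fix R \<phi> x assume R: "algebra K R" "cring R" "\<phi> \<in> calg_homs K S R" "x \<in> carrier (mobj M R)"
        then interpret R: cring R by simp
        have "\<phi> (\<ominus>\<^bsub>S\<^esub> \<one>\<^bsub>S\<^esub>) \<oplus>\<^bsub>R\<^esub> \<one>\<^bsub>R\<^esub> = \<zero>\<^bsub>R\<^esub>"
          using calg_add[OF R(3), of "\<ominus>\<^bsub>S\<^esub> \<one>\<^bsub>S\<^esub>" "\<one>\<^bsub>S\<^esub>"] calg_one[OF R(3)] calg_zero[OF R(3) S R(1)]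
          by (simp add: S.l_neg)
        then show "((\<ominus>\<^bsub>S\<^esub> \<one>\<^bsub>S\<^esub>) \<odot>\<^bsub>?D\<^esub> \<omega> \<oplus>\<^bsub>?D\<^esub> \<omega>) (R, \<phi>) x = \<zero>\<^bsub>?D\<^esub> (R, \<phi>) x"
          using R dualD(1)[OF * S R(1,3,4)] calg_closed[OF R(3), of "\<ominus>\<^bsub>S\<^esub> \<one>\<^bsub>S\<^esub>"]
          by simp (metis R.l_distr R.l_null R.l_one R.one_closed)
      qed (use * in \<open>simp_all add: closed\<close>)
      then show "\<exists>\<eta>\<in>carrier ?D. \<eta> \<oplus>\<^bsub>?D\<^esub> \<omega> = \<zero>\<^bsub>?D\<^esub>"
        using * closed(2) by blast
    qed
  next
    show "\<one>\<^bsub>S\<^esub> \<odot>\<^bsub>?D\<^esub> \<omega> = \<omega>" if "\<omega> \<in> carrier ?D" for \<omega>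
      using that by (intro eqI) (simp_all add: closed dualD(1)[OF _ S] calg_one cring.cring_simprules)
  next
    fix s \<omega> assume *: "s \<in> carrier S" "\<omega> \<in> carrier ?D"
    show "s \<odot>\<^bsub>?D\<^esub> \<omega> \<in> carrier ?D" using * by (rule closed)
    show "(s \<oplus>\<^bsub>S\<^esub> t) \<odot>\<^bsub>?D\<^esub> \<omega> = s \<odot>\<^bsub>?D\<^esub> \<omega> \<oplus>\<^bsub>?D\<^esub> t \<odot>\<^bsub>?D\<^esub> \<omega>" if "t \<in> carrier S" for t
      using * that by (intro eqI)
        (simp_all add: closed dualD(1)[OF _ S] calg_add calg_closed cring.cring_simprules)
    show "(s \<otimes>\<^bsub>S\<^esub> t) \<odot>\<^bsub>?D\<^esub> \<omega> = s \<odot>\<^bsub>?D\<^esub> (t \<odot>\<^bsub>?D\<^esub> \<omega>)" if "t \<in> carrier S" for t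
      using * that by (intro eqI)
        (simp_all add: closed dualD(1)[OF _ S] calg_mult calg_closed cring.cring_simprules)
    show "s \<odot>\<^bsub>?D\<^esub> (\<omega> \<oplus>\<^bsub>?D\<^esub> \<eta>) = s \<odot>\<^bsub>?D\<^esub> \<omega> \<oplus>\<^bsub>?D\<^esub> s \<odot>\<^bsub>?D\<^esub> \<eta>" if "\<eta> \<in> carrier ?D" for \<eta>
      using * that by (intro eqI)
        (simp_all add: closed dualD(1)[OF _ S] calg_closed ring.ring_simprules(23) cring.axioms)
  qed
qed

lemma base_change_add:
  assumes "linear_functor K M" "algebra K S" "algebra K R" "\<phi> \<in> calg_homs K S R"
    "\<omega> \<in> carrier (mobj (dual K M) S)" "\<eta> \<in> carrier (mobj (dual K M) S)"
  shows "base_change K S R \<phi> (\<omega> \<oplus>\<^bsub>mobj (dual K M) S\<^esub> \<eta>) =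
    base_change K S R \<phi> \<omega> \<oplus>\<^bsub>mobj (dual K M) R\<^esub> base_change K S R \<phi> \<eta>"
  using assms
  by (intro dual_eqI[of _ K M R]) (auto simp: dual_closed dual_base_change compose_calg[OF assms(4)])

lemma base_change_smult:
  assumes "linear_functor K M" "algebra K S" "algebra K R" "\<phi> \<in> calg_homs K S R"
    "s \<in> carrier S" "\<omega> \<in> carrier (mobj (dual K M) S)"
  shows "base_change K S R \<phi> (s \<odot>\<^bsub>mobj (dual K M) S\<^esub> \<omega>) =
    \<phi> s \<odot>\<^bsub>mobj (dual K M) R\<^esub> base_change K S R \<phi> \<omega>"
  using assms
  by (intro dual_eqI[of _ K M R])
     (auto simp: dual_closed dual_base_change compose_calg[OF assms(4)] calg_closed)

lemma dual_extensional:
  "\<omega> \<in> carrier (mobj (dual K M) S) \<Longrightarrow> algebra K S \<Longrightarrow> \<omega> \<in> extensional (Obj (algs_under K S))"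
  by (simp add: dual_carrier_iff)

lemma dual_module_functor:
  assumes M: "linear_functor K M"
  shows "module_functor (algs K) (dual K M)"
  unfolding module_functor_def set_functor_def ball_algs
  by (simp add: dual_base_change[OF M] base_change_id[OF dual_extensional[of _ K M]] base_change_compose
    dual_module[OF M] base_change_add[OF M] base_change_smult[OF M])

lemma dual_linear_functor: "linear_functor K M \<Longrightarrow> linear_functor K (dual K M)"
  by (rule module_functor_linear[OF dual_module_functor])


section \<open>Transposes, the bidual, and exchanging the arguments of a pairing\<close>

lemma dual_hom_apply [simp]:
  assumes "algebra K S" "\<omega> \<in> carrier (mobj (dual K N) S)" "algebra K R" "\<phi> \<in> calg_homs K S R"
    "x \<in> carrier (mobj M R)"
  shows "dual_hom K M N f S \<omega> (R, \<phi>) x = \<omega> (R, \<phi>) (f R x)"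
  using assms by (simp add: dual_hom_def)

lemma dual_hom_in:
  assumes M: "linear_functor K M" and N: "linear_functor K N" and f: "f \<in> module_homs (algs K) M N"
  shows "dual_hom K M N f \<in> module_homs (algs K) (dual K N) (dual K M)"
proof -
  let ?P = "\<lambda>S \<omega>. family_fun K S (sets_of M) (\<lambda>R \<phi> x. \<omega> (R, \<phi>) (f R x))"
  have eq: "dual_hom K M N f = family_hom K (dual K N) ?P"
    by (simp add: dual_hom_def family_hom_def family_fun_def)
  have closed: "?P S \<omega> \<in> carrier (mobj (dual K M) S)" 
    if "algebra K S" "\<omega> \<in> carrier (mobj (dual K N) S)" for S \<omega>
    by (rule family_fun_in_dual[OF M linear_family_compose[OF module_homs_linear[OF f that(1)]
          dual_linear[OF that(2,1)]] that(1)])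
  show ?thesis
    unfolding eq
  proof (rule family_hom_in[OF dual_linear_functor[OF N]], rule linear_familyI)
    fix S R and \<phi> assume S: "algebra K R" "algebra K S" "\<phi> \<in> calg_homs K S R"
    fix \<omega> assume \<omega>: "\<omega> \<in> carrier (mobj (dual K N) R)"
    show "?P R \<omega> \<in> carrier (mobj (dual K M) R)" by (rule closed[OF S(1) \<omega>])
    show "?P R' (mmor (dual K N) R R' \<psi> \<omega>) = mmor (dual K M) R R' \<psi> (?P R \<omega>)"
      if R': "algebra K R'" "\<psi> \<in> calg_homs K R R'" for R' \<psi>
      using closed S \<omega> R' dual_base_change[OF N \<omega> S(1) R']
      by (intro dual_eqI[of _ K M R'])
         (auto simp: dual_base_change[OF M] compose_calg[OF R'(2)])
    show "?P R (\<omega> \<oplus>\<^bsub>mobj (dual K N) R\<^esub> \<eta>) = ?P R \<omega> \<oplus>\<^bsub>mobj (dual K M) R\<^esub> ?P R \<eta>"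
      if "\<eta> \<in> carrier (mobj (dual K N) R)" for \<eta>
      using closed S \<omega> that
      by (intro dual_eqI[of _ K M R]) (auto simp: dual_closed[OF M] dual_closed[OF N] module_homsD[OF f])
    show "?P R (r \<odot>\<^bsub>mobj (dual K N) R\<^esub> \<omega>) = r \<odot>\<^bsub>mobj (dual K M) R\<^esub> ?P R \<omega>"
      if "r \<in> carrier R" for r
      using closed S \<omega> that
      by (intro dual_eqI[of _ K M R]) (auto simp: dual_closed[OF M] dual_closed[OF N] module_homsD[OF f])
  qed
qed

lemma bidual_map_apply [simp]:
  assumes "algebra K S" "x \<in> carrier (mobj M S)" "algebra K R" "\<phi> \<in> calg_homs K S R"
    "\<omega> \<in> carrier (mobj (dual K M) R)"
  shows "bidual_map K M S x (R, \<phi>) \<omega> = \<omega> (R, id_on R) (mmor M S R \<phi> x)"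
  using assms by (simp add: bidual_map_def)

text \<open>A form given over R is read at its own algebra, under \<open>id_on R\<close>, and x is
  brought from S to R. Besides producing the map into the bidual, this turns values in a dual into
  scalars, one test element x at a time.\<close>

lemma evaluation_family:
  assumes M: "linear_functor K M" and S: "algebra K S" and x: "x \<in> carrier (mobj M S)"
  shows "linear_family K S (dual K M) Kfun (\<lambda>R \<phi> \<omega>. \<omega> (R, id_on R) (mmor M S R \<phi> x))"
proof (rule linear_familyI)
  fix R \<phi> and \<omega> assume R: "algebra K R" "\<phi> \<in> calg_homs K S R" and \<omega>: "\<omega> \<in> carrier (mobj (dual K M) R)"
  note xR = linear_functor_mor(1)[OF M S R x]
  note D = dualD[OF \<omega> R(1) R(1) id_on_calg[OF R(1)] xR]
  show "\<omega> (R, id_on R) (mmor M S R \<phi> x) \<in> carrier (mobj Kfun R)" using D(1) by simp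
  show "mmor (dual K M) R R' \<psi> \<omega> (R', id_on R') (mmor M S R' (compose (carrier S) \<psi> \<phi>) x) =
      mmor Kfun R R' \<psi> (\<omega> (R, id_on R) (mmor M S R \<phi> x))"
    if R': "algebra K R'" "\<psi> \<in> calg_homs K R R'" for R' \<psi>
    using D(2)[OF R'] R' R(1) linear_functor_mor(3)[OF M S R(1) R'(1) R(2) R'(2) x] by simp
  show "(\<omega> \<oplus>\<^bsub>mobj (dual K M) R\<^esub> \<eta>) (R, id_on R) (mmor M S R \<phi> x) =
      \<omega> (R, id_on R) (mmor M S R \<phi> x) \<oplus>\<^bsub>mobj Kfun R\<^esub> \<eta> (R, id_on R) (mmor M S R \<phi> x)" for \<eta>
    using R xR by simp
  show "(r \<odot>\<^bsub>mobj (dual K M) R\<^esub> \<omega>) (R, id_on R) (mmor M S R \<phi> x) =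
      r \<odot>\<^bsub>mobj Kfun R\<^esub> \<omega> (R, id_on R) (mmor M S R \<phi> x)" if "r \<in> carrier R" for r
    using R xR that by simp
qed

lemma bidual_map_in:
  assumes M: "linear_functor K M"
  shows "bidual_map K M \<in> module_homs (algs K) M (dual K (dual K M))"
proof -
  let ?P = "\<lambda>S x. family_fun K S (sets_of (dual K M)) (\<lambda>R \<phi> \<omega>. \<omega> (R, id_on R) (mmor M S R \<phi> x))"
  have eq: "bidual_map K M = family_hom K M ?P"
    by (simp add: bidual_map_def family_hom_def family_fun_def)
  note closed = family_fun_in_dual[OF dual_linear_functor[OF M] evaluation_family[OF M]]
  show ?thesis
    unfolding eq
  proof (rule family_hom_in[OF M], rule linear_familyI)
    fix S R and \<phi> assume S: "algebra K S" "algebra K R" "\<phi> \<in> calg_homs K S R"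
    fix x assume x: "x \<in> carrier (mobj M R)"
    show "?P R x \<in> carrier (mobj (dual K (dual K M)) R)" by (rule closed[OF S(2) x S(2)])
    show "?P R' (mmor M R R' \<psi> x) = mmor (dual K (dual K M)) R R' \<psi> (?P R x)"
      if R': "algebra K R'" "\<psi> \<in> calg_homs K R R'" for R' \<psi>
    proof (rule dual_eqI[of _ K "dual K M" R'])
      have "mmor M R R' \<psi> x \<in> carrier (mobj M R')" using linear_functor_mor(1)[OF M S(2) R' x] .
      from closed[OF R'(1) this R'(1)]
      show "?P R' (mmor M R R' \<psi> x) \<in> carrier (mobj (dual K (dual K M)) R')" .
      show "mmor (dual K (dual K M)) R R' \<psi> (?P R x) \<in> carrier (mobj (dual K (dual K M)) R')"
        using dual_base_change[OF dual_linear_functor[OF M] closed[OF S(2) x S(2)] S(2) R'] by simp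
      show "?P R' (mmor M R R' \<psi> x) (R'', \<chi>) \<omega> = mmor (dual K (dual K M)) R R' \<psi> (?P R x) (R'', \<chi>) \<omega>"
        if "algebra K R''" "\<chi> \<in> calg_homs K R' R''" "\<omega> \<in> carrier (mobj (dual K M) R'')" for R'' \<chi> \<omega>
        using that R' S x compose_calg[OF R'(2) that(2) S(2)]
          linear_functor_mor(3)[OF M S(2) R'(1) that(1) R'(2) that(2) x] by simp
    qed (rule R'(1))
    show "?P R (x \<oplus>\<^bsub>mobj M R\<^esub> y) = ?P R x \<oplus>\<^bsub>mobj (dual K (dual K M)) R\<^esub> ?P R y"
      if y: "y \<in> carrier (mobj M R)" for y
    proof (rule dual_eqI[of _ K "dual K M" R])
      show "?P R (x \<oplus>\<^bsub>mobj M R\<^esub> y) (R', \<chi>) \<omega> = (?P R x \<oplus>\<^bsub>mobj (dual K (dual K M)) R\<^esub> ?P R y) (R', \<chi>) \<omega>"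
        if "algebra K R'" "\<chi> \<in> calg_homs K R R'" "\<omega> \<in> carrier (mobj (dual K M) R')" for R' \<chi> \<omega>
        using that x y S linear_functorD(4)[OF M S(2) that(1,2) x y]
          dualD(3)[OF that(3,1,1) id_on_calg[OF that(1)]] linear_functor_mor(1)[OF M S(2) that(1,2)] by simp
    qed (use closed S x y linear_functorD(2)[OF M] dual_closed(1)[OF dual_linear_functor[OF M]] in auto)
    show "?P R (r \<odot>\<^bsub>mobj M R\<^esub> x) = r \<odot>\<^bsub>mobj (dual K (dual K M)) R\<^esub> ?P R x"
      if r: "r \<in> carrier R" for r
    proof (rule dual_eqI[of _ K "dual K M" R])
      show "?P R (r \<odot>\<^bsub>mobj M R\<^esub> x) (R', \<chi>) \<omega> = (r \<odot>\<^bsub>mobj (dual K (dual K M)) R\<^esub> ?P R x) (R', \<chi>) \<omega>"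
        if "algebra K R'" "\<chi> \<in> calg_homs K R R'" "\<omega> \<in> carrier (mobj (dual K M) R')" for R' \<chi> \<omega>
        using that x r S linear_functorD(5)[OF M S(2) that(1,2) r x]
          dualD(4)[OF that(3,1,1) id_on_calg[OF that(1)]] linear_functor_mor(1)[OF M S(2) that(1,2)]
          calg_closed[OF that(2) r] by simp
    qed (use closed S x r linear_functorD(3)[OF M] dual_closed(2)[OF dual_linear_functor[OF M]] in auto)
  qed
qed

lemma module_homs_compose:
  assumes M: "linear_functor K M" and f: "f \<in> module_homs (algs K) M N" and g: "g \<in> module_homs (algs K) N L"
  shows "family_hom K M (\<lambda>S x. g S (f S x)) \<in> module_homs (algs K) M L"
  by (rule family_hom_in[OF M], rule linear_familyI)
     (simp_all add: module_homsD[OF f] module_homsD[OF g])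

text \<open>The bijection between morphisms \<open>N \<rightarrow> M\<^sup>*\<close> and \<open>M \<rightarrow> N\<^sup>*\<close>.\<close>

definition flip where
  "flip K M N \<Delta> = family_hom K M (\<lambda>S x. dual_hom K N (dual K M) \<Delta> S (bidual_map K M S x))"

lemma flip_in:
  assumes "linear_functor K M" "linear_functor K N" "\<Delta> \<in> module_homs (algs K) N (dual K M)"
  shows "flip K M N \<Delta> \<in> module_homs (algs K) M (dual K N)"
  unfolding flip_def
  by (rule module_homs_compose[OF assms(1) bidual_map_in[OF assms(1)]
        dual_hom_in[OF assms(2) dual_linear_functor[OF assms(1)] assms(3)]])

text \<open>\<open>flip\<close> is the map into the bidual followed by the transpose of \<Delta>. On
  values it exchanges the two arguments of the pairing, once x has been carried to the algebra over
  which y is given.\<close>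

lemma flip_apply:
  assumes M: "linear_functor K M" and \<Delta>: "\<Delta> \<in> module_homs (algs K) N (dual K M)"
    and "algebra K S" "x \<in> carrier (mobj M S)" "algebra K R" "\<phi> \<in> calg_homs K S R" "y \<in> carrier (mobj N R)"
  shows "flip K M N \<Delta> S x (R, \<phi>) y = \<Delta> R y (R, id_on R) (mmor M S R \<phi> x)"
  using assms module_homsD(1)[OF bidual_map_in[OF M]] module_homsD(1)[OF \<Delta>]
  by (simp add: flip_def)

text \<open>Exchanging the arguments twice leaves the pairing of x with y carried from S to R;
  naturality of \<Delta> undoes this transport.\<close>

lemma flip_flip:
  assumes M: "linear_functor K M" and N: "linear_functor K N" and \<Delta>: "\<Delta> \<in> module_homs (algs K) N (dual K M)"
  shows "flip K N M (flip K M N \<Delta>) = \<Delta>"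
proof (rule module_homs_eqI[OF flip_in[OF N M flip_in[OF M N \<Delta>]] \<Delta>])
  fix S y assume S: "algebra K S" and y: "y \<in> carrier (mobj N S)"
  note f = flip_in[OF M N \<Delta>]
  show "flip K N M (flip K M N \<Delta>) S y = \<Delta> S y"
  proof (rule dual_eqI[OF _ _ S])
    fix R \<phi> x assume R: "algebra K R" "\<phi> \<in> calg_homs K S R" and x: "x \<in> carrier (mobj M R)"
    show "flip K N M (flip K M N \<Delta>) S y (R, \<phi>) x = \<Delta> S y (R, \<phi>) x"
      using S y R x linear_functor_mor(1)[OF N S R y] linear_functor_mor(2)[OF M R(1) x]
      by (simp add: flip_apply[OF N f] flip_apply[OF M \<Delta>] module_homsD(2)[OF \<Delta>])
  qed (rule module_homsD(1)[OF flip_in[OF N M f] S y], rule module_homsD(1)[OF \<Delta> S y])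
qed


section \<open>Bilinear families\<close>

lemma module_functorD: "module_functor (algs K) M \<Longrightarrow> algebra K R \<Longrightarrow> module R (mobj M R)"
  by (simp add: module_functor_def)

lemma tensor_fun_simps [simp]:
  "mobj (tensor_fun M N) S = tensor S (mobj M S) (mobj N S)"
  "mmor (tensor_fun M N) S S' \<phi> =
    coset_map S' (mobj M S') (mobj N S') (map_prod (mmor M S S' \<phi>) (mmor N S S' \<phi>))"
  by (simp_all add: tensor_fun_def)

lemma semilinear_pair_functor:
  assumes M: "module_functor (algs K) M" and N: "module_functor (algs K) N"
    and R: "algebra K R" "algebra K R'" "\<phi> \<in> calg_homs K R R'"
  shows "semilinear_pair R (mobj M R) (mobj N R) R' (mobj M R') (mobj N R') \<phi> (mmor M R R' \<phi>) (mmor N R R' \<phi>)"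
  using linear_functor_mor(1)[OF module_functor_linear[OF M]] linear_functor_mor(1)[OF module_functor_linear[OF N]]
    linear_functorD(4,5)[OF module_functor_linear[OF M]] linear_functorD(4,5)[OF module_functor_linear[OF N]]
    module_functorD[OF M] module_functorD[OF N] calg_closed[OF R(3)] R
  by (intro semilinear_pair.intro) auto

text \<open>Identities, composition and compatibility with scalars hold on pure tensors by
  functoriality of M and N, and spread to all tensors because the induced maps are additive.\<close>

lemma tensor_linear_functor:
  assumes M: "module_functor (algs K) M" and N: "module_functor (algs K) N"
  shows "linear_functor K (tensor_fun M N)"
proof -
  note mods = module_functorD[OF M] module_functorD[OF N]
  note sp = semilinear_pair_functor[OF M N]
  note lM = linear_functor_mor[OF module_functor_linear[OF M]]
  note lN = linear_functor_mor[OF module_functor_linear[OF N]]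
  let ?T = "tensor_fun M N"
  have closed: "mmor ?T R R' \<phi> t \<in> carrier (mobj ?T R')"
    if "algebra K R" "algebra K R'" "\<phi> \<in> calg_homs K R R'" "t \<in> carrier (mobj ?T R)" for R R' \<phi> t
    using semilinear_pair.coset_map_closed[OF sp] that by simp
  have mor_add: "mmor ?T R R' \<phi> (s \<oplus>\<^bsub>mobj ?T R\<^esub> t) = mmor ?T R R' \<phi> s \<oplus>\<^bsub>mobj ?T R'\<^esub> mmor ?T R R' \<phi> t"
    if "algebra K R" "algebra K R'" "\<phi> \<in> calg_homs K R R'" "s \<in> carrier (mobj ?T R)" "t \<in> carrier (mobj ?T R)"
    for R R' \<phi> s t
    using semilinear_pair.coset_map_add[OF sp] that by simp
  have mor_pure: "mmor ?T R R' \<phi> (pure_tensor R (mobj M R) (mobj N R) x y) =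
      pure_tensor R' (mobj M R') (mobj N R') (mmor M R R' \<phi> x) (mmor N R R' \<phi> y)"
    if "algebra K R" "algebra K R'" "\<phi> \<in> calg_homs K R R'" "x \<in> carrier (mobj M R)" "y \<in> carrier (mobj N R)"
    for R R' \<phi> x y
    using semilinear_pair.coset_map_pure[OF sp] that by simp
  have id: "mmor ?T R R (id_on R) t = t" if R: "algebra K R" and t: "t \<in> carrier (mobj ?T R)" for R t
    using t unfolding tensor_fun_simps(1)
    by (induction rule: tensor_induct[OF module_functorD[OF M R] module_functorD[OF N R], consumes 1, case_names pure add])
       (use mor_pure mor_add R lM(2) lN(2) in \<open>simp_all only: tensor_fun_simps(1) id_on_calg\<close>)
  have comp: "mmor ?T R R'' (compose (carrier R) \<psi> \<phi>) t = mmor ?T R' R'' \<psi> (mmor ?T R R' \<phi> t)"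
    if R: "algebra K R" "algebra K R'" "algebra K R''" "\<phi> \<in> calg_homs K R R'" "\<psi> \<in> calg_homs K R' R''"
      and t: "t \<in> carrier (mobj ?T R)" for R R' R'' \<phi> \<psi> t
    using t unfolding tensor_fun_simps(1)
  proof (induction rule: tensor_induct[OF module_functorD[OF M R(1)] module_functorD[OF N R(1)], consumes 1, case_names pure add])
    case (pure x y)
    then show ?case
      using R mor_pure
        lM(1,3) lN(1,3) compose_calg[OF R(4,5,1)] by simp
  next
    case (add s t)
    then show ?case
      using R mor_add
        closed compose_calg[OF R(4,5,1)] by (simp only: tensor_fun_simps(1))
  qed
  have smult: "mmor ?T R R' \<phi> (r \<odot>\<^bsub>mobj ?T R\<^esub> t) = \<phi> r \<odot>\<^bsub>mobj ?T R'\<^esub> mmor ?T R R' \<phi> t"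
    if R: "algebra K R" "algebra K R'" "\<phi> \<in> calg_homs K R R'" and r: "r \<in> carrier R"
      and t: "t \<in> carrier (mobj ?T R)" for R R' \<phi> r t
    using t unfolding tensor_fun_simps(1)
  proof (induction rule: tensor_induct[OF module_functorD[OF M R(1)] module_functorD[OF N R(1)], consumes 1, case_names pure add])
    case (pure x y)
    have "r \<odot>\<^bsub>mobj M R\<^esub> x \<in> carrier (mobj M R)"
      using linear_functorD(3)[OF module_functor_linear[OF M] R(1) r pure(1)] .
    then show ?case
      using pure R r calg_closed[OF R(3) r] lM(1) lN(1) linear_functorD(5)[OF module_functor_linear[OF M] R r pure(1)]
      by (simp only: tensor_fun_simps(1) tensor_smult_pure[OF mods] mor_pure)
  next
    case (add s t)
    then show ?case
      using R r calg_closed[OF R(3) r] closed tensor_smult_closed[OF mods]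
        mor_add
      by (simp only: tensor_fun_simps(1) tensor_smult_add[OF mods])
  qed
  show ?thesis
    unfolding linear_functor_def set_functor_def ball_algs
    using closed mor_add id comp smult tensor_add_closed[OF mods] tensor_smult_closed[OF mods]
    by (simp del: tensor_fun_simps(2))
qed

text \<open>Curried, and natural in both arguments at once, so that linear families may be
  substituted into either argument before any tensor product is formed.\<close>

definition bilinear_family ::
  "'u ring \<Rightarrow> 'u alg \<Rightarrow> ('u alg, 'u, 'm) mfun \<Rightarrow> ('u alg, 'u, 'n) mfun \<Rightarrow> ('u alg, 'u, 'p) mfun \<Rightarrow>
    ('u alg \<Rightarrow> ('u \<Rightarrow> 'u) \<Rightarrow> 'm \<Rightarrow> 'n \<Rightarrow> 'p) \<Rightarrow> bool" where
  "bilinear_family K S M N L P \<longleftrightarrow>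
    (\<forall>R \<phi> R' \<psi> x y. algebra K R \<longrightarrow> \<phi> \<in> calg_homs K S R \<longrightarrow> algebra K R' \<longrightarrow> \<psi> \<in> calg_homs K R R' \<longrightarrow>
      x \<in> carrier (mobj M R) \<longrightarrow> y \<in> carrier (mobj N R) \<longrightarrow>
      P R' (compose (carrier S) \<psi> \<phi>) (mmor M R R' \<psi> x) (mmor N R R' \<psi> y) = mmor L R R' \<psi> (P R \<phi> x y)) \<and>
    (\<forall>R \<phi> x y. algebra K R \<longrightarrow> \<phi> \<in> calg_homs K S R \<longrightarrow> x \<in> carrier (mobj M R) \<longrightarrow> y \<in> carrier (mobj N R) \<longrightarrow>
      P R \<phi> x y \<in> carrier (mobj L R) \<and>
      (\<forall>x'\<in>carrier (mobj M R). P R \<phi> (x \<oplus>\<^bsub>mobj M R\<^esub> x') y = P R \<phi> x y \<oplus>\<^bsub>mobj L R\<^esub> P R \<phi> x' y) \<and>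
      (\<forall>y'\<in>carrier (mobj N R). P R \<phi> x (y \<oplus>\<^bsub>mobj N R\<^esub> y') = P R \<phi> x y \<oplus>\<^bsub>mobj L R\<^esub> P R \<phi> x y') \<and>
      (\<forall>r\<in>carrier R. P R \<phi> (r \<odot>\<^bsub>mobj M R\<^esub> x) y = r \<odot>\<^bsub>mobj L R\<^esub> P R \<phi> x y) \<and>
      (\<forall>r\<in>carrier R. P R \<phi> x (r \<odot>\<^bsub>mobj N R\<^esub> y) = r \<odot>\<^bsub>mobj L R\<^esub> P R \<phi> x y))"

lemma bilinear_familyD:
  assumes "bilinear_family K S M N L P" "algebra K R" "\<phi> \<in> calg_homs K S R"
    "x \<in> carrier (mobj M R)" "y \<in> carrier (mobj N R)"
  shows "P R \<phi> x y \<in> carrier (mobj L R)"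
    and "algebra K R' \<Longrightarrow> \<psi> \<in> calg_homs K R R' \<Longrightarrow>
      P R' (compose (carrier S) \<psi> \<phi>) (mmor M R R' \<psi> x) (mmor N R R' \<psi> y) = mmor L R R' \<psi> (P R \<phi> x y)"
    and "x' \<in> carrier (mobj M R) \<Longrightarrow> P R \<phi> (x \<oplus>\<^bsub>mobj M R\<^esub> x') y = P R \<phi> x y \<oplus>\<^bsub>mobj L R\<^esub> P R \<phi> x' y"
    and "y' \<in> carrier (mobj N R) \<Longrightarrow> P R \<phi> x (y \<oplus>\<^bsub>mobj N R\<^esub> y') = P R \<phi> x y \<oplus>\<^bsub>mobj L R\<^esub> P R \<phi> x y'"
    and "r \<in> carrier R \<Longrightarrow> P R \<phi> (r \<odot>\<^bsub>mobj M R\<^esub> x) y = r \<odot>\<^bsub>mobj L R\<^esub> P R \<phi> x y"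
    and "r \<in> carrier R \<Longrightarrow> P R \<phi> x (r \<odot>\<^bsub>mobj N R\<^esub> y) = r \<odot>\<^bsub>mobj L R\<^esub> P R \<phi> x y"
  using assms unfolding bilinear_family_def by simp_all

lemma bilinear_family_compose:
  assumes "bilinear_family K S M N L P" "linear_family K S L L' Q"
  shows "bilinear_family K S M N L' (\<lambda>R \<phi> x y. Q R \<phi> (P R \<phi> x y))"
  unfolding bilinear_family_def
  by (simp add: bilinear_familyD[OF assms(1)] linear_familyD[OF assms(2)])

lemma bilinear_family_precompose:
  assumes "linear_family K S M' M A" "linear_family K S N' N B" "bilinear_family K S M N L P"
  shows "bilinear_family K S M' N' L (\<lambda>R \<phi> x y. P R \<phi> (A R \<phi> x) (B R \<phi> y))"
  unfolding bilinear_family_def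
  by (simp add: bilinear_familyD[OF assms(3)] linear_familyD[OF assms(1)] linear_familyD[OF assms(2)])

lemma bilinear_family_base_change:
  assumes P: "bilinear_family K S M N L P" and \<sigma>: "\<sigma> \<in> calg_homs K S S'" and S: "algebra K S" "algebra K S'"
  shows "bilinear_family K S' M N L (\<lambda>R \<phi>. P R (compose (carrier S) \<phi> \<sigma>))"
  using bilinear_familyD[OF P] compose_calg[OF \<sigma> _ S(1)]
  unfolding bilinear_family_def by (simp add: compose_calg_assoc[OF \<sigma>])

lemma bilinear_family_right:
  assumes P: "bilinear_family K S M N L P" and S: "algebra K S" and M: "linear_functor K M"
    and x: "x \<in> carrier (mobj M S)"
  shows "linear_family K S N L (\<lambda>R \<phi>. P R \<phi> (mmor M S R \<phi> x))"
proof (rule linear_familyI)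
  show "P R' (compose (carrier S) \<psi> \<phi>) (mmor M S R' (compose (carrier S) \<psi> \<phi>) x) (mmor N R R' \<psi> y) =
      mmor L R R' \<psi> (P R \<phi> (mmor M S R \<phi> x) y)"
    if "algebra K R" "\<phi> \<in> calg_homs K S R" "algebra K R'" "\<psi> \<in> calg_homs K R R'" "y \<in> carrier (mobj N R)"
    for R \<phi> R' \<psi> y
    using bilinear_familyD(2)[OF P that(1,2) _ that(5,3,4)] linear_functor_mor[OF M] S x that
    by (simp flip: linear_functor_mor(3)[OF M])
qed (simp_all add: bilinear_familyD[OF P] linear_functor_mor(1)[OF M S _ _ x])

lemma bilinear_family_left:
  assumes P: "bilinear_family K S M N L P" and S: "algebra K S" and N: "linear_functor K N"
    and y: "y \<in> carrier (mobj N S)"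
  shows "linear_family K S M L (\<lambda>R \<phi> x. P R \<phi> x (mmor N S R \<phi> y))"
proof -
  have "bilinear_family K S N M L (\<lambda>R \<phi> x y. P R \<phi> y x)"
    unfolding bilinear_family_def by (simp add: bilinear_familyD[OF P])
  from bilinear_family_right[OF this S N y] show ?thesis .
qed

lemma pure_tensor_bilinear:
  assumes M: "module_functor (algs K) M" and N: "module_functor (algs K) N"
  shows "bilinear_family K S M N (tensor_fun M N) (\<lambda>R \<phi>. pure_tensor R (mobj M R) (mobj N R))"
proof -
  note mods = module_functorD[OF M] module_functorD[OF N]
  show ?thesis
    unfolding bilinear_family_def
    by (simp add: semilinear_pair.coset_map_pure[OF semilinear_pair_functor[OF M N]]
        pure_tensor_closed[OF mods] pure_tensor_add_left[OF mods] pure_tensor_add_right[OF mods]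
        tensor_smult_pure[OF mods] pure_tensor_smult_swap[OF mods, symmetric])
qed

text \<open>The universal property is applied over each R and \<phi> separately. The resulting maps
  fit together because they are prescribed on pure tensors, where P is natural, and pure tensors
  generate additively.\<close>

lemma tensor_dual_lift:
  assumes M: "module_functor (algs K) M" and N: "module_functor (algs K) N" and S: "algebra K S"
    and P: "bilinear_family K S M N Kfun P"
  obtains \<omega> where "\<omega> \<in> carrier (mobj (dual K (tensor_fun M N)) S)"
    "\<And>R \<phi> x y. algebra K R \<Longrightarrow> \<phi> \<in> calg_homs K S R \<Longrightarrow> x \<in> carrier (mobj M R) \<Longrightarrow> y \<in> carrier (mobj N R) \<Longrightarrow>
      \<omega> (R, \<phi>) (pure_tensor R (mobj M R) (mobj N R) x y) = P R \<phi> x y"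
proof -
  note mods = module_functorD[OF M] module_functorD[OF N]
  let ?T = "tensor_fun M N"
  let ?p = "\<lambda>R. pure_tensor R (mobj M R) (mobj N R)"
  have "\<exists>h. h \<in> carrier (mobj ?T R) \<rightarrow> carrier R \<and>
      (\<forall>s\<in>carrier (mobj ?T R). \<forall>t\<in>carrier (mobj ?T R). h (s \<oplus>\<^bsub>mobj ?T R\<^esub> t) = h s \<oplus>\<^bsub>R\<^esub> h t) \<and>
      (\<forall>x\<in>carrier (mobj M R). \<forall>y\<in>carrier (mobj N R). h (?p R x y) = P R \<phi> x y)"
    if R: "algebra K R" "\<phi> \<in> calg_homs K S R" for R \<phi>
  proof -
    interpret cring R by (rule algebra_cring[OF R(1)])
    obtain h where "h \<in> carrier (tensor R (mobj M R) (mobj N R)) \<rightarrow> carrier R"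
      "\<And>s t. s \<in> carrier (tensor R (mobj M R) (mobj N R)) \<Longrightarrow> t \<in> carrier (tensor R (mobj M R) (mobj N R)) \<Longrightarrow>
        h (s \<oplus>\<^bsub>tensor R (mobj M R) (mobj N R)\<^esub> t) = h s \<oplus>\<^bsub>R\<^esub> h t"
      "\<And>x y. x \<in> carrier (mobj M R) \<Longrightarrow> y \<in> carrier (mobj N R) \<Longrightarrow> h (?p R x y) = P R \<phi> x y"
      by (rule tensor_universal[OF module_functorD[OF M R(1)] module_functorD[OF N R(1)] abelian_group_axioms, of "P R \<phi>"])
         (use bilinear_familyD[OF P R] in auto)
    then show ?thesis by auto
  qed
  \<comment> \<open>Simultaneous choice over all R and \<phi>; nothing relates the chosen maps to
    each other yet.\<close>
  then have "\<exists>h. \<forall>R \<phi>. algebra K R \<longrightarrow> \<phi> \<in> calg_homs K S R \<longrightarrow>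
      h R \<phi> \<in> carrier (mobj ?T R) \<rightarrow> carrier R \<and>
      (\<forall>s\<in>carrier (mobj ?T R). \<forall>t\<in>carrier (mobj ?T R). h R \<phi> (s \<oplus>\<^bsub>mobj ?T R\<^esub> t) = h R \<phi> s \<oplus>\<^bsub>R\<^esub> h R \<phi> t) \<and>
      (\<forall>x\<in>carrier (mobj M R). \<forall>y\<in>carrier (mobj N R). h R \<phi> (?p R x y) = P R \<phi> x y)"
    by metis
  then obtain h where h: "\<And>R \<phi>. algebra K R \<Longrightarrow> \<phi> \<in> calg_homs K S R \<Longrightarrow>
      h R \<phi> \<in> carrier (mobj ?T R) \<rightarrow> carrier R \<and>
      (\<forall>s\<in>carrier (mobj ?T R). \<forall>t\<in>carrier (mobj ?T R). h R \<phi> (s \<oplus>\<^bsub>mobj ?T R\<^esub> t) = h R \<phi> s \<oplus>\<^bsub>R\<^esub> h R \<phi> t) \<and>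
      (\<forall>x\<in>carrier (mobj M R). \<forall>y\<in>carrier (mobj N R). h R \<phi> (?p R x y) = P R \<phi> x y)"
    by blast
  have h_closed: "h R \<phi> t \<in> carrier R"
    if "algebra K R" "\<phi> \<in> calg_homs K S R" "t \<in> carrier (mobj ?T R)" for R \<phi> t
    using h[OF that(1,2)] that(3) by blast
  have h_add: "h R \<phi> (s \<oplus>\<^bsub>mobj ?T R\<^esub> t) = h R \<phi> s \<oplus>\<^bsub>R\<^esub> h R \<phi> t"
    if "algebra K R" "\<phi> \<in> calg_homs K S R" "s \<in> carrier (mobj ?T R)" "t \<in> carrier (mobj ?T R)" for R \<phi> s t
    using h[OF that(1,2)] that(3,4) by blast
  have h_pure: "h R \<phi> (?p R x y) = P R \<phi> x y"
    if "algebra K R" "\<phi> \<in> calg_homs K S R" "x \<in> carrier (mobj M R)" "y \<in> carrier (mobj N R)" for R \<phi> x y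
    using h[OF that(1,2)] that(3,4) by blast
  note T = tensor_linear_functor[OF M N]
  note pt = bilinear_familyD[OF pure_tensor_bilinear[OF M N]]
  have lin: "linear_family K S ?T Kfun h"
  proof (rule linear_familyI)
    fix R \<phi> t assume R: "algebra K R" "\<phi> \<in> calg_homs K S R" and t: "t \<in> carrier (mobj ?T R)"
    interpret cring R by (rule algebra_cring[OF R(1)])
    show "h R \<phi> t \<in> carrier (mobj Kfun R)" using h_closed[OF R t] by simp
    show "h R \<phi> (t \<oplus>\<^bsub>mobj ?T R\<^esub> s) = h R \<phi> t \<oplus>\<^bsub>mobj Kfun R\<^esub> h R \<phi> s" if "s \<in> carrier (mobj ?T R)" for s
      using h_add[OF R t that] by simp
    \<comment> \<open>Naturality and compatibility with scalars are not part of the universal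
      property. Both are checked on pure tensors, where h is P, and pass to sums.\<close>
    show "h R' (compose (carrier S) \<psi> \<phi>) (mmor ?T R R' \<psi> t) = mmor Kfun R R' \<psi> (h R \<phi> t)"
      if R': "algebra K R'" "\<psi> \<in> calg_homs K R R'" for R' \<psi>
      using t unfolding tensor_fun_simps(1)
    proof (induction rule: tensor_induct[OF module_functorD[OF M R(1)] module_functorD[OF N R(1)], consumes 1, case_names pure add])
      case (pure x y)
      note c = compose_calg[OF R(2) R'(2) S]
      have "mmor ?T R R' \<psi> (?p R x y) = ?p R' (mmor M R R' \<psi> x) (mmor N R R' \<psi> y)"
        using pt(2)[OF R pure R'] by simp
      then show ?case
        using pure R R' c h_pure linear_functor_mor(1)[OF module_functor_linear[OF M]]
          linear_functor_mor(1)[OF module_functor_linear[OF N]] bilinear_familyD(2)[OF P R pure R'] by simp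
    next
      case (add s t)
      note c = compose_calg[OF R(2) R'(2) S]
      have st: "s \<in> carrier (mobj ?T R)" "t \<in> carrier (mobj ?T R)" using add by simp_all
      have "h R' (compose (carrier S) \<psi> \<phi>) (mmor ?T R R' \<psi> (s \<oplus>\<^bsub>mobj ?T R\<^esub> t)) =
          h R' (compose (carrier S) \<psi> \<phi>) (mmor ?T R R' \<psi> s) \<oplus>\<^bsub>R'\<^esub>
          h R' (compose (carrier S) \<psi> \<phi>) (mmor ?T R R' \<psi> t)"
        using linear_functorD(4)[OF T R(1) R' st] linear_functor_mor(1)[OF T R(1) R'] st h_add[OF R'(1) c]
        by (simp del: tensor_fun_simps)
      then show ?case
        using add.IH h_add[OF R st] calg_add[OF R'(2)] h_closed[OF R] st by simp
    qed
    show "h R \<phi> (r \<odot>\<^bsub>mobj ?T R\<^esub> t) = r \<odot>\<^bsub>mobj Kfun R\<^esub> h R \<phi> t" if r: "r \<in> carrier R" for r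
      using t unfolding tensor_fun_simps(1)
    proof (induction rule: tensor_induct[OF module_functorD[OF M R(1)] module_functorD[OF N R(1)], consumes 1, case_names pure add])
      case (pure x y)
      then show ?case
        using R r h_pure bilinear_familyD(5)[OF P R pure r] linear_functorD(3)[OF module_functor_linear[OF M] R(1) r]
          tensor_smult_pure[OF module_functorD[OF M R(1)] module_functorD[OF N R(1)] r] by simp
    next
      case (add s t)
      have st: "s \<in> carrier (mobj ?T R)" "t \<in> carrier (mobj ?T R)" using add by simp_all
      have "r \<odot>\<^bsub>mobj ?T R\<^esub> (s \<oplus>\<^bsub>mobj ?T R\<^esub> t) = r \<odot>\<^bsub>mobj ?T R\<^esub> s \<oplus>\<^bsub>mobj ?T R\<^esub> r \<odot>\<^bsub>mobj ?T R\<^esub> t"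
        using tensor_smult_add[OF module_functorD[OF M R(1)] module_functorD[OF N R(1)] r] add by simp
      moreover have "r \<odot>\<^bsub>mobj ?T R\<^esub> s \<in> carrier (mobj ?T R)" "r \<odot>\<^bsub>mobj ?T R\<^esub> t \<in> carrier (mobj ?T R)"
        using linear_functorD(3)[OF T R(1) r] st by blast+
      ultimately show ?case
        using add.IH h_add[OF R] st h_closed[OF R] r by (simp add: r_distr)
    qed
  qed
  show thesis
  proof (rule that[OF family_fun_in_dual[OF T lin S]])
    show "family_fun K S (sets_of ?T) h (R, \<phi>) (?p R x y) = P R \<phi> x y"
      if "algebra K R" "\<phi> \<in> calg_homs K S R" "x \<in> carrier (mobj M R)" "y \<in> carrier (mobj N R)" for R \<phi> x y
      using that h_pure pt(1)[OF that] by simp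
  qed
qed


section \<open>Evaluation at points\<close>

lemma funs_linear_functor:
  assumes X: "set_functor (algs K) X"
  shows "linear_functor K (funs K X)"
proof -
  have id: "base_change K R R (id_on R) f = f" if "f \<in> carrier (mobj (funs K X) R)" "algebra K R" for f R
    using that by (simp add: base_change_id funs_carrier_iff)
  have add: "base_change K R R' \<phi> (f \<oplus>\<^bsub>mobj (funs K X) R\<^esub> g) =
      base_change K R R' \<phi> f \<oplus>\<^bsub>mobj (funs K X) R'\<^esub> base_change K R R' \<phi> g"
    if "algebra K R" "algebra K R'" "\<phi> \<in> calg_homs K R R'" "f \<in> carrier (mobj (funs K X) R)"
      "g \<in> carrier (mobj (funs K X) R)" for R R' \<phi> f g
    using that
    by (intro funs_eqI[of _ K X R']) (simp_all add: funs_base_change funs_closed[OF X] compose_calg[OF that(3)])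
  have smult: "base_change K R R' \<phi> (r \<odot>\<^bsub>mobj (funs K X) R\<^esub> f) =
      \<phi> r \<odot>\<^bsub>mobj (funs K X) R'\<^esub> base_change K R R' \<phi> f"
    if "algebra K R" "algebra K R'" "\<phi> \<in> calg_homs K R R'" "r \<in> carrier R" "f \<in> carrier (mobj (funs K X) R)"
    for R R' \<phi> r f
    using that
    by (intro funs_eqI[of _ K X R'])
       (simp_all add: funs_base_change funs_closed[OF X] compose_calg[OF that(3)] calg_closed)
  show ?thesis
    unfolding linear_functor_def set_functor_def ball_algs
    by (simp add: funs_base_change funs_closed[OF X] id add smult base_change_compose)
qed

lemma base_change_mult:
  assumes X: "set_functor (algs K) X" and "algebra K R" "algebra K R'" "\<phi> \<in> calg_homs K R R'"
    "f \<in> carrier (mobj (funs K X) R)" "g \<in> carrier (mobj (funs K X) R)"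
  shows "base_change K R R' \<phi> (f \<otimes>\<^bsub>mobj (funs K X) R\<^esub> g) =
    base_change K R R' \<phi> f \<otimes>\<^bsub>mobj (funs K X) R'\<^esub> base_change K R R' \<phi> g"
  using assms
  by (intro funs_eqI[of _ K X R']) (simp_all add: funs_base_change funs_closed[OF X] compose_calg[OF assms(4)])

lemma base_change_one:
  assumes X: "set_functor (algs K) X" and "algebra K R" "algebra K R'" "\<phi> \<in> calg_homs K R R'"
  shows "base_change K R R' \<phi> \<one>\<^bsub>mobj (funs K X) R\<^esub> = \<one>\<^bsub>mobj (funs K X) R'\<^esub>"
  using assms
  by (intro funs_eqI[of _ K X R']) (simp_all add: funs_base_change funs_closed[OF X] compose_calg[OF assms(4)])

section \<open>Points of the spectrum and the evaluation map\<close>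

lemma Spec_simps [simp]:
  "mor (Spec K A) = base_change K"
  by (simp add: Spec_def)

text \<open>Places the points of the spectrum inside the dual of A, so that equality tests and base
  change for linear forms apply to them.\<close>

lemma Spec_iff:
  assumes "algebra K S"
  shows "\<omega> \<in> obj (Spec K A) S \<longleftrightarrow> \<omega> \<in> carrier (mobj (dual K A) S) \<and>
    (\<forall>R \<phi>. algebra K R \<longrightarrow> \<phi> \<in> calg_homs K S R \<longrightarrow>
      (\<forall>f\<in>carrier (mobj A R). \<forall>g\<in>carrier (mobj A R).
        \<omega> (R, \<phi>) (f \<otimes>\<^bsub>mobj A R\<^esub> g) = \<omega> (R, \<phi>) f \<otimes>\<^bsub>R\<^esub> \<omega> (R, \<phi>) g) \<and>
      \<omega> (R, \<phi>) \<one>\<^bsub>mobj A R\<^esub> = \<one>\<^bsub>R\<^esub>)"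
  by (simp add: Spec_def algebra_homs_def dual_def ihom_def ball_under)

lemma eval_map_apply [simp]:
  assumes "algebra K S" "x \<in> obj X S" "algebra K R" "\<phi> \<in> calg_homs K S R" "f \<in> carrier (mobj (funs K X) R)"
  shows "eval_map K X S x (R, \<phi>) f = f (R, id_on R) (mor X S R \<phi> x)"
  using assms by (simp add: eval_map_def)

lemma eval_map_in:
  assumes X: "set_functor (algs K) X" and S: "algebra K S" and x: "x \<in> obj X S"
  shows "eval_map K X S x \<in> carrier (mobj (funs_dual K X) S)"
proof -
  have "linear_family K S (funs K X) Kfun (\<lambda>R \<phi> f. f (R, id_on R) (mor X S R \<phi> x))"
  proof (rule linear_familyI)
    fix R \<phi> f assume R: "algebra K R" "\<phi> \<in> calg_homs K S R" and f: "f \<in> carrier (mobj (funs K X) R)"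
    note xR = set_functorD(1)[OF X S R x]
    show "f (R, id_on R) (mor X S R \<phi> x) \<in> carrier (mobj Kfun R)"
      using funsD(1)[OF f R(1) R(1) _ xR] R(1) by simp
    show "mmor (funs K X) R R' \<psi> f (R', id_on R') (mor X S R' (compose (carrier S) \<psi> \<phi>) x) =
        mmor Kfun R R' \<psi> (f (R, id_on R) (mor X S R \<phi> x))"
      if R': "algebra K R'" "\<psi> \<in> calg_homs K R R'" for R' \<psi>
      using funsD(2)[OF f R(1) R(1) id_on_calg[OF R(1)] R' xR] R' R(1) set_functorD(3)[OF X S R(1) R'(1) R(2) R'(2) x] by simp
    show "(f \<oplus>\<^bsub>mobj (funs K X) R\<^esub> g) (R, id_on R) (mor X S R \<phi> x) =
        f (R, id_on R) (mor X S R \<phi> x) \<oplus>\<^bsub>mobj Kfun R\<^esub> g (R, id_on R) (mor X S R \<phi> x)" for g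
      using R xR by simp
    show "(r \<odot>\<^bsub>mobj (funs K X) R\<^esub> f) (R, id_on R) (mor X S R \<phi> x) =
        r \<odot>\<^bsub>mobj Kfun R\<^esub> f (R, id_on R) (mor X S R \<phi> x)" if "r \<in> carrier R" for r
      using R xR that by simp
  qed
  from family_fun_in_dual[OF funs_linear_functor[OF X] this S]
  show ?thesis using S x by (simp add: eval_map_def family_fun_def)
qed

text \<open>Naturality of the map from X to the dual of its functions; it allows expressions in
  evaluations to be compared over further algebras.\<close>

lemma eval_map_base_change:
  assumes X: "set_functor (algs K) X" and S: "algebra K S" "algebra K R" "\<phi> \<in> calg_homs K S R" and x: "x \<in> obj X S"
  shows "base_change K S R \<phi> (eval_map K X S x) = eval_map K X R (mor X S R \<phi> x)"
proof (rule dual_eqI)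
  show "base_change K S R \<phi> (eval_map K X S x) \<in> carrier (mobj (funs_dual K X) R)"
    by (rule dual_base_change[OF funs_linear_functor[OF X] eval_map_in[OF X S(1) x] S])
  show "eval_map K X R (mor X S R \<phi> x) \<in> carrier (mobj (funs_dual K X) R)"
    by (rule eval_map_in[OF X S(2) set_functorD(1)[OF X S x]])
  show "base_change K S R \<phi> (eval_map K X S x) (R', \<psi>) f = eval_map K X R (mor X S R \<phi> x) (R', \<psi>) f"
    if "algebra K R'" "\<psi> \<in> calg_homs K R R'" "f \<in> carrier (mobj (funs K X) R')" for R' \<psi> f
    using that S x set_functorD(1)[OF X S x] compose_calg[OF S(3) that(2) S(1)]
      set_functorD(3)[OF X S(1,2) that(1) S(3) that(2) x] by simp
qed (rule S(2))

section \<open>Linear and bilinear maps determined by their values at points\<close>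

definition families_agree ::
  "'u ring \<Rightarrow> 'u alg \<Rightarrow> ('u alg, 'u, 'x) sfun \<Rightarrow> ('u alg \<Rightarrow> ('u \<Rightarrow> 'u) \<Rightarrow> 'x \<Rightarrow> 'y) \<Rightarrow>
    ('u alg \<Rightarrow> ('u \<Rightarrow> 'u) \<Rightarrow> 'x \<Rightarrow> 'y) \<Rightarrow> bool" where
  "families_agree K S X P Q \<longleftrightarrow>
    (\<forall>R \<phi>. algebra K R \<longrightarrow> \<phi> \<in> calg_homs K S R \<longrightarrow> (\<forall>x\<in>obj X R. P R \<phi> x = Q R \<phi> x))"

text \<open>The target N is a parameter: reflexivity yields the property for scalars, while products
  and transposes take values in duals. All bases S occur, because frozen arguments live over
  algebras other than the original base.\<close>

definition evals_determine :: "'u ring \<Rightarrow> ('u alg, 'u, 'x) sfun \<Rightarrow> ('u alg, 'u, 'n) mfun \<Rightarrow> bool" where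
  "evals_determine K X N \<longleftrightarrow> (\<forall>S P Q. algebra K S \<longrightarrow>
    linear_family K S (funs_dual K X) N P \<longrightarrow> linear_family K S (funs_dual K X) N Q \<longrightarrow>
    families_agree K S X (\<lambda>R \<phi> x. P R \<phi> (eval_map K X R x)) (\<lambda>R \<phi> x. Q R \<phi> (eval_map K X R x)) \<longrightarrow>
    families_agree K S (sets_of (funs_dual K X)) P Q)"

lemma evals_determineD:
  assumes "evals_determine K X N" "algebra K S"
    "linear_family K S (funs_dual K X) N P" "linear_family K S (funs_dual K X) N Q"
    "\<And>R \<phi> x. algebra K R \<Longrightarrow> \<phi> \<in> calg_homs K S R \<Longrightarrow> x \<in> obj X R \<Longrightarrow>
      P R \<phi> (eval_map K X R x) = Q R \<phi> (eval_map K X R x)"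
    "algebra K R" "\<phi> \<in> calg_homs K S R" "u \<in> carrier (mobj (funs_dual K X) R)"
  shows "P R \<phi> u = Q R \<phi> u"
proof -
  have "families_agree K S X (\<lambda>R \<phi> x. P R \<phi> (eval_map K X R x)) (\<lambda>R \<phi> x. Q R \<phi> (eval_map K X R x))"
    using assms(5) unfolding families_agree_def by blast
  with assms(1-4) have "families_agree K S (sets_of (funs_dual K X)) P Q"
    unfolding evals_determine_def by blast
  then show ?thesis using assms(6-8) unfolding families_agree_def by simp
qed

lemma reflexive_evals_determine:
  assumes X: "set_functor (algs K) X" and refl: "reflexive K (funs K X)"
  shows "evals_determine K X Kfun"
  unfolding evals_determine_def
proof (intro allI impI)
  fix S P Q
  assume S: "algebra K S" and P: "linear_family K S (funs_dual K X) Kfun P"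
    and Q: "linear_family K S (funs_dual K X) Kfun Q"
    and PQ: "families_agree K S X (\<lambda>R \<phi> x. P R \<phi> (eval_map K X R x)) (\<lambda>R \<phi> x. Q R \<phi> (eval_map K X R x))"
  note lin = funs_linear_functor[OF X]
  let ?el = "family_fun K S (sets_of (funs_dual K X))"
  \<comment> \<open>The inverse morphism provided by reflexivity makes the map into the bidual
    surjective over S.\<close>
  have rep: "\<exists>f\<in>carrier (mobj (funs K X) S). bidual_map K (funs K X) S f = \<omega>"
    if "\<omega> \<in> carrier (mobj (dual K (funs_dual K X)) S)" for \<omega>
    using refl S that module_homsD(1) unfolding reflexive_def module_iso_def ball_algs by metis
  obtain f where f: "f \<in> carrier (mobj (funs K X) S)" "bidual_map K (funs K X) S f = ?el P"
    using rep[OF family_fun_in_dual[OF dual_linear_functor[OF lin] P S]] by blast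
  obtain g where g: "g \<in> carrier (mobj (funs K X) S)" "bidual_map K (funs K X) S g = ?el Q"
    using rep[OF family_fun_in_dual[OF dual_linear_functor[OF lin] Q S]] by blast
  \<comment> \<open>The image of h in the bidual, paired with the evaluation at x over R, reads the
    base change of h to R at x under \<open>id_on R\<close>, which is the value of h over
    \<phi>.\<close>
  have val: "h (R, \<phi>) x = bidual_map K (funs K X) S h (R, \<phi>) (eval_map K X R x)"
    if "h \<in> carrier (mobj (funs K X) S)" "algebra K R" "\<phi> \<in> calg_homs K S R" "x \<in> obj X R" for h R \<phi> x
    using that S eval_map_in[OF X that(2,4)] set_functorD(2)[OF X that(2,4)]
    by (simp add: funs_base_change)
  have "f = g"
  proof (rule funs_eqI[OF f(1) g(1) S])
    show "f (R, \<phi>) x = g (R, \<phi>) x" if "algebra K R" "\<phi> \<in> calg_homs K S R" "x \<in> obj X R" for R \<phi> x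
      using val[OF f(1) that] val[OF g(1) that] PQ[unfolded families_agree_def] that eval_map_in[OF X that(1,3)]
      by (simp add: f(2) g(2))
  qed
  then have "?el P = ?el Q" using f(2) g(2) by simp
  then have "?el P (R, \<phi>) u = ?el Q (R, \<phi>) u" for R \<phi> u by simp
  then show "families_agree K S (sets_of (funs_dual K X)) P Q"
    unfolding families_agree_def
    by (metis family_fun_apply)
qed

text \<open>An element of the dual of N is known from its values at elements n of N over further
  algebras. For fixed n, composition with evaluation at n reduces to scalar targets, over the
  algebra where n is defined.\<close>

lemma evals_determine_dual:
  assumes X: "set_functor (algs K) X" and det: "evals_determine K X Kfun" and N: "linear_functor K N"
  shows "evals_determine K X (dual K N)"
  unfolding evals_determine_def
proof (intro allI impI)
  fix S P Q
  assume S: "algebra K S" and P: "linear_family K S (funs_dual K X) (dual K N) P"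
    and Q: "linear_family K S (funs_dual K X) (dual K N) Q"
    and PQ: "families_agree K S X (\<lambda>R \<phi> x. P R \<phi> (eval_map K X R x)) (\<lambda>R \<phi> x. Q R \<phi> (eval_map K X R x))"
  have main: "P R \<phi> u = Q R \<phi> u"
    if R: "algebra K R" "\<phi> \<in> calg_homs K S R" and u: "u \<in> carrier (mobj (funs_dual K X) R)" for R \<phi> u
  proof (rule dual_eqI[OF linear_familyD(1)[OF P R u] linear_familyD(1)[OF Q R u] R(1)])
    fix R' \<psi> n assume R': "algebra K R'" "\<psi> \<in> calg_homs K R R'" and n: "n \<in> carrier (mobj N R')"
    let ?\<sigma> = "compose (carrier S) \<psi> \<phi>"
    \<comment> \<open>The form that sends v to the value of P v at n. Its base is R', so structure
      morphisms over S arise by composing with \<open>?\<sigma>\<close>, and n is carried along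
      \<chi>.\<close>
    let ?at = "\<lambda>P R'' \<chi> v. P R'' (compose (carrier S) \<chi> ?\<sigma>) v (R'', id_on R'') (mmor N R' R'' \<chi> n)"
    have \<sigma>: "?\<sigma> \<in> calg_homs K S R'" using R R' S by blast
    have lin: "linear_family K R' (funs_dual K X) Kfun (?at P)"
      if "linear_family K S (funs_dual K X) (dual K N) P" for P
      by (rule linear_family_compose[OF linear_family_base_change[OF that \<sigma> S R'(1)] evaluation_family[OF N R'(1) n]])
    have ev: "?at P R'' \<chi> (eval_map K X R'' x) = ?at Q R'' \<chi> (eval_map K X R'' x)"
      if "algebra K R''" "\<chi> \<in> calg_homs K R' R''" "x \<in> obj X R''" for R'' \<chi> x
      using PQ[unfolded families_agree_def] that compose_calg[OF \<sigma> that(2) S] by simp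
    have "mmor (funs_dual K X) R R' \<psi> u \<in> carrier (mobj (funs_dual K X) R')"
      using linear_functor_mor(1)[OF dual_linear_functor[OF funs_linear_functor[OF X]] R(1) R' u] .
    from evals_determineD[OF det R'(1) lin[OF P] lin[OF Q] ev R'(1) id_on_calg[OF R'(1)] this]
    have "mmor (dual K N) R R' \<psi> (P R \<phi> u) (R', id_on R') n = mmor (dual K N) R R' \<psi> (Q R \<phi> u) (R', id_on R') n"
      using linear_familyD(2)[OF P R u R'] linear_familyD(2)[OF Q R u R'] linear_functor_mor(2)[OF N R'(1) n] \<sigma>
      by simp
    then show "P R \<phi> u (R', \<psi>) n = Q R \<phi> u (R', \<psi>) n" using R' by simp
  qed
  show "families_agree K S (sets_of (funs_dual K X)) P Q"
    unfolding families_agree_def by (simp add: main)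
qed

text \<open>With the first argument a point x, the second is freed; with the second an arbitrary
  element v, the first is freed. What is frozen lives over R, so each round works over the base R
  and is read off at \<open>id_on R\<close>.\<close>

lemma evals_determine_bilinear:
  assumes X: "set_functor (algs K) X" "evals_determine K X L" and Y: "set_functor (algs K) Y" "evals_determine K Y L"
    and S: "algebra K S"
    and P: "bilinear_family K S (funs_dual K X) (funs_dual K Y) L P"
    and Q: "bilinear_family K S (funs_dual K X) (funs_dual K Y) L Q"
    and PQ: "\<And>R \<phi> x y. algebra K R \<Longrightarrow> \<phi> \<in> calg_homs K S R \<Longrightarrow> x \<in> obj X R \<Longrightarrow> y \<in> obj Y R \<Longrightarrow>
      P R \<phi> (eval_map K X R x) (eval_map K Y R y) = Q R \<phi> (eval_map K X R x) (eval_map K Y R y)"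
    and R: "algebra K R" "\<phi> \<in> calg_homs K S R"
    and u: "u \<in> carrier (mobj (funs_dual K X) R)" and v: "v \<in> carrier (mobj (funs_dual K Y) R)"
  shows "P R \<phi> u v = Q R \<phi> u v"
proof -
  note linX = dual_linear_functor[OF funs_linear_functor[OF X(1)]]
  note linY = dual_linear_functor[OF funs_linear_functor[OF Y(1)]]
  have step: "P R \<phi> (eval_map K X R x) v = Q R \<phi> (eval_map K X R x) v"
    if R: "algebra K R" "\<phi> \<in> calg_homs K S R" and x: "x \<in> obj X R" and v: "v \<in> carrier (mobj (funs_dual K Y) R)"
    for R \<phi> x v
  proof -
    note ev = eval_map_in[OF X(1) R(1) x]
    let ?at = "\<lambda>P R' \<psi>. P R' (compose (carrier S) \<psi> \<phi>) (mmor (funs_dual K X) R R' \<psi> (eval_map K X R x))"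
    have "?at P R (id_on R) v = ?at Q R (id_on R) v"
    proof (rule evals_determineD[where P = "?at P" and Q = "?at Q", OF Y(2) R(1) _ _ _ R(1) id_on_calg[OF R(1)] v])
      show "linear_family K R (funs_dual K Y) L (?at P)"
        by (rule bilinear_family_right[OF bilinear_family_base_change[OF P R(2) S R(1)] R(1) linX ev])
      show "linear_family K R (funs_dual K Y) L (?at Q)"
        by (rule bilinear_family_right[OF bilinear_family_base_change[OF Q R(2) S R(1)] R(1) linX ev])
      show "?at P R' \<psi> (eval_map K Y R' y) = ?at Q R' \<psi> (eval_map K Y R' y)"
        if "algebra K R'" "\<psi> \<in> calg_homs K R R'" "y \<in> obj Y R'" for R' \<psi> y
        using PQ[OF that(1) compose_calg[OF R(2) that(2) S] set_functorD(1)[OF X(1) R(1) that(1,2) x] that(3)]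
          eval_map_base_change[OF X(1) R(1) that(1,2) x] by simp
    qed
    then show ?thesis using R x linear_functor_mor(2)[OF linX R(1) ev] by simp
  qed
  let ?at = "\<lambda>P R' \<psi> u. P R' (compose (carrier S) \<psi> \<phi>) u (mmor (funs_dual K Y) R R' \<psi> v)"
  have "?at P R (id_on R) u = ?at Q R (id_on R) u"
  proof (rule evals_determineD[where P = "?at P" and Q = "?at Q", OF X(2) R(1) _ _ _ R(1) id_on_calg[OF R(1)] u])
    show "linear_family K R (funs_dual K X) L (?at P)"
      by (rule bilinear_family_left[OF bilinear_family_base_change[OF P R(2) S R(1)] R(1) linY v])
    show "linear_family K R (funs_dual K X) L (?at Q)"
      by (rule bilinear_family_left[OF bilinear_family_base_change[OF Q R(2) S R(1)] R(1) linY v])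
    show "?at P R' \<psi> (eval_map K X R' x) = ?at Q R' \<psi> (eval_map K X R' x)"
      if "algebra K R'" "\<psi> \<in> calg_homs K R R'" "x \<in> obj X R'" for R' \<psi> x
      using step[OF that(1) compose_calg[OF R(2) that(2) S] that(3) linear_functor_mor(1)[OF linY R(1) that(1,2) v]] .
  qed
  then show ?thesis using R linear_functor_mor(2)[OF linY R(1) v] by simp
qed


section \<open>Functions on the square as bilinear forms\<close>

lemma sprod_set_functor:
  assumes "set_functor (algs K) X" "set_functor (algs K) Y"
  shows "set_functor (algs K) (sprod X Y)"
  unfolding set_functor_def ball_algs
  using set_functorD[OF assms(1)] set_functorD[OF assms(2)] by auto

abbreviation funs_dual_tensor where
  "funs_dual_tensor K X \<equiv> tensor_fun (funs_dual K X) (funs_dual K X)"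

abbreviation funs_dual_pure where
  "funs_dual_pure K X R \<equiv> pure_tensor R (mobj (funs_dual K X) R) (mobj (funs_dual K X) R)"

lemma funs_dual_module_functor:
  "set_functor (algs K) X \<Longrightarrow> module_functor (algs K) (funs_dual K X)"
  by (rule dual_module_functor[OF funs_linear_functor])

lemma funs_dual_tensor_linear:
  "set_functor (algs K) X \<Longrightarrow> linear_functor K (funs_dual_tensor K X)"
  by (rule tensor_linear_functor[OF funs_dual_module_functor funs_dual_module_functor])

lemma funs_dual_pure_bilinear:
  "set_functor (algs K) X \<Longrightarrow>
    bilinear_family K S (funs_dual K X) (funs_dual K X) (funs_dual_tensor K X) (\<lambda>R \<phi>. funs_dual_pure K X R)"
  by (rule pure_tensor_bilinear[OF funs_dual_module_functor funs_dual_module_functor])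

lemma tensor_dual_to_funs_apply [simp]:
  assumes "algebra K S" "\<omega> \<in> carrier (mobj (dual K (funs_dual_tensor K X)) S)"
    "algebra K R" "\<phi> \<in> calg_homs K S R" "x \<in> obj X R" "y \<in> obj X R"
  shows "tensor_dual_to_funs K X S \<omega> (R, \<phi>) (x, y) =
    \<omega> (R, \<phi>) (funs_dual_pure K X R (eval_map K X R x) (eval_map K X R y))"
  using assms by (simp add: tensor_dual_to_funs_def)

text \<open>
  For \<open>\<phi> : S \<rightarrow> R\<close>, the section at \<open>x\<close> is \<open>y \<mapsto> F(x, y)\<close> over \<open>R\<close>, and the slice along \<open>v\<close> is
  \<open>x \<mapsto> v(y \<mapsto> F(x, y))\<close>.
\<close>

definition fun_section where
  "fun_section K X S F R \<phi> x =
    family_fun K R X (\<lambda>R' \<psi> y. F (R', compose (carrier S) \<psi> \<phi>) (mor X R R' \<psi> x, y))"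

definition fun_slice where
  "fun_slice K X S F R \<phi> v =
    family_fun K R X (\<lambda>R' \<psi> x. v (R', \<psi>) (fun_section K X S F R' (compose (carrier S) \<psi> \<phi>) x))"

context
  fixes K :: "'u ring" and X :: "('u alg, 'u, 'x) sfun" and S :: "'u alg"
    and F :: "'u alg \<times> ('u \<Rightarrow> 'u) \<Rightarrow> 'x \<times> 'x \<Rightarrow> 'u"
  assumes X: "set_functor (algs K) X" and S: "algebra K S"
    and F: "F \<in> carrier (mobj (funs K (sprod X X)) S)"
begin

lemma fun_section_in:
  assumes R: "algebra K R" "\<phi> \<in> calg_homs K S R" and x: "x \<in> obj X R"
  shows "fun_section K X S F R \<phi> x \<in> carrier (mobj (funs K X) R)"
  unfolding fun_section_def
proof (rule family_fun_in_funs[OF X _ R(1)])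
  note X1 = set_functorD(1)[OF X R(1) _ _ x]
  show "nat_family K R X (sets_of Kfun) (\<lambda>R' \<psi> y. F (R', compose (carrier S) \<psi> \<phi>) (mor X R R' \<psi> x, y))"
    unfolding nat_family_def
  proof (intro conjI allI impI)
    fix R' \<psi> y assume R': "algebra K R'" "\<psi> \<in> calg_homs K R R'" and y: "y \<in> obj X R'"
    note c = compose_calg[OF R(2) R'(2) S]
    show "F (R', compose (carrier S) \<psi> \<phi>) (mor X R R' \<psi> x, y) \<in> obj (sets_of Kfun) R'"
      using funsD(1)[OF F S R'(1) c, of "(mor X R R' \<psi> x, y)"] y X1[OF R'] by simp
    show "F (R'', compose (carrier S) (compose (carrier R) \<chi> \<psi>) \<phi>)
        (mor X R R'' (compose (carrier R) \<chi> \<psi>) x, mor X R' R'' \<chi> y) =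
      mor (sets_of Kfun) R' R'' \<chi> (F (R', compose (carrier S) \<psi> \<phi>) (mor X R R' \<psi> x, y))"
      if R'': "algebra K R''" "\<chi> \<in> calg_homs K R' R''" for R'' \<chi>
      using funsD(2)[OF F S R'(1) c R'', of "(mor X R R' \<psi> x, y)"] y X1[OF R']
        set_functorD(3)[OF X R(1) R'(1) R''(1) R'(2) R''(2) x]
      by (simp add: compose_calg_assoc[OF R(2)])
  qed
qed

text \<open>Transport along \<psi> moves the point x and lengthens the structure morphism. This
  makes the values of v on sections natural in x, so that a slice is again a function.\<close>

lemma fun_section_base_change:
  assumes R: "algebra K R" "\<phi> \<in> calg_homs K S R" and x: "x \<in> obj X R"
    and R': "algebra K R'" "\<psi> \<in> calg_homs K R R'"
  shows "base_change K R R' \<psi> (fun_section K X S F R \<phi> x) =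
    fun_section K X S F R' (compose (carrier S) \<psi> \<phi>) (mor X R R' \<psi> x)"
proof (rule funs_eqI)
  note c = compose_calg[OF R(2) R'(2) S] and xR' = set_functorD(1)[OF X R(1) R' x]
  show "base_change K R R' \<psi> (fun_section K X S F R \<phi> x) \<in> carrier (mobj (funs K X) R')"
    by (rule funs_base_change[OF fun_section_in[OF R x] R' R(1)])
  show "fun_section K X S F R' (compose (carrier S) \<psi> \<phi>) (mor X R R' \<psi> x) \<in> carrier (mobj (funs K X) R')"
    by (rule fun_section_in[OF R'(1) c xR'])
  show "base_change K R R' \<psi> (fun_section K X S F R \<phi> x) (R'', \<chi>) y =
      fun_section K X S F R' (compose (carrier S) \<psi> \<phi>) (mor X R R' \<psi> x) (R'', \<chi>) y"
    if R'': "algebra K R''" "\<chi> \<in> calg_homs K R' R''" "y \<in> obj X R''" for R'' \<chi> y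
    using R R' R'' compose_calg[OF R'(2) R''(2) R(1)]
      set_functorD(3)[OF X R(1) R'(1) R''(1) R'(2) R''(2) x]
    by (simp add: fun_section_def compose_calg_assoc[OF R(2)])
qed (rule R'(1))

lemma fun_slice_in:
  assumes R: "algebra K R" "\<phi> \<in> calg_homs K S R" and v: "v \<in> carrier (mobj (funs_dual K X) R)"
  shows "fun_slice K X S F R \<phi> v \<in> carrier (mobj (funs K X) R)"
  unfolding fun_slice_def
proof (rule family_fun_in_funs[OF X _ R(1)])
  show "nat_family K R X (sets_of Kfun)
      (\<lambda>R' \<psi> x. v (R', \<psi>) (fun_section K X S F R' (compose (carrier S) \<psi> \<phi>) x))"
    unfolding nat_family_def
  proof (intro conjI allI impI)
    fix R' \<psi> x assume R': "algebra K R'" "\<psi> \<in> calg_homs K R R'" and x: "x \<in> obj X R'"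
    note c = compose_calg[OF R(2) R'(2) S]
    note D = dualD[OF v R(1) R' fun_section_in[OF R'(1) c x]]
    show "v (R', \<psi>) (fun_section K X S F R' (compose (carrier S) \<psi> \<phi>) x) \<in> obj (sets_of Kfun) R'"
      using D(1) by simp
    show "v (R'', compose (carrier R) \<chi> \<psi>)
        (fun_section K X S F R'' (compose (carrier S) (compose (carrier R) \<chi> \<psi>) \<phi>) (mor X R' R'' \<chi> x)) =
      mor (sets_of Kfun) R' R'' \<chi> (v (R', \<psi>) (fun_section K X S F R' (compose (carrier S) \<psi> \<phi>) x))"
      if R'': "algebra K R''" "\<chi> \<in> calg_homs K R' R''" for R'' \<chi>
      using D(2)[OF R''] fun_section_base_change[OF R'(1) c x R'']
      by (simp add: compose_calg_assoc[OF R(2)])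
  qed
qed

lemma fun_slice_base_change:
  assumes R: "algebra K R" "\<phi> \<in> calg_homs K S R" and v: "v \<in> carrier (mobj (funs_dual K X) R)"
    and R': "algebra K R'" "\<psi> \<in> calg_homs K R R'"
  shows "base_change K R R' \<psi> (fun_slice K X S F R \<phi> v) =
    fun_slice K X S F R' (compose (carrier S) \<psi> \<phi>) (base_change K R R' \<psi> v)"
proof (rule funs_eqI)
  note c = compose_calg[OF R(2) R'(2) S]
  note v' = dual_base_change[OF funs_linear_functor[OF X] v R(1) R']
  show "base_change K R R' \<psi> (fun_slice K X S F R \<phi> v) \<in> carrier (mobj (funs K X) R')"
    by (rule funs_base_change[OF fun_slice_in[OF R v] R' R(1)])
  show "fun_slice K X S F R' (compose (carrier S) \<psi> \<phi>) (base_change K R R' \<psi> v) \<in> carrier (mobj (funs K X) R')"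
    by (rule fun_slice_in[OF R'(1) c v'])
  show "base_change K R R' \<psi> (fun_slice K X S F R \<phi> v) (R'', \<chi>) y =
      fun_slice K X S F R' (compose (carrier S) \<psi> \<phi>) (base_change K R R' \<psi> v) (R'', \<chi>) y"
    if R'': "algebra K R''" "\<chi> \<in> calg_homs K R' R''" "y \<in> obj X R''" for R'' \<chi> y
    using R R' R'' compose_calg[OF R'(2) R''(2) R(1)]
    by (simp add: fun_slice_def compose_calg_assoc[OF R(2)])
qed (rule R'(1))

lemma fun_slice_linear:
  assumes R: "algebra K R" "\<phi> \<in> calg_homs K S R" and v: "v \<in> carrier (mobj (funs_dual K X) R)"
  shows "w \<in> carrier (mobj (funs_dual K X) R) \<Longrightarrow>
      fun_slice K X S F R \<phi> (v \<oplus>\<^bsub>mobj (funs_dual K X) R\<^esub> w) =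
      fun_slice K X S F R \<phi> v \<oplus>\<^bsub>mobj (funs K X) R\<^esub> fun_slice K X S F R \<phi> w"
    and "r \<in> carrier R \<Longrightarrow>
      fun_slice K X S F R \<phi> (r \<odot>\<^bsub>mobj (funs_dual K X) R\<^esub> v) =
      r \<odot>\<^bsub>mobj (funs K X) R\<^esub> fun_slice K X S F R \<phi> v"
proof -
  note closed = dual_closed[OF funs_linear_functor[OF X] R(1)]
  have sec: "fun_section K X S F R' (compose (carrier S) \<psi> \<phi>) x \<in> carrier (mobj (funs K X) R')"
    if "algebra K R'" "\<psi> \<in> calg_homs K R R'" "x \<in> obj X R'" for R' \<psi> x
    using fun_section_in[OF that(1) compose_calg[OF R(2) that(2) S] that(3)] .
  show "fun_slice K X S F R \<phi> (v \<oplus>\<^bsub>mobj (funs_dual K X) R\<^esub> w) =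
      fun_slice K X S F R \<phi> v \<oplus>\<^bsub>mobj (funs K X) R\<^esub> fun_slice K X S F R \<phi> w"
    if w: "w \<in> carrier (mobj (funs_dual K X) R)"
  proof (rule funs_eqI[OF fun_slice_in[OF R closed(1)[OF v w]]
        funs_closed(1)[OF X R(1) fun_slice_in[OF R v] fun_slice_in[OF R w]] R(1)])
    show "fun_slice K X S F R \<phi> (v \<oplus>\<^bsub>mobj (funs_dual K X) R\<^esub> w) (R', \<psi>) x =
      (fun_slice K X S F R \<phi> v \<oplus>\<^bsub>mobj (funs K X) R\<^esub> fun_slice K X S F R \<phi> w) (R', \<psi>) x"
      if "algebra K R'" "\<psi> \<in> calg_homs K R R'" "x \<in> obj X R'" for R' \<psi> x
      using that sec[OF that] by (simp add: fun_slice_def)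
  qed
  show "fun_slice K X S F R \<phi> (r \<odot>\<^bsub>mobj (funs_dual K X) R\<^esub> v) =
      r \<odot>\<^bsub>mobj (funs K X) R\<^esub> fun_slice K X S F R \<phi> v" if r: "r \<in> carrier R"
  proof (rule funs_eqI[OF fun_slice_in[OF R closed(2)[OF r v]]
        funs_closed(3)[OF X R(1) r fun_slice_in[OF R v]] R(1)])
    show "fun_slice K X S F R \<phi> (r \<odot>\<^bsub>mobj (funs_dual K X) R\<^esub> v) (R', \<psi>) x =
      (r \<odot>\<^bsub>mobj (funs K X) R\<^esub> fun_slice K X S F R \<phi> v) (R', \<psi>) x"
      if "algebra K R'" "\<psi> \<in> calg_homs K R R'" "x \<in> obj X R'" for R' \<psi> x
      using that sec[OF that] by (simp add: fun_slice_def)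
  qed
qed

text \<open>Linearity in u is built into the operations of the dual; linearity in v combines that of
  the slice with that of the form u. Naturality needs the slice to commute with change of
  base.\<close>

lemma fun_slice_bilinear:
  "bilinear_family K S (funs_dual K X) (funs_dual K X) Kfun
    (\<lambda>R \<phi> u v. u (R, id_on R) (fun_slice K X S F R \<phi> v))"
  unfolding bilinear_family_def
proof (intro conjI allI impI ballI)
  fix R \<phi> u v assume R: "algebra K R" "\<phi> \<in> calg_homs K S R"
    and u: "u \<in> carrier (mobj (funs_dual K X) R)" and v: "v \<in> carrier (mobj (funs_dual K X) R)"
  note sl = fun_slice_in[OF R v]
  note D = dualD[OF u R(1) R(1) id_on_calg[OF R(1)] sl]
  show "mmor (funs_dual K X) R R' \<psi> u (R', id_on R')
      (fun_slice K X S F R' (compose (carrier S) \<psi> \<phi>) (mmor (funs_dual K X) R R' \<psi> v)) =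
      mmor Kfun R R' \<psi> (u (R, id_on R) (fun_slice K X S F R \<phi> v))"
    if R': "algebra K R'" "\<psi> \<in> calg_homs K R R'" for R' \<psi>
    using D(2)[OF R'] fun_slice_base_change[OF R v R'] R' by simp
  show "u (R, id_on R) (fun_slice K X S F R \<phi> v) \<in> carrier (mobj Kfun R)" using D(1) by simp
  show "(u \<oplus>\<^bsub>mobj (funs_dual K X) R\<^esub> w) (R, id_on R) (fun_slice K X S F R \<phi> v) =
      u (R, id_on R) (fun_slice K X S F R \<phi> v) \<oplus>\<^bsub>mobj Kfun R\<^esub> w (R, id_on R) (fun_slice K X S F R \<phi> v)" for w
    using R sl by simp
  show "u (R, id_on R) (fun_slice K X S F R \<phi> (v \<oplus>\<^bsub>mobj (funs_dual K X) R\<^esub> w)) =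
      u (R, id_on R) (fun_slice K X S F R \<phi> v) \<oplus>\<^bsub>mobj Kfun R\<^esub> u (R, id_on R) (fun_slice K X S F R \<phi> w)"
    if w: "w \<in> carrier (mobj (funs_dual K X) R)" for w
    using D(3)[OF fun_slice_in[OF R w]] fun_slice_linear(1)[OF R v w] by simp
  show "(r \<odot>\<^bsub>mobj (funs_dual K X) R\<^esub> u) (R, id_on R) (fun_slice K X S F R \<phi> v) =
      r \<odot>\<^bsub>mobj Kfun R\<^esub> u (R, id_on R) (fun_slice K X S F R \<phi> v)" if "r \<in> carrier R" for r
    using R sl that by simp
  show "u (R, id_on R) (fun_slice K X S F R \<phi> (r \<odot>\<^bsub>mobj (funs_dual K X) R\<^esub> v)) =
      r \<odot>\<^bsub>mobj Kfun R\<^esub> u (R, id_on R) (fun_slice K X S F R \<phi> v)" if r: "r \<in> carrier R" for r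
    using D(4)[OF r] fun_slice_linear(2)[OF R v r] by simp
qed

lemma tensor_dual_to_funs_surj:
  "F \<in> tensor_dual_to_funs K X S ` carrier (mobj (dual K (funs_dual_tensor K X)) S)"
proof -
  note mf = funs_dual_module_functor[OF X]
  obtain \<omega> where \<omega>: "\<omega> \<in> carrier (mobj (dual K (funs_dual_tensor K X)) S)"
    and \<omega>_pure: "\<And>R \<phi> u v. algebra K R \<Longrightarrow> \<phi> \<in> calg_homs K S R \<Longrightarrow> u \<in> carrier (mobj (funs_dual K X) R) \<Longrightarrow>
      v \<in> carrier (mobj (funs_dual K X) R) \<Longrightarrow>
      \<omega> (R, \<phi>) (funs_dual_pure K X R u v) = u (R, id_on R) (fun_slice K X S F R \<phi> v)"
    using tensor_dual_lift[OF mf mf S fun_slice_bilinear] by metis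
  have "tensor_dual_to_funs K X S \<omega> = F"
  proof (rule extensional_pair_eqI[of _ K S _ "\<lambda>R. obj X R \<times> obj X R"])
    show "F \<in> extensional (Obj (algs_under K S))"
      "algebra K R \<Longrightarrow> \<phi> \<in> calg_homs K S R \<Longrightarrow> F (R, \<phi>) \<in> extensional (obj X R \<times> obj X R)" for R \<phi>
      using F by (auto simp: funs_carrier_iff[OF S])
    show "tensor_dual_to_funs K X S \<omega> \<in> extensional (Obj (algs_under K S))"
      using S \<omega> by (simp add: tensor_dual_to_funs_def)
    show "tensor_dual_to_funs K X S \<omega> (R, \<phi>) \<in> extensional (obj X R \<times> obj X R)"
      if "algebra K R" "\<phi> \<in> calg_homs K S R" for R \<phi>
      using S \<omega> that by (simp add: tensor_dual_to_funs_def)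
    fix R \<phi> p assume R: "algebra K R" "\<phi> \<in> calg_homs K S R" and "p \<in> obj X R \<times> obj X R"
    then obtain x y where p: "p = (x, y)" "x \<in> obj X R" "y \<in> obj X R" by blast
    note ex = eval_map_in[OF X R(1) p(2)] and ey = eval_map_in[OF X R(1) p(3)]
    \<comment> \<open>At two points the iterated form collapses: evaluation at x of the slice along
      ev_y is evaluation at y of the section at x, which is the value of F.\<close>
    have "tensor_dual_to_funs K X S \<omega> (R, \<phi>) (x, y) =
        eval_map K X R x (R, id_on R) (fun_slice K X S F R \<phi> (eval_map K X R y))"
      using S \<omega> R p \<omega>_pure[OF R ex ey] by simp
    also have "\<dots> = eval_map K X R y (R, id_on R) (fun_section K X S F R \<phi> x)"
      using R p fun_slice_in[OF R ey] set_functorD(2)[OF X R(1)] by (simp add: fun_slice_def)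
    also have "\<dots> = F (R, \<phi>) (x, y)"
      using R p fun_section_in[OF R p(2)] set_functorD(2)[OF X R(1)] by (simp add: fun_section_def)
    finally show "tensor_dual_to_funs K X S \<omega> (R, \<phi>) p = F (R, \<phi>) p" using p(1) by simp
  qed
  then show ?thesis using \<omega> by blast
qed

end

section \<open>The identification of forms on the tensor square with functions on the square\<close>

lemma tensor_dual_to_funs_in:
  assumes X: "set_functor (algs K) X"
  shows "tensor_dual_to_funs K X \<in> module_homs (algs K) (dual K (funs_dual_tensor K X)) (funs K (sprod X X))"
proof -
  let ?T = "funs_dual_tensor K X"
  let ?e = "\<lambda>R p. funs_dual_pure K X R (eval_map K X R (fst p)) (eval_map K X R (snd p))"
  let ?P = "\<lambda>S \<omega>. family_fun K S (sprod X X) (\<lambda>R \<phi> p. \<omega> (R, \<phi>) (?e R p))"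
  have eq: "tensor_dual_to_funs K X = family_hom K (dual K ?T) ?P"
    by (simp add: tensor_dual_to_funs_def family_hom_def family_fun_def case_prod_unfold)
  note T = funs_dual_tensor_linear[OF X] and XX = sprod_set_functor[OF X X]
  note lf = dual_linear_functor[OF T]
  have e_in: "?e R p \<in> carrier (mobj ?T R)" if "algebra K R" "p \<in> obj (sprod X X) R" for R p
    using bilinear_familyD(1)[OF funs_dual_pure_bilinear[OF X] that(1) id_on_calg[OF that(1)]
        eval_map_in[OF X that(1)] eval_map_in[OF X that(1)]] that by auto
  have e_mor: "mmor ?T R R' \<psi> (?e R p) = ?e R' (mor (sprod X X) R R' \<psi> p)"
    if "algebra K R" "p \<in> obj (sprod X X) R" "algebra K R'" "\<psi> \<in> calg_homs K R R'" for R R' \<psi> p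
    using bilinear_familyD(2)[OF funs_dual_pure_bilinear[OF X] that(1) id_on_calg[OF that(1)]
        eval_map_in[OF X that(1)] eval_map_in[OF X that(1)] that(3,4)] that
      eval_map_base_change[OF X that(1,3,4)] by (auto simp del: tensor_fun_simps)
  have closed: "?P S \<omega> \<in> carrier (mobj (funs K (sprod X X)) S)"
    if S: "algebra K S" and \<omega>: "\<omega> \<in> carrier (mobj (dual K ?T) S)" for S \<omega>
  proof (rule family_fun_in_funs[OF XX _ S])
    show "nat_family K S (sprod X X) (sets_of Kfun) (\<lambda>R \<phi> p. \<omega> (R, \<phi>) (?e R p))"
      unfolding nat_family_def
    proof (intro conjI allI impI)
      fix R \<phi> p assume R: "algebra K R" "\<phi> \<in> calg_homs K S R" and p: "p \<in> obj (sprod X X) R"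
      note D = dualD[OF \<omega> S R e_in[OF R(1) p]]
      show "\<omega> (R, \<phi>) (?e R p) \<in> obj (sets_of Kfun) R" using D(1) by simp
      show "\<omega> (R', compose (carrier S) \<psi> \<phi>) (?e R' (mor (sprod X X) R R' \<psi> p)) =
          mor (sets_of Kfun) R R' \<psi> (\<omega> (R, \<phi>) (?e R p))"
        if R': "algebra K R'" "\<psi> \<in> calg_homs K R R'" for R' \<psi>
        using D(2)[OF R'] unfolding e_mor[OF R(1) p R'] by simp
    qed
  qed
  show ?thesis
    unfolding eq
  proof (rule family_hom_in[OF lf], rule linear_familyI)
    fix S R and \<phi> assume S: "algebra K S" "algebra K R" "\<phi> \<in> calg_homs K S R"
    fix \<omega> assume \<omega>: "\<omega> \<in> carrier (mobj (dual K ?T) R)"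
    show "?P R \<omega> \<in> carrier (mobj (funs K (sprod X X)) R)" by (rule closed[OF S(2) \<omega>])
    show "?P R' (mmor (dual K ?T) R R' \<psi> \<omega>) = mmor (funs K (sprod X X)) R R' \<psi> (?P R \<omega>)"
      if R': "algebra K R'" "\<psi> \<in> calg_homs K R R'" for R' \<psi>
      using closed[OF R'(1) dual_base_change[OF T \<omega> S(2) R']] funs_base_change[OF closed[OF S(2) \<omega>] R' S(2)]
        S R' compose_calg[OF R'(2) _ S(2)]
      by (intro funs_eqI[of _ K "sprod X X" R']) (simp_all del: sprod_simps tensor_fun_simps)
    show "?P R (\<omega> \<oplus>\<^bsub>mobj (dual K ?T) R\<^esub> \<eta>) = ?P R \<omega> \<oplus>\<^bsub>mobj (funs K (sprod X X)) R\<^esub> ?P R \<eta>"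
      if \<eta>: "\<eta> \<in> carrier (mobj (dual K ?T) R)" for \<eta>
      using closed[OF S(2) dual_closed(1)[OF T S(2) \<omega> \<eta>]]
        funs_closed(1)[OF XX S(2) closed[OF S(2) \<omega>] closed[OF S(2) \<eta>]] S e_in
      by (intro funs_eqI[of _ K "sprod X X" R]) (simp_all del: sprod_simps tensor_fun_simps)
    show "?P R (r \<odot>\<^bsub>mobj (dual K ?T) R\<^esub> \<omega>) = r \<odot>\<^bsub>mobj (funs K (sprod X X)) R\<^esub> ?P R \<omega>"
      if r: "r \<in> carrier R" for r
      using closed[OF S(2) dual_closed(2)[OF T S(2) r \<omega>]]
        funs_closed(3)[OF XX S(2) r closed[OF S(2) \<omega>]] S e_in
      by (intro funs_eqI[of _ K "sprod X X" R]) (simp_all del: sprod_simps tensor_fun_simps)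
  qed
qed

text \<open>Induction reduces to pure tensors, on which a form is bilinear and hence fixed by pairs
  of points.\<close>

lemma tensor_forms_eqI:
  assumes X: "set_functor (algs K) X" and det: "evals_determine K X Kfun" and S: "algebra K S"
    and \<omega>: "\<omega> \<in> carrier (mobj (dual K (funs_dual_tensor K X)) S)"
    and \<eta>: "\<eta> \<in> carrier (mobj (dual K (funs_dual_tensor K X)) S)"
    and eq: "\<And>R \<phi> x y. algebra K R \<Longrightarrow> \<phi> \<in> calg_homs K S R \<Longrightarrow> x \<in> obj X R \<Longrightarrow> y \<in> obj X R \<Longrightarrow>
      \<omega> (R, \<phi>) (funs_dual_pure K X R (eval_map K X R x) (eval_map K X R y)) =
      \<eta> (R, \<phi>) (funs_dual_pure K X R (eval_map K X R x) (eval_map K X R y))"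
  shows "\<omega> = \<eta>"
proof (rule dual_eqI[OF \<omega> \<eta> S])
  fix R \<phi> t assume R: "algebra K R" "\<phi> \<in> calg_homs K S R" and t: "t \<in> carrier (mobj (funs_dual_tensor K X) R)"
  note mf = module_functorD[OF funs_dual_module_functor[OF X] R(1)]
  note bil = bilinear_family_compose[OF funs_dual_pure_bilinear[OF X]]
  show "\<omega> (R, \<phi>) t = \<eta> (R, \<phi>) t"
    using t unfolding tensor_fun_simps(1)
  proof (induction rule: tensor_induct[OF mf mf, consumes 1, case_names pure add])
    case (pure u v)
    show ?case
      by (rule evals_determine_bilinear[OF X det X det S bil[OF dual_linear[OF \<omega> S]] bil[OF dual_linear[OF \<eta> S]] eq R pure])
  next
    case (add s t)
    then show ?case using dualD(3)[OF \<omega> S R] dualD(3)[OF \<eta> S R] by simp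
  qed
qed

text \<open>Injectivity is determination by pairs of points, surjectivity is the construction from
  slices.\<close>

lemma tensor_dual_to_funs_bij:
  assumes X: "set_functor (algs K) X" and det: "evals_determine K X Kfun" and S: "algebra K S"
  shows "bij_betw (tensor_dual_to_funs K X S) (carrier (mobj (dual K (funs_dual_tensor K X)) S))
    (carrier (mobj (funs K (sprod X X)) S))"
  unfolding bij_betw_def
proof
  show "inj_on (tensor_dual_to_funs K X S) (carrier (mobj (dual K (funs_dual_tensor K X)) S))"
  proof (rule inj_onI)
    fix \<omega> \<eta> assume \<omega>: "\<omega> \<in> carrier (mobj (dual K (funs_dual_tensor K X)) S)"
      and \<eta>: "\<eta> \<in> carrier (mobj (dual K (funs_dual_tensor K X)) S)"
      and eq: "tensor_dual_to_funs K X S \<omega> = tensor_dual_to_funs K X S \<eta>"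
    show "\<omega> = \<eta>"
    proof (rule tensor_forms_eqI[OF X det S \<omega> \<eta>])
      fix R \<phi> x y assume R: "algebra K R" "\<phi> \<in> calg_homs K S R" "x \<in> obj X R" "y \<in> obj X R"
      show "\<omega> (R, \<phi>) (funs_dual_pure K X R (eval_map K X R x) (eval_map K X R y)) =
        \<eta> (R, \<phi>) (funs_dual_pure K X R (eval_map K X R x) (eval_map K X R y))"
        using tensor_dual_to_funs_apply[OF S \<omega> R] tensor_dual_to_funs_apply[OF S \<eta> R] eq by simp
    qed
  qed
  show "tensor_dual_to_funs K X S ` carrier (mobj (dual K (funs_dual_tensor K X)) S) =
    carrier (mobj (funs K (sprod X X)) S)"
    using module_homsD(1)[OF tensor_dual_to_funs_in[OF X] S] tensor_dual_to_funs_surj[OF X S] by blast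
qed

text \<open>An equation for the inverse is verified after applying f. The lemma makes the
  identification of forms on the tensor square with functions on the square invertible as a morphism
  of functors.\<close>

lemma module_homs_inverse:
  assumes M: "linear_functor K M" and N: "linear_functor K N" and f: "f \<in> module_homs (algs K) M N"
    and bij: "\<And>S. algebra K S \<Longrightarrow> bij_betw (f S) (carrier (mobj M S)) (carrier (mobj N S))"
  shows "family_hom K N (\<lambda>S. inv_into (carrier (mobj M S)) (f S)) \<in> module_homs (algs K) N M"
proof (rule family_hom_in[OF N], rule linear_familyI)
  let ?g = "\<lambda>S. inv_into (carrier (mobj M S)) (f S)"
  fix S R and \<phi> assume S: "algebra K S" "algebra K R" "\<phi> \<in> calg_homs K S R"
  fix y assume y: "y \<in> carrier (mobj N R)"
  have g_in: "?g R y \<in> carrier (mobj M R)" if "algebra K R" "y \<in> carrier (mobj N R)" for R y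
    using bij[OF that(1)] that(2) by (metis bij_betw_imp_surj_on inv_into_into)
  have fg: "f R (?g R y) = y" if "algebra K R" "y \<in> carrier (mobj N R)" for R y
    using bij[OF that(1)] that(2) by (metis bij_betw_inv_into_right)
  have gI: "?g R y = x" if "algebra K R" "x \<in> carrier (mobj M R)" "f R x = y" for R x y
    using bij[OF that(1)] that(2,3) by (metis bij_betw_inv_into_left)
  show "?g R y \<in> carrier (mobj M R)" by (rule g_in[OF S(2) y])
  show "?g R' (mmor N R R' \<psi> y) = mmor M R R' \<psi> (?g R y)"
    if R': "algebra K R'" "\<psi> \<in> calg_homs K R R'" for R' \<psi>
    by (rule gI[OF R'(1) linear_functor_mor(1)[OF M S(2) R' g_in[OF S(2) y]]])
       (simp add: module_homsD(2)[OF f S(2) g_in[OF S(2) y] R'] fg[OF S(2) y])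
  show "?g R (y \<oplus>\<^bsub>mobj N R\<^esub> z) = ?g R y \<oplus>\<^bsub>mobj M R\<^esub> ?g R z" if z: "z \<in> carrier (mobj N R)" for z
    by (rule gI[OF S(2) linear_functorD(2)[OF M S(2) g_in[OF S(2) y] g_in[OF S(2) z]]])
       (simp add: module_homsD(3)[OF f S(2) g_in[OF S(2) y] g_in[OF S(2) z]] fg[OF S(2)] y z)
  show "?g R (r \<odot>\<^bsub>mobj N R\<^esub> y) = r \<odot>\<^bsub>mobj M R\<^esub> ?g R y" if r: "r \<in> carrier R" for r
    by (rule gI[OF S(2) linear_functorD(3)[OF M S(2) r g_in[OF S(2) y]]])
       (simp add: module_homsD(4)[OF f S(2) g_in[OF S(2) y] r] fg[OF S(2)] y)
qed


section \<open>Comultiplication and counit\<close>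

lemma set_homsD:
  assumes "h \<in> set_homs (algs K) X Y" "algebra K S" "x \<in> obj X S"
  shows "h S x \<in> obj Y S"
    and "algebra K R \<Longrightarrow> \<phi> \<in> calg_homs K S R \<Longrightarrow> h R (mor X S R \<phi> x) = mor Y S R \<phi> (h S x)"
  using assms unfolding set_homs_def by (auto simp: PiE_iff)

lemma set_homs_eqI:
  fixes f g :: "'u alg \<Rightarrow> 'm \<Rightarrow> 'n"
  assumes "f \<in> set_homs (algs K) X Y" "g \<in> set_homs (algs K) X Y"
    and "\<And>S x. algebra K S \<Longrightarrow> x \<in> obj X S \<Longrightarrow> f S x = g S x"
  shows "f = g"
proof (rule extensionalityI)
  show "f \<in> extensional (Obj (algs K))" "g \<in> extensional (Obj (algs K))"
    using assms(1,2) by (auto simp: set_homs_def)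
  fix S :: "'u alg" assume S: "S \<in> Obj (algs K)"
  show "f S = g S"
    by (rule extensionalityI[of _ "obj X S"]) (use S assms in \<open>auto simp: set_homs_def PiE_iff\<close>)
qed

lemma set_homsI:
  assumes X: "set_functor (algs K) X"
    and "\<And>S x. algebra K S \<Longrightarrow> x \<in> obj X S \<Longrightarrow> P S x \<in> obj Y S"
    and "\<And>S x R \<phi>. algebra K S \<Longrightarrow> x \<in> obj X S \<Longrightarrow> algebra K R \<Longrightarrow> \<phi> \<in> calg_homs K S R \<Longrightarrow>
      P R (mor X S R \<phi> x) = mor Y S R \<phi> (P S x)"
  shows "(\<lambda>S\<in>Obj (algs K). \<lambda>x\<in>obj X S. P S x) \<in> set_homs (algs K) X Y"
  using assms set_functorD(1)[OF X] unfolding set_homs_def by auto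

lemma spoint_simps [simp]: "obj spoint i = {()}" "mor spoint i j \<phi> p = p"
  by (simp_all add: spoint_def)

lemma pullback_apply [simp]:
  assumes "algebra K S" "f \<in> carrier (mobj (funs K Y) S)" "algebra K R" "\<phi> \<in> calg_homs K S R" "x \<in> obj X R"
  shows "pullback K X Y h S f (R, \<phi>) x = f (R, \<phi>) (h R x)"
  using assms by (simp add: pullback_def)

lemma Kfun_linear_functor: "linear_functor K Kfun"
  unfolding linear_functor_def set_functor_def ball_algs
  by (simp add: calg_closed calg_add calg_mult algebra_closed Pi_iff)

lemma algebra_homs_iff:
  "f \<in> algebra_homs (algs K) A B \<longleftrightarrow> f \<in> module_homs (algs K) A B \<and>
    (\<forall>S. algebra K S \<longrightarrow> (\<forall>x\<in>carrier (mobj A S). \<forall>y\<in>carrier (mobj A S).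
      f S (x \<otimes>\<^bsub>mobj A S\<^esub> y) = f S x \<otimes>\<^bsub>mobj B S\<^esub> f S y) \<and> f S \<one>\<^bsub>mobj A S\<^esub> = \<one>\<^bsub>mobj B S\<^esub>)"
  unfolding algebra_homs_def ball_algs by simp

text \<open>Composition with h respects pointwise operations and commutes with change of base;
  naturality of h makes the composite a function on X.\<close>

lemma pullback_in:
  assumes X: "set_functor (algs K) X" and Y: "set_functor (algs K) Y" and h: "h \<in> set_homs (algs K) X Y"
  shows "pullback K X Y h \<in> algebra_homs (algs K) (funs K Y) (funs K X)"
proof -
  let ?P = "\<lambda>S f. family_fun K S X (\<lambda>R \<phi> x. f (R, \<phi>) (h R x))"
  have eq: "pullback K X Y h = family_hom K (funs K Y) ?P"
    by (simp add: pullback_def family_hom_def family_fun_def)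
  have closed: "?P S f \<in> carrier (mobj (funs K X) S)"
    if S: "algebra K S" and f: "f \<in> carrier (mobj (funs K Y) S)" for S f
  proof (rule family_fun_in_funs[OF X _ S])
    show "nat_family K S X (sets_of Kfun) (\<lambda>R \<phi> x. f (R, \<phi>) (h R x))"
      unfolding nat_family_def
      by (simp add: funsD[OF f S] set_homsD[OF h] )
  qed
  have mod: "family_hom K (funs K Y) ?P \<in> module_homs (algs K) (funs K Y) (funs K X)"
  proof (rule family_hom_in[OF funs_linear_functor[OF Y]], rule linear_familyI)
    fix S R and \<phi> assume S: "algebra K S" "algebra K R" "\<phi> \<in> calg_homs K S R"
    fix f assume f: "f \<in> carrier (mobj (funs K Y) R)"
    show "?P R f \<in> carrier (mobj (funs K X) R)" by (rule closed[OF S(2) f])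
    show "?P R' (mmor (funs K Y) R R' \<psi> f) = mmor (funs K X) R R' \<psi> (?P R f)"
      if R': "algebra K R'" "\<psi> \<in> calg_homs K R R'" for R' \<psi>
      using closed[OF R'(1) funs_base_change[OF f R' S(2)]] funs_base_change[OF closed[OF S(2) f] R' S(2)]
        R' compose_calg[OF R'(2) _ S(2)]
      by (intro funs_eqI[of _ K X R']) simp_all
    show "?P R (f \<oplus>\<^bsub>mobj (funs K Y) R\<^esub> g) = ?P R f \<oplus>\<^bsub>mobj (funs K X) R\<^esub> ?P R g"
      if g: "g \<in> carrier (mobj (funs K Y) R)" for g
      using closed[OF S(2) funs_closed(1)[OF Y S(2) f g]] funs_closed(1)[OF X S(2) closed[OF S(2) f] closed[OF S(2) g]] S
      by (intro funs_eqI[of _ K X R]) (simp_all add: set_homsD(1)[OF h])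
    show "?P R (r \<odot>\<^bsub>mobj (funs K Y) R\<^esub> f) = r \<odot>\<^bsub>mobj (funs K X) R\<^esub> ?P R f"
      if r: "r \<in> carrier R" for r
      using closed[OF S(2) funs_closed(3)[OF Y S(2) r f]] funs_closed(3)[OF X S(2) r closed[OF S(2) f]] S
      by (intro funs_eqI[of _ K X R]) (simp_all add: set_homsD(1)[OF h])
  qed
  have mult: "?P S (f \<otimes>\<^bsub>mobj (funs K Y) S\<^esub> g) = ?P S f \<otimes>\<^bsub>mobj (funs K X) S\<^esub> ?P S g"
    if S: "algebra K S" and f: "f \<in> carrier (mobj (funs K Y) S)" and g: "g \<in> carrier (mobj (funs K Y) S)" for S f g
    using closed[OF S funs_closed(2)[OF Y S f g]] funs_closed(2)[OF X S closed[OF S f] closed[OF S g]] S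
    by (intro funs_eqI[of _ K X S]) (simp_all add: set_homsD(1)[OF h])
  have one: "?P S \<one>\<^bsub>mobj (funs K Y) S\<^esub> = \<one>\<^bsub>mobj (funs K X) S\<^esub>" if S: "algebra K S" for S
    using closed[OF S funs_closed(4)[OF Y S]] funs_closed(4)[OF X S] S
    by (intro funs_eqI[of _ K X S]) (simp_all add: set_homsD(1)[OF h])
  show ?thesis
    unfolding eq algebra_homs_iff using mod mult one funs_closed(2,4)[OF Y] by simp
qed

lemma eval_map_in_Spec:
  assumes X: "set_functor (algs K) X" and S: "algebra K S" and x: "x \<in> obj X S"
  shows "eval_map K X S x \<in> obj (Spec K (funs K X)) S"
  unfolding Spec_iff[OF S]
  using eval_map_in[OF X S x] S x funs_closed[OF X] set_functorD(1)[OF X S _ _ x] by simp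

text \<open>The comultiplication is m with its arguments exchanged. Hence m can be recovered from
  it, which is how a multiplication with prescribed comultiplication is found.\<close>

lemma comult_eq_flip: "comult K X m = flip K (funs K X) (funs_dual_tensor K X) m"
  by (simp add: comult_def flip_def family_hom_def)

section \<open>Values of the multiplication and the unit at points\<close>

context
  fixes K :: "'u ring" and X :: "('u alg, 'u, 'x) sfun"
  assumes X: "set_functor (algs K) X"
begin

lemma eval_pure_in:
  "algebra K S \<Longrightarrow> x \<in> obj X S \<Longrightarrow> y \<in> obj X S \<Longrightarrow>
    funs_dual_pure K X S (eval_map K X S x) (eval_map K X S y) \<in> carrier (mobj (funs_dual_tensor K X) S)"
  using bilinear_familyD(1)[OF funs_dual_pure_bilinear[OF X]] id_on_calg eval_map_in[OF X] by blast

lemma eval_pure_mor: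
  assumes "algebra K S" "algebra K R" "\<phi> \<in> calg_homs K S R" "x \<in> obj X S" "y \<in> obj X S"
  shows "mmor (funs_dual_tensor K X) S R \<phi> (funs_dual_pure K X S (eval_map K X S x) (eval_map K X S y)) =
    funs_dual_pure K X R (eval_map K X R (mor X S R \<phi> x)) (eval_map K X R (mor X S R \<phi> y))"
  using bilinear_familyD(2)[OF funs_dual_pure_bilinear[OF X] assms(1) id_on_calg[OF assms(1)]
      eval_map_in[OF X assms(1,4)] eval_map_in[OF X assms(1,5)] assms(2,3)]
    eval_map_base_change[OF X assms(1-3)] assms by (simp del: tensor_fun_simps)

context
  fixes m
  assumes m: "m \<in> module_homs (algs K) (funs_dual_tensor K X) (funs_dual K X)"
begin

lemma comult_in: "comult K X m \<in> module_homs (algs K) (funs K X) (dual K (funs_dual_tensor K X))"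
  unfolding comult_eq_flip by (rule flip_in[OF funs_linear_functor[OF X] funs_dual_tensor_linear[OF X] m])

lemma comult_apply:
  assumes "algebra K S" "f \<in> carrier (mobj (funs K X) S)" "algebra K R" "\<phi> \<in> calg_homs K S R"
    "t \<in> carrier (mobj (funs_dual_tensor K X) R)"
  shows "comult K X m S f (R, \<phi>) t = m R t (R, id_on R) (base_change K S R \<phi> f)"
  unfolding comult_eq_flip using flip_apply[OF funs_linear_functor[OF X] m assms] by simp

text \<open>Both m and pure tensors of evaluations are natural; thus a product of evaluations only
  has to be known over \<open>id_on R\<close>.\<close>

lemma mult_eval_base_change:
  assumes "algebra K S" "x \<in> obj X S" "y \<in> obj X S" "algebra K R" "\<phi> \<in> calg_homs K S R"
  shows "m S (funs_dual_pure K X S (eval_map K X S x) (eval_map K X S y)) (R, \<phi>) =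
    m R (funs_dual_pure K X R (eval_map K X R (mor X S R \<phi> x)) (eval_map K X R (mor X S R \<phi> y))) (R, id_on R)"
  using module_homsD(2)[OF m assms(1) eval_pure_in[OF assms(1-3)] assms(4,5)] assms
  unfolding eval_pure_mor[OF assms(1,4,5,2,3)] by simp

text \<open>This is the exchange of arguments read at two evaluations. Comparing m with a product of
  points, and multiplicativity of the comultiplication with membership in the spectrum, both go
  through this formula.\<close>

lemma comult_eval:
  assumes "algebra K S" "f \<in> carrier (mobj (funs K X) S)" "algebra K R" "\<phi> \<in> calg_homs K S R" "x \<in> obj X R" "y \<in> obj X R"
  shows "tensor_dual_to_funs K X S (comult K X m S f) (R, \<phi>) (x, y) =
    m R (funs_dual_pure K X R (eval_map K X R x) (eval_map K X R y)) (R, id_on R) (base_change K S R \<phi> f)"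
  using tensor_dual_to_funs_apply[OF assms(1) module_homsD(1)[OF comult_in assms(1,2)] assms(3-6)]
    comult_apply[OF assms(1-4) eval_pure_in[OF assms(3,5,6)]] by simp

text \<open>Both sides express that the product of ev_x and ev_y takes f to f(\<mu>(x, y)). On the
  left f is given over S and the points over an S-algebra, on the right the other way round, and
  naturality brings both to one algebra.\<close>

lemma comult_pullback_iff:
  assumes \<mu>: "\<mu> \<in> set_homs (algs K) (sprod X X) X"
  shows "(\<forall>S f. algebra K S \<longrightarrow> f \<in> carrier (mobj (funs K X) S) \<longrightarrow>
      tensor_dual_to_funs K X S (comult K X m S f) = pullback K (sprod X X) X \<mu> S f) \<longleftrightarrow>
    (\<forall>S x y. algebra K S \<longrightarrow> x \<in> obj X S \<longrightarrow> y \<in> obj X S \<longrightarrow>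
      m S (funs_dual_pure K X S (eval_map K X S x) (eval_map K X S y)) = eval_map K X S (\<mu> S (x, y)))"
    (is "?L \<longleftrightarrow> ?R")
proof (intro iffI allI impI)
  fix S x y assume L: ?L and S: "algebra K S" and xy: "x \<in> obj X S" "y \<in> obj X S"
  have \<mu>xy: "\<mu> S (x, y) \<in> obj X S" using set_homsD(1)[OF \<mu> S] xy by simp
  show "m S (funs_dual_pure K X S (eval_map K X S x) (eval_map K X S y)) = eval_map K X S (\<mu> S (x, y))"
  proof (rule dual_eqI[OF module_homsD(1)[OF m S eval_pure_in[OF S xy]] eval_map_in[OF X S \<mu>xy] S])
    fix R \<phi> f assume R: "algebra K R" "\<phi> \<in> calg_homs K S R" and f: "f \<in> carrier (mobj (funs K X) R)"
    let ?x = "mor X S R \<phi> x" and ?y = "mor X S R \<phi> y"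
    have xy': "?x \<in> obj X R" "?y \<in> obj X R" using set_functorD(1)[OF X S R] xy by auto
    have fe: "base_change K R R (id_on R) f = f"
      using f R by (simp add: base_change_id funs_carrier_iff)
    have "m S (funs_dual_pure K X S (eval_map K X S x) (eval_map K X S y)) (R, \<phi>) f =
        tensor_dual_to_funs K X R (comult K X m R f) (R, id_on R) (?x, ?y)"
      using mult_eval_base_change[OF S xy R] comult_eval[OF R(1) f R(1) id_on_calg[OF R(1)] xy'] fe by simp
    also have "\<dots> = f (R, id_on R) (\<mu> R (?x, ?y))"
      using L R f xy' by simp
    also have "\<dots> = eval_map K X S (\<mu> S (x, y)) (R, \<phi>) f"
      using set_homsD(2)[OF \<mu> S, of "(x, y)" R \<phi>] xy R S f \<mu>xy by simp
    finally show "m S (funs_dual_pure K X S (eval_map K X S x) (eval_map K X S y)) (R, \<phi>) f =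
      eval_map K X S (\<mu> S (x, y)) (R, \<phi>) f" .
  qed
next
  fix S :: "'u alg" and f assume R: ?R and S: "algebra K S" and f: "f \<in> carrier (mobj (funs K X) S)"
  note XX = sprod_set_functor[OF X X]
  have "pullback K (sprod X X) X \<mu> \<in> module_homs (algs K) (funs K X) (funs K (sprod X X))"
    using pullback_in[OF XX X \<mu>] by (simp add: algebra_homs_iff)
  note pb = module_homsD(1)[OF this S f]
  show "tensor_dual_to_funs K X S (comult K X m S f) = pullback K (sprod X X) X \<mu> S f"
  proof (rule funs_eqI[OF module_homsD(1)[OF tensor_dual_to_funs_in[OF X] S module_homsD(1)[OF comult_in S f]] pb S])
    fix R \<phi> p assume R': "algebra K R" "\<phi> \<in> calg_homs K S R" and p: "p \<in> obj (sprod X X) R"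
    then obtain x y where xy: "p = (x, y)" "x \<in> obj X R" "y \<in> obj X R" by auto
    have "\<mu> R (x, y) \<in> obj X R" using set_homsD(1)[OF \<mu> R'(1)] xy by simp
    then show "tensor_dual_to_funs K X S (comult K X m S f) (R, \<phi>) p = pullback K (sprod X X) X \<mu> S f (R, \<phi>) p"
      using comult_eval[OF S f R' xy(2,3)] R R' S f xy funs_base_change[OF f R' S] set_functorD(2)[OF X R'(1)]
      by simp
  qed
qed

end

text \<open>Reading a form on \<open>Kfun\<close> through its value at 1 leaves the element u(1),
  applied to f.\<close>

lemma counit_apply:
  assumes u: "u \<in> module_homs (algs K) Kfun (funs_dual K X)"
    and S: "algebra K S" and f: "f \<in> carrier (mobj (funs K X) S)"
  shows "counit K X u S f = u S \<one>\<^bsub>S\<^esub> (S, id_on S) f"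
proof -
  note lf = funs_linear_functor[OF X]
  have u1: "u S \<one>\<^bsub>S\<^esub> \<in> carrier (mobj (funs_dual K X) S)"
    using module_homsD(1)[OF u S, of "\<one>\<^bsub>S\<^esub>"] algebra_closed(1)[OF S] by simp
  have "bidual_map K (funs K X) S f \<in> carrier (mobj (dual K (funs_dual K X)) S)"
    by (rule module_homsD(1)[OF bidual_map_in[OF lf] S f])
  then show ?thesis
    using S f u1 algebra_closed(1)[OF S] linear_functor_mor(2)[OF lf S f] by (simp add: counit_def)
qed

lemma unit_base_change:
  assumes u: "u \<in> module_homs (algs K) Kfun (funs_dual K X)"
    and S: "algebra K S" "algebra K R" "\<phi> \<in> calg_homs K S R"
  shows "u S \<one>\<^bsub>S\<^esub> (R, \<phi>) = u R \<one>\<^bsub>R\<^esub> (R, id_on R)"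
  using module_homsD(2)[OF u S(1) _ S(2,3), of "\<one>\<^bsub>S\<^esub>"] S algebra_closed(1)[OF S(1)] calg_one[OF S(3)] by simp

lemma unit_in: "u \<in> module_homs (algs K) Kfun (funs_dual K X) \<Longrightarrow> algebra K S \<Longrightarrow>
    u S \<one>\<^bsub>S\<^esub> \<in> carrier (mobj (funs_dual K X) S)"
  using module_homsD(1)[of u K Kfun "funs_dual K X" S "\<one>\<^bsub>S\<^esub>"] algebra_closed(1)[of K S] by simp

lemma counit_point_iff:
  assumes u: "u \<in> module_homs (algs K) Kfun (funs_dual K X)" and e: "e \<in> set_homs (algs K) spoint X"
  shows "(\<forall>S f. algebra K S \<longrightarrow> f \<in> carrier (mobj (funs K X) S) \<longrightarrow> counit K X u S f = f (S, id_on S) (e S ())) \<longleftrightarrow>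
    (\<forall>S. algebra K S \<longrightarrow> u S \<one>\<^bsub>S\<^esub> = eval_map K X S (e S ()))"
    (is "?L \<longleftrightarrow> ?R")
proof (intro iffI allI impI)
  fix S :: "'u alg" assume L: ?L and S: "algebra K S"
  have eS: "e S () \<in> obj X S" using set_homsD(1)[OF e S] by simp
  show "u S \<one>\<^bsub>S\<^esub> = eval_map K X S (e S ())"
  proof (rule dual_eqI[OF unit_in[OF u S] eval_map_in[OF X S eS] S])
    fix R \<phi> f assume R: "algebra K R" "\<phi> \<in> calg_homs K S R" and f: "f \<in> carrier (mobj (funs K X) R)"
    show "u S \<one>\<^bsub>S\<^esub> (R, \<phi>) f = eval_map K X S (e S ()) (R, \<phi>) f"
      using unit_base_change[OF u S R] counit_apply[OF u R(1) f] L R f S eS set_homsD(2)[OF e S _ R, of "()"] by simp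
  qed
next
  fix S :: "'u alg" and f assume R: ?R and S: "algebra K S" and f: "f \<in> carrier (mobj (funs K X) S)"
  show "counit K X u S f = f (S, id_on S) (e S ())"
    using counit_apply[OF u S f] R S f set_homsD(1)[OF e S, of "()"] set_functorD(2)[OF X S] by simp
qed

lemma corresponding_iff:
  assumes m: "m \<in> module_homs (algs K) (funs_dual_tensor K X) (funs_dual K X)"
    and u: "u \<in> module_homs (algs K) Kfun (funs_dual K X)"
    and \<mu>: "\<mu> \<in> set_homs (algs K) (sprod X X) X" and e: "e \<in> set_homs (algs K) spoint X"
  shows "corresponding K X (\<mu>, e) (m, u) \<longleftrightarrow>
    (\<forall>S x y. algebra K S \<longrightarrow> x \<in> obj X S \<longrightarrow> y \<in> obj X S \<longrightarrow>
      m S (funs_dual_pure K X S (eval_map K X S x) (eval_map K X S y)) = eval_map K X S (\<mu> S (x, y))) \<and>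
    (\<forall>S. algebra K S \<longrightarrow> u S \<one>\<^bsub>S\<^esub> = eval_map K X S (e S ()))"
  unfolding comult_pullback_iff[OF m \<mu>, symmetric] counit_point_iff[OF u e, symmetric]
    corresponding_def ball_algs by auto

text \<open>Gives uniqueness of a multiplication with prescribed products of points. Tensors are
  reduced to pure ones by additivity, and then both arguments are reduced to points.\<close>

lemma tensor_homs_eqI:
  assumes det: "evals_determine K X (dual K N)"
    and m: "m \<in> module_homs (algs K) (funs_dual_tensor K X) (dual K N)"
    and m': "m' \<in> module_homs (algs K) (funs_dual_tensor K X) (dual K N)"
    and eq: "\<And>S x y. algebra K S \<Longrightarrow> x \<in> obj X S \<Longrightarrow> y \<in> obj X S \<Longrightarrow>
      m S (funs_dual_pure K X S (eval_map K X S x) (eval_map K X S y)) =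
      m' S (funs_dual_pure K X S (eval_map K X S x) (eval_map K X S y))"
  shows "m = m'"
proof (rule module_homs_eqI[OF m m'])
  fix S t assume S: "algebra K S" and t: "t \<in> carrier (mobj (funs_dual_tensor K X) S)"
  note mf = module_functorD[OF funs_dual_module_functor[OF X] S]
  note bil = bilinear_family_compose[OF funs_dual_pure_bilinear[OF X]]
  show "m S t = m' S t"
    using t unfolding tensor_fun_simps(1)
  proof (induction rule: tensor_induct[OF mf mf, consumes 1, case_names pure add])
    case (pure a b)
    show ?case
      by (rule evals_determine_bilinear[where P = "\<lambda>R \<phi> a b. m R (funs_dual_pure K X R a b)" and
            Q = "\<lambda>R \<phi> a b. m' R (funs_dual_pure K X R a b)",
            OF X det X det S bil[OF module_homs_linear[OF m S]] bil[OF module_homs_linear[OF m' S]]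
            eq S id_on_calg[OF S] pure])
  next
    case (add s t)
    then show ?case using module_homsD(3)[OF m S] module_homsD(3)[OF m' S] by simp
  qed
qed

text \<open>Over each algebra \<open>Kfun\<close> is generated by 1 as a module.\<close>

lemma unit_homs_eqI:
  assumes u: "u \<in> module_homs (algs K) Kfun (funs_dual K X)" and u': "u' \<in> module_homs (algs K) Kfun (funs_dual K X)"
    and eq: "\<And>S. algebra K S \<Longrightarrow> u S \<one>\<^bsub>S\<^esub> = u' S \<one>\<^bsub>S\<^esub>"
  shows "u = u'"
proof (rule module_homs_eqI[OF u u'])
  fix S r assume S: "algebra K S" and r: "r \<in> carrier (mobj Kfun S)"
  interpret cring S by (rule algebra_cring[OF S])
  have "r = r \<odot>\<^bsub>mobj Kfun S\<^esub> \<one>\<^bsub>S\<^esub>" using r by simp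
  then show "u S r = u' S r"
    using module_homsD(4)[OF u S, of "\<one>\<^bsub>S\<^esub>" r] module_homsD(4)[OF u' S, of "\<one>\<^bsub>S\<^esub>" r] eq[OF S] r by simp
qed

end

section \<open>Multiplicativity of comultiplication and counit in terms of the spectrum\<close>

lemma tensor_dual_alg_simps:
  "mobj (tensor_dual_alg K X) S = mobj (dual K (funs_dual_tensor K X)) S
    \<lparr>monoid.mult := (\<lambda>\<omega> \<omega>'. inv_into (carrier (mobj (dual K (funs_dual_tensor K X)) S)) (tensor_dual_to_funs K X S)
        (tensor_dual_to_funs K X S \<omega> \<otimes>\<^bsub>mobj (funs K (sprod X X)) S\<^esub> tensor_dual_to_funs K X S \<omega>')),
      one := inv_into (carrier (mobj (dual K (funs_dual_tensor K X)) S)) (tensor_dual_to_funs K X S)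
        \<one>\<^bsub>mobj (funs K (sprod X X)) S\<^esub>\<rparr>"
  "mmor (tensor_dual_alg K X) = mmor (dual K (funs_dual_tensor K X))"
  by (simp_all add: tensor_dual_alg_def Let_def)

lemma module_homs_tensor_dual_alg:
  "module_homs C M (tensor_dual_alg K X) = module_homs C M (dual K (funs_dual_tensor K X))"
  by (simp add: module_homs_def set_homs_def tensor_dual_alg_simps)

lemma with_mult_simps [simp]:
  "mobj (with_mult M b) S = mobj M S
     \<lparr>monoid.mult := (\<lambda>x y. fst b S (pure_tensor S (mobj M S) (mobj M S) x y)), one := snd b S \<one>\<^bsub>S\<^esub>\<rparr>"
  "mmor (with_mult M b) = mmor M"
  by (simp_all add: with_mult_def)

lemma bialgebra_structures_iff:
  fixes K :: "'u ring" and X :: "('u alg, 'u, 'x) sfun"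
  assumes X: "set_functor (algs K) X" and det: "evals_determine K X Kfun"
    and b: "b \<in> algebra_structures K (funs_dual K X)"
  shows "b \<in> bialgebra_structures K X \<longleftrightarrow>
    (\<forall>S x y. algebra K S \<longrightarrow> x \<in> obj X S \<longrightarrow> y \<in> obj X S \<longrightarrow>
      fst b S (funs_dual_pure K X S (eval_map K X S x) (eval_map K X S y)) \<in> obj (Spec K (funs K X)) S) \<and>
    (\<forall>S. algebra K S \<longrightarrow> snd b S \<one>\<^bsub>S\<^esub> \<in> obj (Spec K (funs K X)) S)"
proof -
  obtain m u where mu: "b = (m, u)" by (cases b)
  have m: "m \<in> module_homs (algs K) (funs_dual_tensor K X) (funs_dual K X)"
    and u: "u \<in> module_homs (algs K) Kfun (funs_dual K X)"
    using b by (auto simp: algebra_structures_def mu)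
  note XX = sprod_set_functor[OF X X] and lf = funs_linear_functor[OF X]
  let ?T = "dual K (funs_dual_tensor K X)" and ?A = "funs K X" and ?AA = "funs K (sprod X X)"
  let ?to = "tensor_dual_to_funs K X"
  let ?D = "\<lambda>S f. ?to S (comult K X m S f)"
  let ?ev = "\<lambda>S x y. m S (funs_dual_pure K X S (eval_map K X S x) (eval_map K X S y))"
  note \<Delta> = comult_in[OF X m]
  note D_in = module_homsD(1)[OF tensor_dual_to_funs_in[OF X] _ module_homsD(1)[OF \<Delta>]]
  \<comment> \<open>The algebra structure of the target is transported with \<open>inv_into\<close>.
    Applying the identification turns such equations into equations between functions on the square,
    where the operations are pointwise.\<close>
  have inv_iff: "\<omega> = inv_into (carrier (mobj ?T S)) (?to S) z \<longleftrightarrow> ?to S \<omega> = z"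
    if "algebra K S" "\<omega> \<in> carrier (mobj ?T S)" "z \<in> carrier (mobj ?AA S)" for S \<omega> z
  proof -
    note bij = tensor_dual_to_funs_bij[OF X det that(1)]
    show ?thesis
      using bij_betw_inv_into_left[OF bij that(2)] bij_betw_inv_into_right[OF bij that(3)] by metis
  qed
  have id: "base_change K R R (id_on R) f = f" if "algebra K R" "f \<in> carrier (mobj ?A R)" for R f
    using linear_functor_mor(2)[OF lf that] by simp
  have comult_iff: "comult K X m \<in> algebra_homs (algs K) ?A (tensor_dual_alg K X) \<longleftrightarrow>
      (\<forall>S. algebra K S \<longrightarrow> (\<forall>f\<in>carrier (mobj ?A S). \<forall>g\<in>carrier (mobj ?A S).
        ?D S (f \<otimes>\<^bsub>mobj ?A S\<^esub> g) = ?D S f \<otimes>\<^bsub>mobj ?AA S\<^esub> ?D S g) \<and> ?D S \<one>\<^bsub>mobj ?A S\<^esub> = \<one>\<^bsub>mobj ?AA S\<^esub>)"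
    using \<Delta> inv_iff module_homsD(1)[OF \<Delta>] D_in funs_closed[OF X] funs_closed[OF XX]
    by (simp add: algebra_homs_iff module_homs_tensor_dual_alg tensor_dual_alg_simps)
  \<comment> \<open>For fixed x and y, the values of \<open>?D R f\<close> at the transported points
    are the values of the product of evaluations on f. Multiplicativity in f on one side is
    therefore multiplicativity on the other.\<close>
  have D_eval: "?ev S x y (R, \<phi>) f = ?D R f (R, id_on R) (mor X S R \<phi> x, mor X S R \<phi> y)"
    if "algebra K S" "x \<in> obj X S" "y \<in> obj X S" "algebra K R" "\<phi> \<in> calg_homs K S R" "f \<in> carrier (mobj ?A R)"
    for S x y R \<phi> f
    using mult_eval_base_change[OF X m that(1-5)] id[OF that(4,6)]
      comult_eval[OF X m that(4,6,4) id_on_calg[OF that(4)] set_functorD(1)[OF X that(1,4,5,2)]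
        set_functorD(1)[OF X that(1,4,5,3)]]
    by simp
  have "comult K X m \<in> algebra_homs (algs K) ?A (tensor_dual_alg K X) \<longleftrightarrow>
      (\<forall>S x y. algebra K S \<longrightarrow> x \<in> obj X S \<longrightarrow> y \<in> obj X S \<longrightarrow> ?ev S x y \<in> obj (Spec K ?A) S)"
    unfolding comult_iff
  proof (intro iffI allI impI conjI ballI)
    fix S x y assume hom: "\<forall>S. algebra K S \<longrightarrow> (\<forall>f\<in>carrier (mobj ?A S). \<forall>g\<in>carrier (mobj ?A S).
        ?D S (f \<otimes>\<^bsub>mobj ?A S\<^esub> g) = ?D S f \<otimes>\<^bsub>mobj ?AA S\<^esub> ?D S g) \<and> ?D S \<one>\<^bsub>mobj ?A S\<^esub> = \<one>\<^bsub>mobj ?AA S\<^esub>"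
      and S: "algebra K S" and xy: "x \<in> obj X S" "y \<in> obj X S"
    show "?ev S x y \<in> obj (Spec K ?A) S"
      unfolding Spec_iff[OF S]
      using module_homsD(1)[OF m S eval_pure_in[OF X S xy]] hom D_eval[OF S xy] funs_closed[OF X]
        set_functorD(1)[OF X S] xy by simp
  next
    fix S :: "'u alg" assume spec: "\<forall>S x y. algebra K S \<longrightarrow> x \<in> obj X S \<longrightarrow> y \<in> obj X S \<longrightarrow> ?ev S x y \<in> obj (Spec K ?A) S"
      and S: "algebra K S"
    \<comment> \<open>Membership in the spectrum is used over each R at \<open>id_on R\<close>. This
      is enough, because the value over \<phi> at a pair of points is the product of their
      evaluations over R, applied to the base change of f.\<close>
    have ev: "?ev R x y (R, id_on R) (f \<otimes>\<^bsub>mobj ?A R\<^esub> g) =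
          ?ev R x y (R, id_on R) f \<otimes>\<^bsub>R\<^esub> ?ev R x y (R, id_on R) g"
        "?ev R x y (R, id_on R) \<one>\<^bsub>mobj ?A R\<^esub> = \<one>\<^bsub>R\<^esub>"
      if "algebra K R" "x \<in> obj X R" "y \<in> obj X R" "f \<in> carrier (mobj ?A R)" "g \<in> carrier (mobj ?A R)" for R x y f g
      using spec[rule_format, OF that(1-3)] that by (simp_all add: Spec_iff)
    show "?D S (f \<otimes>\<^bsub>mobj ?A S\<^esub> g) = ?D S f \<otimes>\<^bsub>mobj ?AA S\<^esub> ?D S g"
      if f: "f \<in> carrier (mobj ?A S)" and g: "g \<in> carrier (mobj ?A S)" for f g
    proof (rule funs_eqI[OF D_in[OF S S funs_closed(2)[OF X S f g]] funs_closed(2)[OF XX S D_in[OF S S f] D_in[OF S S g]] S])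
      fix R \<phi> p assume R: "algebra K R" "\<phi> \<in> calg_homs K S R" and "p \<in> obj (sprod X X) R"
      then obtain x y where p: "p = (x, y)" "x \<in> obj X R" "y \<in> obj X R" by auto
      show "?D S (f \<otimes>\<^bsub>mobj ?A S\<^esub> g) (R, \<phi>) p = (?D S f \<otimes>\<^bsub>mobj ?AA S\<^esub> ?D S g) (R, \<phi>) p"
        using R p comult_eval[OF X m S _ R p(2,3)] f g funs_closed(2)[OF X S f g] base_change_mult[OF X S R f g]
          ev(1)[OF R(1) p(2,3) funs_base_change[OF f R S] funs_base_change[OF g R S]] by simp
    qed
    have one: "\<one>\<^bsub>mobj ?A S\<^esub> \<in> carrier (mobj ?A S)" using funs_closed(4)[OF X S] .
    show "?D S \<one>\<^bsub>mobj ?A S\<^esub> = \<one>\<^bsub>mobj ?AA S\<^esub>"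
    proof (rule funs_eqI[OF D_in[OF S S one] funs_closed(4)[OF XX S] S])
      fix R \<phi> p assume R: "algebra K R" "\<phi> \<in> calg_homs K S R" and "p \<in> obj (sprod X X) R"
      then obtain x y where p: "p = (x, y)" "x \<in> obj X R" "y \<in> obj X R" by auto
      show "?D S \<one>\<^bsub>mobj ?A S\<^esub> (R, \<phi>) p = \<one>\<^bsub>mobj ?AA S\<^esub> (R, \<phi>) p"
        using R p comult_eval[OF X m S one R p(2,3)] base_change_one[OF X S R]
          ev(2)[OF R(1) p(2,3) funs_closed(4)[OF X R(1)] funs_closed(4)[OF X R(1)]] by simp
    qed
  qed
  moreover have "counit K X u \<in> algebra_homs (algs K) ?A Kfun \<longleftrightarrow>
      (\<forall>S. algebra K S \<longrightarrow> u S \<one>\<^bsub>S\<^esub> \<in> obj (Spec K ?A) S)"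
  proof -
    \<comment> \<open>Written as evaluation of the form u(1), the counit inherits its linearity from
      that form and its naturality from u.\<close>
    have eq: "counit K X u = family_hom K ?A (\<lambda>S f. u S \<one>\<^bsub>S\<^esub> (S, id_on S) f)"
    proof -
      have "counit K X u S f = u S \<one>\<^bsub>S\<^esub> (S, id_on S) f" if "algebra K S" "f \<in> carrier (mobj ?A S)" for S f
        by (rule counit_apply[OF X u that])
      then show ?thesis
        by (auto simp: counit_def family_hom_def intro!: restrict_ext)
    qed
    have mod: "counit K X u \<in> module_homs (algs K) ?A Kfun"
      unfolding eq
    proof (rule family_hom_in[OF lf], rule linear_familyI)
      fix S R and \<phi> assume S: "algebra K S" "algebra K R" "\<phi> \<in> calg_homs K S R"
      fix f assume f: "f \<in> carrier (mobj ?A R)"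
      note D = dualD[OF unit_in[OF X u S(2)] S(2) S(2) id_on_calg[OF S(2)] f]
      show "u R \<one>\<^bsub>R\<^esub> (R, id_on R) f \<in> carrier (mobj Kfun R)" using D(1) by simp
      show "u R' \<one>\<^bsub>R'\<^esub> (R', id_on R') (mmor ?A R R' \<psi> f) = mmor Kfun R R' \<psi> (u R \<one>\<^bsub>R\<^esub> (R, id_on R) f)"
        if R': "algebra K R'" "\<psi> \<in> calg_homs K R R'" for R' \<psi>
        using D(2)[OF R'] unit_base_change[OF X u S(2) R'] R' by simp
      show "u R \<one>\<^bsub>R\<^esub> (R, id_on R) (f \<oplus>\<^bsub>mobj ?A R\<^esub> g) =
          u R \<one>\<^bsub>R\<^esub> (R, id_on R) f \<oplus>\<^bsub>mobj Kfun R\<^esub> u R \<one>\<^bsub>R\<^esub> (R, id_on R) g"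
        if "g \<in> carrier (mobj ?A R)" for g using D(3)[OF that] by simp
      show "u R \<one>\<^bsub>R\<^esub> (R, id_on R) (r \<odot>\<^bsub>mobj ?A R\<^esub> f) = r \<odot>\<^bsub>mobj Kfun R\<^esub> u R \<one>\<^bsub>R\<^esub> (R, id_on R) f"
        if "r \<in> carrier R" for r using D(4)[OF that] by simp
    qed
    let ?u = "\<lambda>S. u S \<one>\<^bsub>S\<^esub>"
    \<comment> \<open>The spectrum asks for multiplicativity over every structure morphism, the
      counit over identities; \<open>unit_base_change\<close> bridges the difference.\<close>
    have "(\<forall>S. algebra K S \<longrightarrow> ?u S \<in> obj (Spec K ?A) S) \<longleftrightarrow>
      (\<forall>S. algebra K S \<longrightarrow> (\<forall>f\<in>carrier (mobj ?A S). \<forall>g\<in>carrier (mobj ?A S).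
        ?u S (S, id_on S) (f \<otimes>\<^bsub>mobj ?A S\<^esub> g) = ?u S (S, id_on S) f \<otimes>\<^bsub>S\<^esub> ?u S (S, id_on S) g) \<and>
        ?u S (S, id_on S) \<one>\<^bsub>mobj ?A S\<^esub> = \<one>\<^bsub>S\<^esub>)" (is "?L \<longleftrightarrow> ?R")
    proof
      show ?R if ?L
      proof (intro allI impI)
        fix S :: "'u alg" assume S: "algebra K S"
        with that have "?u S \<in> obj (Spec K ?A) S" by blast
        with S id_on_calg[OF S]
        show "(\<forall>f\<in>carrier (mobj ?A S). \<forall>g\<in>carrier (mobj ?A S).
          ?u S (S, id_on S) (f \<otimes>\<^bsub>mobj ?A S\<^esub> g) = ?u S (S, id_on S) f \<otimes>\<^bsub>S\<^esub> ?u S (S, id_on S) g) \<and>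
          ?u S (S, id_on S) \<one>\<^bsub>mobj ?A S\<^esub> = \<one>\<^bsub>S\<^esub>"
          unfolding Spec_iff[OF S] by blast
      qed
      show ?L if ?R
      proof (intro allI impI)
        fix S :: "'u alg" assume S: "algebra K S"
        have "(\<forall>f\<in>carrier (mobj ?A R). \<forall>g\<in>carrier (mobj ?A R).
            ?u S (R, \<phi>) (f \<otimes>\<^bsub>mobj ?A R\<^esub> g) = ?u S (R, \<phi>) f \<otimes>\<^bsub>R\<^esub> ?u S (R, \<phi>) g) \<and>
            ?u S (R, \<phi>) \<one>\<^bsub>mobj ?A R\<^esub> = \<one>\<^bsub>R\<^esub>"
          if R: "algebra K R" "\<phi> \<in> calg_homs K S R" for R \<phi>
          unfolding unit_base_change[OF X u S R] using \<open>?R\<close> R(1) by blast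
        then show "?u S \<in> obj (Spec K ?A) S"
          unfolding Spec_iff[OF S] using unit_in[OF X u S] by blast
      qed
    qed
    then show ?thesis
      using mod funs_closed[OF X] by (simp add: algebra_homs_iff eq)
  qed
  ultimately show ?thesis
    using b by (simp add: bialgebra_structures_def mu)
qed


section \<open>Monoid and bialgebra structures\<close>

text \<open>Extracts what affineness contributes: points detect linear maps from the dual of the
  functions into scalars or duals, and every point of the spectrum is the evaluation at exactly one
  point.\<close>

lemma affineD:
  assumes "affine K X"
  shows "set_functor (algs K) X"
    and "evals_determine K X Kfun"
    and "linear_functor K N \<Longrightarrow> evals_determine K X (dual K N)"
    and "algebra K S \<Longrightarrow> bij_betw (eval_map K X S) (obj X S) (obj (Spec K (funs K X)) S)"
proof -
  show X: "set_functor (algs K) X" and det: "evals_determine K X Kfun"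
    using assms reflexive_evals_determine unfolding affine_def by blast+
  show "evals_determine K X (dual K N)" if "linear_functor K N"
    by (rule evals_determine_dual[OF X det that])
  show "bij_betw (eval_map K X S) (obj X S) (obj (Spec K (funs K X)) S)" if S: "algebra K S"
  proof -
    obtain \<theta> where \<theta>: "\<theta> \<in> set_homs (algs K) (Spec K (funs K X)) X"
      "\<And>x. x \<in> obj X S \<Longrightarrow> \<theta> S (eval_map K X S x) = x"
      "\<And>\<omega>. \<omega> \<in> obj (Spec K (funs K X)) S \<Longrightarrow> eval_map K X S (\<theta> S \<omega>) = \<omega>"
      using assms S unfolding affine_def set_iso_def ball_algs by blast
    show ?thesis
      by (rule bij_betw_byWitness[where f' = "\<theta> S"])
         (use \<theta> eval_map_in_Spec[OF X S] set_homsD(1)[OF \<theta>(1) S] in auto)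
  qed
qed

lemma affine_eval_inject:
  assumes "affine K X" "algebra K S" "x \<in> obj X S" "y \<in> obj X S" "eval_map K X S x = eval_map K X S y"
  shows "x = y"
  using affineD(4)[OF assms(1,2)] assms(3-5) by (metis bij_betw_inv_into_left)

text \<open>The product, the unit and the image of a point are each first found in the spectrum and
  then brought back to points with this map.\<close>

definition point_of where
  "point_of K X S = inv_into (obj X S) (eval_map K X S)"

lemma point_of:
  assumes "affine K X" "algebra K S" "\<omega> \<in> obj (Spec K (funs K X)) S"
  shows "point_of K X S \<omega> \<in> obj X S" "eval_map K X S (point_of K X S \<omega>) = \<omega>"
  using bij_betw_inv_into_right[OF affineD(4)[OF assms(1,2)] assms(3)] assms(3)
    bij_betw_imp_surj_on[OF affineD(4)[OF assms(1,2)]]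
  unfolding point_of_def by (auto intro: inv_into_into)

lemma module_update:
  assumes "module R M"
  shows "module R (M\<lparr>monoid.mult := f, one := e\<rparr>)"
proof -
  have "add_monoid (M\<lparr>monoid.mult := f, one := e\<rparr>) = add_monoid M" by simp
  then have "abelian_group (M\<lparr>monoid.mult := f, one := e\<rparr>)"
    using module.axioms(2)[OF assms]
    unfolding abelian_group_def abelian_monoid_def abelian_group_axioms_def by simp
  then show ?thesis
    using module.axioms[OF assms] unfolding module_def module_axioms_def by simp
qed

lemma module_homs_with_mult:
  "module_homs (algs K) (with_mult M b) (with_mult N c) = module_homs (algs K) M N"
  by (simp add: module_homs_def set_homs_def)

lemma linear_family_id: "linear_family K S M M (\<lambda>R \<phi> x. x)"
  by (simp add: linear_family_def nat_family_def)

section \<open>The convolution algebra of a functor of monoids\<close>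

context
  fixes K :: "'u ring" and X :: "('u alg, 'u, 'x) sfun" and \<mu> e m u
  assumes X: "set_functor (algs K) X" and det: "evals_determine K X (dual K (funs K X))"
    and m: "m \<in> module_homs (algs K) (funs_dual_tensor K X) (funs_dual K X)"
    and u: "u \<in> module_homs (algs K) Kfun (funs_dual K X)"
    and s: "(\<mu>, e) \<in> monoid_structures K X"
    and m_eval: "\<And>S x y. algebra K S \<Longrightarrow> x \<in> obj X S \<Longrightarrow> y \<in> obj X S \<Longrightarrow>
      m S (funs_dual_pure K X S (eval_map K X S x) (eval_map K X S y)) = eval_map K X S (\<mu> S (x, y))"
    and u_eval: "\<And>S. algebra K S \<Longrightarrow> u S \<one>\<^bsub>S\<^esub> = eval_map K X S (e S ())"
begin

abbreviation (input) conv where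
  "conv S a b \<equiv> m S (funs_dual_pure K X S a b)"

lemma conv_bilinear: "algebra K S \<Longrightarrow>
    bilinear_family K S (funs_dual K X) (funs_dual K X) (funs_dual K X) (\<lambda>R \<phi>. conv R)"
  by (rule bilinear_family_compose[OF funs_dual_pure_bilinear[OF X] module_homs_linear[OF m]])

lemma monoid_laws:
  assumes S: "algebra K S"
  shows "x \<in> obj X S \<Longrightarrow> y \<in> obj X S \<Longrightarrow> \<mu> S (x, y) \<in> obj X S"
    and "e S () \<in> obj X S"
    and "x \<in> obj X S \<Longrightarrow> y \<in> obj X S \<Longrightarrow> z \<in> obj X S \<Longrightarrow> \<mu> S (\<mu> S (x, y), z) = \<mu> S (x, \<mu> S (y, z))"
    and "x \<in> obj X S \<Longrightarrow> \<mu> S (e S (), x) = x"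
    and "x \<in> obj X S \<Longrightarrow> \<mu> S (x, e S ()) = x"
proof -
  interpret monoid "monoid_at X (\<mu>, e) S"
    using s S by (simp add: monoid_structures_def ball_algs)
  show "x \<in> obj X S \<Longrightarrow> y \<in> obj X S \<Longrightarrow> \<mu> S (x, y) \<in> obj X S"
    "e S () \<in> obj X S"
    "x \<in> obj X S \<Longrightarrow> y \<in> obj X S \<Longrightarrow> z \<in> obj X S \<Longrightarrow> \<mu> S (\<mu> S (x, y), z) = \<mu> S (x, \<mu> S (y, z))"
    "x \<in> obj X S \<Longrightarrow> \<mu> S (e S (), x) = x"
    "x \<in> obj X S \<Longrightarrow> \<mu> S (x, e S ()) = x"
    using m_closed[of x y] one_closed m_assoc[of x y z] l_one[of x] r_one[of x] by (simp_all add: monoid_at_def)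
qed

lemma conv_unit:
  assumes S: "algebra K S" and a: "a \<in> carrier (mobj (funs_dual K X) S)"
  shows "conv S (u S \<one>\<^bsub>S\<^esub>) a = a" "conv S a (u S \<one>\<^bsub>S\<^esub>) = a"
proof -
  note lf = dual_linear_functor[OF funs_linear_functor[OF X]]
  note u1 = unit_in[OF X u S]
  have u1_mor: "mmor (funs_dual K X) S R \<phi> (u S \<one>\<^bsub>S\<^esub>) = eval_map K X R (e R ())"
    if "algebra K R" "\<phi> \<in> calg_homs K S R" for R \<phi>
    using module_homsD(2)[OF u S, of "\<one>\<^bsub>S\<^esub>" R \<phi>] algebra_closed(1)[OF S] that calg_one[OF that(2)] u_eval by simp
  \<comment> \<open>Transport along \<open>id_on S\<close> is inserted so that the left side is the
    instance at S of a family with one argument frozen; it is removed again right after.\<close>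
  have "conv S (mmor (funs_dual K X) S S (id_on S) (u S \<one>\<^bsub>S\<^esub>)) a = a"
    by (rule evals_determineD[where P = "\<lambda>R \<phi>. conv R (mmor (funs_dual K X) S R \<phi> (u S \<one>\<^bsub>S\<^esub>))" and Q = "\<lambda>R \<phi> a. a",
          OF det S bilinear_family_right[OF conv_bilinear[OF S] S lf u1] linear_family_id _ S id_on_calg[OF S] a])
       (use u1_mor m_eval monoid_laws in simp)
  then show "conv S (u S \<one>\<^bsub>S\<^esub>) a = a"
    unfolding linear_functor_mor(2)[OF lf S u1] .
  have "conv S a (mmor (funs_dual K X) S S (id_on S) (u S \<one>\<^bsub>S\<^esub>)) = a"
    by (rule evals_determineD[where P = "\<lambda>R \<phi> a. conv R a (mmor (funs_dual K X) S R \<phi> (u S \<one>\<^bsub>S\<^esub>))" and Q = "\<lambda>R \<phi> a. a",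
          OF det S bilinear_family_left[OF conv_bilinear[OF S] S lf u1] linear_family_id _ S id_on_calg[OF S] a])
       (use u1_mor m_eval monoid_laws in simp)
  then show "conv S a (u S \<one>\<^bsub>S\<^esub>) = a"
    unfolding linear_functor_mor(2)[OF lf S u1] .
qed

text \<open>Three arguments have to be freed, while the available tests free one or two. So the
  third is freed with points in the other two places, and afterwards the first two are freed with
  the third frozen.\<close>

lemma conv_assoc:
  assumes S: "algebra K S" and a: "a \<in> carrier (mobj (funs_dual K X) S)"
    and b: "b \<in> carrier (mobj (funs_dual K X) S)" and c: "c \<in> carrier (mobj (funs_dual K X) S)"
  shows "conv S (conv S a b) c = conv S a (conv S b c)"
proof -
  note lf = dual_linear_functor[OF funs_linear_functor[OF X]]
  let ?r = "mmor (funs_dual K X)"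
  note closed = bilinear_familyD(1)[OF conv_bilinear]
  have step: "conv S (conv S (eval_map K X S x) (eval_map K X S y)) c =
      conv S (eval_map K X S x) (conv S (eval_map K X S y) c)"
    if S: "algebra K S" and xy: "x \<in> obj X S" "y \<in> obj X S" and c: "c \<in> carrier (mobj (funs_dual K X) S)"
    for S x y c
  proof -
    note ex = eval_map_in[OF X S xy(1)] and ey = eval_map_in[OF X S xy(2)]
    note exy = closed[OF S S id_on_calg[OF S] ex ey]
    note bc = eval_map_base_change[OF X S]
    have "conv S (?r S S (id_on S) (conv S (eval_map K X S x) (eval_map K X S y))) c =
        conv S (?r S S (id_on S) (eval_map K X S x)) (conv S (?r S S (id_on S) (eval_map K X S y)) c)"
    proof (rule evals_determineD[where P = "\<lambda>R \<phi>. conv R (?r S R \<phi> (conv S (eval_map K X S x) (eval_map K X S y)))"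
          and Q = "\<lambda>R \<phi> c. conv R (?r S R \<phi> (eval_map K X S x)) (conv R (?r S R \<phi> (eval_map K X S y)) c)",
          OF det S _ _ _ S id_on_calg[OF S] c])
      note right = bilinear_family_right[OF conv_bilinear[OF S] S lf]
      show "linear_family K S (funs_dual K X) (funs_dual K X)
          (\<lambda>R \<phi>. conv R (?r S R \<phi> (conv S (eval_map K X S x) (eval_map K X S y))))"
        by (rule right[OF exy])
      show "linear_family K S (funs_dual K X) (funs_dual K X)
          (\<lambda>R \<phi> c. conv R (?r S R \<phi> (eval_map K X S x)) (conv R (?r S R \<phi> (eval_map K X S y)) c))"
        by (rule linear_family_compose[OF right[OF ey] right[OF ex]])
      \<comment> \<open>With evaluations in all three places the claim is associativity of the
        product of points, read through \<open>m_eval\<close>.\<close>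
      show "conv R (?r S R \<phi> (conv S (eval_map K X S x) (eval_map K X S y))) (eval_map K X R z) =
          conv R (?r S R \<phi> (eval_map K X S x)) (conv R (?r S R \<phi> (eval_map K X S y)) (eval_map K X R z))"
        if R: "algebra K R" "\<phi> \<in> calg_homs K S R" and z: "z \<in> obj X R" for R \<phi> z
      proof -
        have xy': "mor X S R \<phi> x \<in> obj X R" "mor X S R \<phi> y \<in> obj X R"
          using set_functorD(1)[OF X S R] xy by auto
        have "?r S R \<phi> (conv S (eval_map K X S x) (eval_map K X S y)) =
            conv R (?r S R \<phi> (eval_map K X S x)) (?r S R \<phi> (eval_map K X S y))"
          using bilinear_familyD(2)[OF conv_bilinear[OF S] S id_on_calg[OF S] ex ey R] by simp
        then show ?thesis
          using xy xy' z R by (simp add: bc m_eval monoid_laws)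
      qed
    qed
    then show ?thesis
      unfolding linear_functor_mor(2)[OF lf S exy] linear_functor_mor(2)[OF lf S ex] linear_functor_mor(2)[OF lf S ey] .
  qed
  have "conv S (conv S a b) (?r S S (id_on S) c) = conv S a (conv S b (?r S S (id_on S) c))"
  proof (rule evals_determine_bilinear[where P = "\<lambda>R \<phi> a b. conv R (conv R a b) (?r S R \<phi> c)"
        and Q = "\<lambda>R \<phi> a b. conv R a (conv R b (?r S R \<phi> c))", OF X det X det S _ _ _ S id_on_calg[OF S] a b])
    note left = bilinear_family_left[OF conv_bilinear[OF S] S lf c]
    show "bilinear_family K S (funs_dual K X) (funs_dual K X) (funs_dual K X)
        (\<lambda>R \<phi> a b. conv R (conv R a b) (?r S R \<phi> c))"
      by (rule bilinear_family_compose[OF conv_bilinear[OF S] left])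
    show "bilinear_family K S (funs_dual K X) (funs_dual K X) (funs_dual K X)
        (\<lambda>R \<phi> a b. conv R a (conv R b (?r S R \<phi> c)))"
      by (rule bilinear_family_precompose[OF linear_family_id left conv_bilinear[OF S]])
    show "conv R (conv R (eval_map K X R x) (eval_map K X R y)) (?r S R \<phi> c) =
        conv R (eval_map K X R x) (conv R (eval_map K X R y) (?r S R \<phi> c))"
      if "algebra K R" "\<phi> \<in> calg_homs K S R" "x \<in> obj X R" "y \<in> obj X R" for R \<phi> x y
      by (rule step[OF that(1,3,4) linear_functor_mor(1)[OF lf S that(1,2) c]])
  qed
  then show ?thesis unfolding linear_functor_mor(2)[OF lf S c] .
qed

text \<open>Unit and associativity laws carry the content; distributivity, compatibility with
  scalars and functoriality restate that the product is bilinear and natural.\<close>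

lemma convolution_algebra_structure: "(m, u) \<in> algebra_structures K (funs_dual K X)"
proof -
  let ?A = "with_mult (funs_dual K X) (m, u)"
  note mf = funs_dual_module_functor[OF X]
  note mods = module_update[OF module_functorD[OF mf]]
  have mod: "module_functor (algs K) ?A"
    using mf mods unfolding module_functor_def ball_algs by (simp add: set_functor_def)
  have alg: "assoc_algebra S (mobj ?A S)" if S: "algebra K S" for S
  proof -
    note bil = bilinear_familyD[OF conv_bilinear[OF S] S id_on_calg[OF S]]
    have u1: "u S \<one>\<^bsub>S\<^esub> \<in> carrier (mobj (funs_dual K X) S)" by (rule unit_in[OF X u S])
    have mS: "module S (mobj ?A S)" using mods[OF S] by simp
    have "ring (mobj ?A S)"
    proof (rule ringI)
      show "abelian_group (mobj ?A S)" by (rule module.axioms(2)[OF mS])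
      show "monoid (mobj ?A S)"
        by (rule monoidI) (simp_all add: bil(1) u1 conv_unit[OF S] conv_assoc[OF S])
    qed (simp_all add: bil(3,4))
    then show ?thesis
      unfolding assoc_algebra_def using mS by (simp add: bil(5,6))
  qed
  have hom: "mmor ?A S R \<phi> \<in> ring_hom (mobj ?A S) (mobj ?A R)"
    if S: "algebra K S" "algebra K R" "\<phi> \<in> calg_homs K S R" for S R \<phi>
  proof (rule ring_hom_memI)
    note bil = bilinear_familyD[OF conv_bilinear[OF S(1)] S(1) id_on_calg[OF S(1)]]
    note lf = dual_linear_functor[OF funs_linear_functor[OF X]]
    fix a assume "a \<in> carrier (mobj ?A S)"
    then have a: "a \<in> carrier (mobj (funs_dual K X) S)" by simp
    show "mmor ?A S R \<phi> a \<in> carrier (mobj ?A R)" using linear_functor_mor(1)[OF lf S a] by simp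
    fix b assume "b \<in> carrier (mobj ?A S)"
    then have b: "b \<in> carrier (mobj (funs_dual K X) S)" by simp
    show "mmor ?A S R \<phi> (a \<otimes>\<^bsub>mobj ?A S\<^esub> b) = mmor ?A S R \<phi> a \<otimes>\<^bsub>mobj ?A R\<^esub> mmor ?A S R \<phi> b"
      using bil(2)[OF a b S(2,3)] by simp
    show "mmor ?A S R \<phi> (a \<oplus>\<^bsub>mobj ?A S\<^esub> b) = mmor ?A S R \<phi> a \<oplus>\<^bsub>mobj ?A R\<^esub> mmor ?A S R \<phi> b"
      using linear_functorD(4)[OF lf S a b] by simp
  next
    show "mmor ?A S R \<phi> \<one>\<^bsub>mobj ?A S\<^esub> = \<one>\<^bsub>mobj ?A R\<^esub>"
      using module_homsD(2)[OF u S(1) _ S(2,3), of "\<one>\<^bsub>S\<^esub>"] algebra_closed(1)[OF S(1)] calg_one[OF S(3)] by simp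
  qed
  show ?thesis
    unfolding algebra_structures_def algebra_functor_def ball_algs using m u mod alg hom by simp
qed

end

lemma monoid_structuresD:
  assumes "s \<in> monoid_structures K X"
  shows "fst s \<in> set_homs (algs K) (sprod X X) X" "snd s \<in> set_homs (algs K) spoint X"
  using assms by (auto simp: monoid_structures_def)

lemma bialgebra_structuresD:
  assumes "b \<in> bialgebra_structures K X"
  shows "b \<in> algebra_structures K (funs_dual K X)"
    and "fst b \<in> module_homs (algs K) (funs_dual_tensor K X) (funs_dual K X)"
    and "snd b \<in> module_homs (algs K) Kfun (funs_dual K X)"
  using assms by (auto simp: bialgebra_structures_def algebra_structures_def)

text \<open>The comultiplication is prescribed as f \<mapsto> f \<circ> \<mu>, so m is defined by
  exchanging the arguments of that map; its values at points then follow from the comparison of m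
  with \<mu>.\<close>

lemma bialgebra_of_monoid:
  fixes K :: "'u ring" and X :: "('u alg, 'u, 'x) sfun"
  assumes aff: "affine K X" and s: "s \<in> monoid_structures K X"
  shows "\<exists>!b. b \<in> bialgebra_structures K X \<and> corresponding K X s b"
proof -
  note X = affineD(1)[OF aff] and det = affineD(2)[OF aff]
  note lf = funs_linear_functor[OF X] and T = funs_dual_tensor_linear[OF X] and XX = sprod_set_functor[OF X X]
  note det' = affineD(3)[OF aff lf]
  obtain \<mu> e where se: "s = (\<mu>, e)" by (cases s)
  have \<mu>: "\<mu> \<in> set_homs (algs K) (sprod X X) X" and e: "e \<in> set_homs (algs K) spoint X"
    using monoid_structuresD[OF s] by (simp_all add: se)
  have eS: "e S () \<in> obj X S" if "algebra K S" for S using set_homsD(1)[OF e that] by simp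
  let ?T = "funs_dual_tensor K X"
  \<comment> \<open>The inverse of the identification, as a morphism: a function on the square
    becomes a linear form on the tensor square.\<close>
  define lift where "lift = family_hom K (funs K (sprod X X))
    (\<lambda>S. inv_into (carrier (mobj (dual K ?T) S)) (tensor_dual_to_funs K X S))"
  have lift: "lift \<in> module_homs (algs K) (funs K (sprod X X)) (dual K ?T)"
    unfolding lift_def
    by (rule module_homs_inverse[OF dual_linear_functor[OF T] funs_linear_functor[OF XX]
          tensor_dual_to_funs_in[OF X] tensor_dual_to_funs_bij[OF X det]])
  have to_lift: "tensor_dual_to_funs K X S (lift S F) = F"
    if "algebra K S" "F \<in> carrier (mobj (funs K (sprod X X)) S)" for S F
    using bij_betw_inv_into_right[OF tensor_dual_to_funs_bij[OF X det that(1)] that(2)] that by (simp add: lift_def)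
  have pb: "pullback K (sprod X X) X \<mu> \<in> module_homs (algs K) (funs K X) (funs K (sprod X X))"
    using pullback_in[OF XX X \<mu>] by (simp add: algebra_homs_iff)
  define \<Delta> where "\<Delta> = family_hom K (funs K X) (\<lambda>S f. lift S (pullback K (sprod X X) X \<mu> S f))"
  have \<Delta>: "\<Delta> \<in> module_homs (algs K) (funs K X) (dual K ?T)"
    unfolding \<Delta>_def by (rule module_homs_compose[OF lf pb lift])
  define m where "m = flip K ?T (funs K X) \<Delta>"
  have m: "m \<in> module_homs (algs K) ?T (funs_dual K X)"
    unfolding m_def by (rule flip_in[OF T lf \<Delta>])
  \<comment> \<open>Exchanging arguments twice gives back \<Delta>, so the comultiplication of m is
    the prescribed one.\<close>
  have "comult K X m = \<Delta>"
    unfolding comult_eq_flip m_def by (rule flip_flip[OF T lf \<Delta>])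
  then have "tensor_dual_to_funs K X S (comult K X m S f) = pullback K (sprod X X) X \<mu> S f"
    if "algebra K S" "f \<in> carrier (mobj (funs K X) S)" for S f
    using that to_lift[OF that(1) module_homsD(1)[OF pb that]] by (simp add: \<Delta>_def)
  then have m_eval: "m S (funs_dual_pure K X S (eval_map K X S x) (eval_map K X S y)) = eval_map K X S (\<mu> S (x, y))"
    if "algebra K S" "x \<in> obj X S" "y \<in> obj X S" for S x y
    using comult_pullback_iff[OF X m \<mu>] that by blast
  \<comment> \<open>A linear map out of \<open>Kfun\<close> is fixed by the image of 1, which has to
    be the evaluation at e.\<close>
  define u where "u = family_hom K Kfun (\<lambda>S r. r \<odot>\<^bsub>mobj (funs_dual K X) S\<^esub> eval_map K X S (e S ()))"
  have u: "u \<in> module_homs (algs K) Kfun (funs_dual K X)"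
    unfolding u_def
  proof (rule family_hom_in[OF Kfun_linear_functor], rule linear_familyI)
    fix S R and \<phi> assume S: "algebra K S" "algebra K R" "\<phi> \<in> calg_homs K S R"
    fix r assume r: "r \<in> carrier (mobj Kfun R)"
    interpret A: module R "mobj (funs_dual K X) R"
      by (rule module_functorD[OF funs_dual_module_functor[OF X] S(2)])
    note ev = eval_map_in[OF X S(2) eS[OF S(2)]]
    show "r \<odot>\<^bsub>mobj (funs_dual K X) R\<^esub> eval_map K X R (e R ()) \<in> carrier (mobj (funs_dual K X) R)"
      using r ev by simp
    show "mmor Kfun R R' \<psi> r \<odot>\<^bsub>mobj (funs_dual K X) R'\<^esub> eval_map K X R' (e R' ()) =
        mmor (funs_dual K X) R R' \<psi> (r \<odot>\<^bsub>mobj (funs_dual K X) R\<^esub> eval_map K X R (e R ()))"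
      if R': "algebra K R'" "\<psi> \<in> calg_homs K R R'" for R' \<psi>
      using base_change_smult[OF lf S(2) R' _ ev] r eval_map_base_change[OF X S(2) R' eS[OF S(2)]]
        set_homsD(2)[OF e S(2) _ R', of "()"] by simp
    show "(r \<oplus>\<^bsub>mobj Kfun R\<^esub> r') \<odot>\<^bsub>mobj (funs_dual K X) R\<^esub> eval_map K X R (e R ()) =
        r \<odot>\<^bsub>mobj (funs_dual K X) R\<^esub> eval_map K X R (e R ()) \<oplus>\<^bsub>mobj (funs_dual K X) R\<^esub>
        r' \<odot>\<^bsub>mobj (funs_dual K X) R\<^esub> eval_map K X R (e R ())" if "r' \<in> carrier (mobj Kfun R)" for r'
      using r that ev A.smult_l_distr by simp
    show "(r' \<odot>\<^bsub>mobj Kfun R\<^esub> r) \<odot>\<^bsub>mobj (funs_dual K X) R\<^esub> eval_map K X R (e R ()) =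
        r' \<odot>\<^bsub>mobj (funs_dual K X) R\<^esub> (r \<odot>\<^bsub>mobj (funs_dual K X) R\<^esub> eval_map K X R (e R ()))"
      if "r' \<in> carrier R" for r'
      using r that ev A.smult_assoc1 by simp
  qed
  have u_eval: "u S \<one>\<^bsub>S\<^esub> = eval_map K X S (e S ())" if S: "algebra K S" for S
    using module.smult_one[OF module_functorD[OF funs_dual_module_functor[OF X] S] eval_map_in[OF X S eS[OF S]]]
      S algebra_closed(1)[OF S] by (simp add: u_def)
  have alg: "(m, u) \<in> algebra_structures K (funs_dual K X)"
    by (rule convolution_algebra_structure[OF X det' m u s[unfolded se] m_eval u_eval])
  have bialg: "(m, u) \<in> bialgebra_structures K X"
    unfolding bialgebra_structures_iff[OF X det alg]
    using m_eval u_eval eval_map_in_Spec[OF X] set_homsD(1)[OF \<mu>] eS by simp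
  have corr: "corresponding K X s (m, u)"
    unfolding se corresponding_iff[OF X m u \<mu> e] using m_eval u_eval by blast
  show ?thesis
  proof (rule ex1I[of _ "(m, u)"])
    show "(m, u) \<in> bialgebra_structures K X \<and> corresponding K X s (m, u)" using bialg corr by blast
    fix b assume b: "b \<in> bialgebra_structures K X \<and> corresponding K X s b"
    obtain m' u' where b': "b = (m', u')" by (cases b)
    have m': "m' \<in> module_homs (algs K) ?T (funs_dual K X)" and u': "u' \<in> module_homs (algs K) Kfun (funs_dual K X)"
      using bialgebra_structuresD[of b K X] b by (simp_all add: b')
    have ev: "m' S (funs_dual_pure K X S (eval_map K X S x) (eval_map K X S y)) = eval_map K X S (\<mu> S (x, y))"
        "u' S \<one>\<^bsub>S\<^esub> = eval_map K X S (e S ())"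
      if "algebra K S" "x \<in> obj X S" "y \<in> obj X S" for S x y
      using b that unfolding b' se corresponding_iff[OF X m' u' \<mu> e] by blast+
    \<comment> \<open>Correspondence with s prescribes the products of evaluations, and these
      determine the whole multiplication.\<close>
    have "m' = m"
      by (rule tensor_homs_eqI[OF X det' m' m]) (simp add: ev m_eval)
    moreover have "u' = u"
      by (rule unit_homs_eqI[OF X u' u]) (simp add: ev(2)[OF _ eS eS] u_eval)
    ultimately show "b = (m, u)" by (simp add: b')
  qed
qed


text \<open>Evaluation embeds the points over S into the ring of linear forms over S. The image is
  closed under products and contains 1, so the monoid laws are inherited along the embedding;
  injectivity also makes the structure unique.\<close>

lemma monoid_of_bialgebra:
  fixes K :: "'u ring" and X :: "('u alg, 'u, 'x) sfun"
  assumes aff: "affine K X" and b: "b \<in> bialgebra_structures K X"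
  shows "\<exists>!s. s \<in> monoid_structures K X \<and> corresponding K X s b"
proof -
  note X = affineD(1)[OF aff] and det = affineD(2)[OF aff] and XX = sprod_set_functor[OF affineD(1)[OF aff] affineD(1)[OF aff]]
  note inj = affine_eval_inject[OF aff]
  note bD = bialgebra_structuresD[OF b]
  obtain m u where mu: "b = (m, u)" by (cases b)
  have m: "m \<in> module_homs (algs K) (funs_dual_tensor K X) (funs_dual K X)"
    and u: "u \<in> module_homs (algs K) Kfun (funs_dual K X)" using bD by (simp_all add: mu)
  let ?ev = "\<lambda>S x y. m S (funs_dual_pure K X S (eval_map K X S x) (eval_map K X S y))"
  have ev_Spec: "?ev S x y \<in> obj (Spec K (funs K X)) S" if "algebra K S" "x \<in> obj X S" "y \<in> obj X S" for S x y
    using b that unfolding bialgebra_structures_iff[OF X det bD(1)] by (simp add: mu)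
  have u_Spec: "u S \<one>\<^bsub>S\<^esub> \<in> obj (Spec K (funs K X)) S" if "algebra K S" for S
    using b that unfolding bialgebra_structures_iff[OF X det bD(1)] by (simp add: mu)
  \<comment> \<open>The product of two evaluations is a point of the spectrum; the point of X behind
    it is taken as the product.\<close>
  define \<mu> where "\<mu> = (\<lambda>S\<in>Obj (algs K). \<lambda>p\<in>obj (sprod X X) S. point_of K X S (?ev S (fst p) (snd p)))"
  define e where "e = (\<lambda>S\<in>Obj (algs K). \<lambda>p\<in>obj (spoint :: ('u alg, 'u, unit) sfun) S. point_of K X S (u S \<one>\<^bsub>S\<^esub>))"
  have \<mu>_in: "\<mu> S (x, y) \<in> obj X S" and \<mu>_ev: "eval_map K X S (\<mu> S (x, y)) = ?ev S x y"
    if "algebra K S" "x \<in> obj X S" "y \<in> obj X S" for S x y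
    using point_of[OF aff that(1) ev_Spec[OF that]] that by (simp_all add: \<mu>_def)
  have e_in: "e S () \<in> obj X S" and e_ev: "eval_map K X S (e S ()) = u S \<one>\<^bsub>S\<^esub>" if "algebra K S" for S
    using point_of[OF aff that u_Spec[OF that]] that by (simp_all add: e_def)
  have \<mu>: "\<mu> \<in> set_homs (algs K) (sprod X X) X"
    unfolding \<mu>_def
  proof (rule set_homsI[OF XX])
    fix S p assume S: "algebra K S" and "p \<in> obj (sprod X X) S"
    then obtain x y where p: "p = (x, y)" "x \<in> obj X S" "y \<in> obj X S" by auto
    show "point_of K X S (?ev S (fst p) (snd p)) \<in> obj X S"
      using point_of(1)[OF aff S ev_Spec[OF S p(2,3)]] p by simp
    show "point_of K X R (?ev R (fst (mor (sprod X X) S R \<phi> p)) (snd (mor (sprod X X) S R \<phi> p))) =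
        mor X S R \<phi> (point_of K X S (?ev S (fst p) (snd p)))"
      if R: "algebra K R" "\<phi> \<in> calg_homs K S R" for R \<phi>
    proof (rule inj[OF R(1)])
      note xy = set_functorD(1)[OF X S R p(2)] set_functorD(1)[OF X S R p(3)]
      note pt = point_of[OF aff R(1) ev_Spec[OF R(1) xy]] and pS = point_of[OF aff S ev_Spec[OF S p(2,3)]]
      show "point_of K X R (?ev R (fst (mor (sprod X X) S R \<phi> p)) (snd (mor (sprod X X) S R \<phi> p))) \<in> obj X R"
        using pt(1) p by simp
      show "mor X S R \<phi> (point_of K X S (?ev S (fst p) (snd p))) \<in> obj X R"
        using set_functorD(1)[OF X S R pS(1)] p by simp
      \<comment> \<open>After evaluation, naturality of the product of points is naturality of
        m.\<close>
      show "eval_map K X R (point_of K X R (?ev R (fst (mor (sprod X X) S R \<phi> p)) (snd (mor (sprod X X) S R \<phi> p)))) =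
          eval_map K X R (mor X S R \<phi> (point_of K X S (?ev S (fst p) (snd p))))"
        using pt(2) pS(2) p eval_map_base_change[OF X S R pS(1)]
          module_homsD(2)[OF m S eval_pure_in[OF X S p(2,3)] R] eval_pure_mor[OF X S R p(2,3)]
        by (simp del: tensor_fun_simps)
    qed
  qed
  have e: "e \<in> set_homs (algs K) spoint X"
    unfolding e_def
  proof (rule set_homsI)
    show "set_functor (algs K) (spoint :: ('u alg, 'u, unit) sfun)" by (simp add: set_functor_def)
    fix S :: "'u alg" and p assume S: "algebra K S"
    note pS = point_of[OF aff S u_Spec[OF S]]
    show "point_of K X S (u S \<one>\<^bsub>S\<^esub>) \<in> obj X S" by (rule pS(1))
    show "point_of K X R (u R \<one>\<^bsub>R\<^esub>) = mor X S R \<phi> (point_of K X S (u S \<one>\<^bsub>S\<^esub>))"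
      if R: "algebra K R" "\<phi> \<in> calg_homs K S R" for R \<phi>
    proof (rule inj[OF R(1)])
      note pR = point_of[OF aff R(1) u_Spec[OF R(1)]]
      show "point_of K X R (u R \<one>\<^bsub>R\<^esub>) \<in> obj X R" by (rule pR(1))
      show "mor X S R \<phi> (point_of K X S (u S \<one>\<^bsub>S\<^esub>)) \<in> obj X R" by (rule set_functorD(1)[OF X S R pS(1)])
      show "eval_map K X R (point_of K X R (u R \<one>\<^bsub>R\<^esub>)) = eval_map K X R (mor X S R \<phi> (point_of K X S (u S \<one>\<^bsub>S\<^esub>)))"
        using pR(2) pS(2) eval_map_base_change[OF X S R pS(1)]
          module_homsD(2)[OF u S _ R, of "\<one>\<^bsub>S\<^esub>"] algebra_closed(1)[OF S] calg_one[OF R(2)] by simp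
    qed
  qed
  have "monoid (monoid_at X (\<mu>, e) S)" if S: "algebra K S" for S
  proof -
    have "assoc_algebra S (mobj (with_mult (funs_dual K X) b) S)"
      using bD(1) S by (simp add: algebra_structures_def algebra_functor_def ball_algs)
    then interpret A: ring "mobj (with_mult (funs_dual K X) b) S" by (simp add: assoc_algebra_def)
    note ev = eval_map_in[OF X S]
    show ?thesis
    proof (rule monoidI, simp_all add: monoid_at_def)
      show "\<mu> S (x, y) \<in> obj X S" if "x \<in> obj X S" "y \<in> obj X S" for x y by (rule \<mu>_in[OF S that])
      show "e S () \<in> obj X S" by (rule e_in[OF S])
      show "\<mu> S (\<mu> S (x, y), z) = \<mu> S (x, \<mu> S (y, z))" if "x \<in> obj X S" "y \<in> obj X S" "z \<in> obj X S" for x y z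
      proof (rule inj[OF S])
        show "eval_map K X S (\<mu> S (\<mu> S (x, y), z)) = eval_map K X S (\<mu> S (x, \<mu> S (y, z)))"
          using A.m_assoc[of "eval_map K X S x" "eval_map K X S y" "eval_map K X S z"] that ev
          by (simp add: \<mu>_ev[OF S] \<mu>_in[OF S] mu)
      qed (simp_all add: \<mu>_in[OF S] that)
      show "\<mu> S (e S (), x) = x" if "x \<in> obj X S" for x
      proof (rule inj[OF S])
        show "eval_map K X S (\<mu> S (e S (), x)) = eval_map K X S x"
          using A.l_one[of "eval_map K X S x"] that ev by (simp add: \<mu>_ev[OF S] e_in[OF S] e_ev[OF S] mu)
      qed (simp_all add: \<mu>_in[OF S] e_in[OF S] that)
      show "\<mu> S (x, e S ()) = x" if "x \<in> obj X S" for x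
      proof (rule inj[OF S])
        show "eval_map K X S (\<mu> S (x, e S ())) = eval_map K X S x"
          using A.r_one[of "eval_map K X S x"] that ev by (simp add: \<mu>_ev[OF S] e_in[OF S] e_ev[OF S] mu)
      qed (simp_all add: \<mu>_in[OF S] e_in[OF S] that)
    qed
  qed
  then have s: "(\<mu>, e) \<in> monoid_structures K X"
    using \<mu> e by (simp add: monoid_structures_def ball_algs)
  have corr: "corresponding K X (\<mu>, e) b"
    unfolding mu corresponding_iff[OF X m u \<mu> e] by (simp add: \<mu>_ev e_ev)
  show ?thesis
  proof (rule ex1I[of _ "(\<mu>, e)"])
    show "(\<mu>, e) \<in> monoid_structures K X \<and> corresponding K X (\<mu>, e) b" using s corr by blast
    fix s' assume s': "s' \<in> monoid_structures K X \<and> corresponding K X s' b"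
    obtain \<mu>' e' where se: "s' = (\<mu>', e')" by (cases s')
    have \<mu>': "\<mu>' \<in> set_homs (algs K) (sprod X X) X" and e': "e' \<in> set_homs (algs K) spoint X"
      using monoid_structuresD[of s' K X] s' by (simp_all add: se)
    have ev: "\<And>S x y. algebra K S \<Longrightarrow> x \<in> obj X S \<Longrightarrow> y \<in> obj X S \<Longrightarrow> ?ev S x y = eval_map K X S (\<mu>' S (x, y))"
        "\<And>S. algebra K S \<Longrightarrow> u S \<one>\<^bsub>S\<^esub> = eval_map K X S (e' S ())"
      using s' unfolding se mu corresponding_iff[OF X m u \<mu>' e'] by blast+
    have "\<mu>' = \<mu>"
    proof (rule set_homs_eqI[OF \<mu>' \<mu>])
      fix S p assume S: "algebra K S" and "p \<in> obj (sprod X X) S"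
      then obtain x y where p: "p = (x, y)" "x \<in> obj X S" "y \<in> obj X S" by auto
      show "\<mu>' S p = \<mu> S p"
        unfolding p(1)
        by (rule inj[OF S _ \<mu>_in[OF S p(2,3)]])
           (use set_homsD(1)[OF \<mu>' S, of "(x, y)"] p ev(1)[OF S p(2,3)] \<mu>_ev[OF S p(2,3)] in auto)
    qed
    moreover have "e' = e"
    proof (rule set_homs_eqI[OF e' e])
      fix S p assume S: "algebra K S" and "p \<in> obj (spoint :: ('u alg, 'u, unit) sfun) S"
      show "e' S p = e S p"
        by (cases p, simp, rule inj[OF S _ e_in[OF S]])
           (use set_homsD(1)[OF e' S, of "()"] ev(2)[OF S] e_ev[OF S] in auto)
    qed
    ultimately show "s' = (\<mu>, e)" by (simp add: se)
  qed
qed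


section \<open>Morphisms\<close>

lemma correspondingD:
  assumes "set_functor (algs K) X" "s \<in> monoid_structures K X" "b \<in> bialgebra_structures K X"
    "corresponding K X s b" "algebra K S"
  shows "x \<in> obj X S \<Longrightarrow> y \<in> obj X S \<Longrightarrow>
      fst b S (funs_dual_pure K X S (eval_map K X S x) (eval_map K X S y)) = eval_map K X S (fst s S (x, y))"
    and "snd b S \<one>\<^bsub>S\<^esub> = eval_map K X S (snd s S ())"
  using assms(4,5) corresponding_iff[OF assms(1) bialgebra_structuresD(2,3)[OF assms(3)] monoid_structuresD[OF assms(2)]]
  by simp_all

text \<open>The transpose of the induced map extends h from points to linear forms. This is how h
  appears inside the duals, and it makes h recoverable from its pullback.\<close>

lemma dual_hom_pullback_eval:
  assumes X: "set_functor (algs K) X" and Y: "set_functor (algs K) Y" and h: "h \<in> set_homs (algs K) X Y"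
    and S: "algebra K S" and x: "x \<in> obj X S"
  shows "dual_hom K (funs K Y) (funs K X) (pullback K X Y h) S (eval_map K X S x) = eval_map K Y S (h S x)"
proof -
  have pb: "pullback K X Y h \<in> module_homs (algs K) (funs K Y) (funs K X)"
    using pullback_in[OF X Y h] by (simp add: algebra_homs_iff)
  note F = dual_hom_in[OF funs_linear_functor[OF Y] funs_linear_functor[OF X] pb]
  note ev = eval_map_in[OF X S x] and hx = set_homsD(1)[OF h S x]
  show ?thesis
  proof (rule dual_eqI[OF module_homsD(1)[OF F S ev] eval_map_in[OF Y S hx] S])
    fix R \<phi> f assume R: "algebra K R" "\<phi> \<in> calg_homs K S R" and f: "f \<in> carrier (mobj (funs K Y) R)"
    show "dual_hom K (funs K Y) (funs K X) (pullback K X Y h) S (eval_map K X S x) (R, \<phi>) f =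
        eval_map K Y S (h S x) (R, \<phi>) f"
      using S ev hx x R f module_homsD(1)[OF pb R(1) f] set_functorD(1)[OF X S R x] set_homsD(2)[OF h S x R]
      by simp
  qed
qed

text \<open>Multiplicativity of the transpose is an identity between bilinear maps on the dual of
  the functions on X, so it is enough to know it at pairs of points, where it says that h preserves
  products.\<close>

lemma pullback_in_bialgebra_homs:
  assumes affX: "affine K X" and affY: "affine K Y"
    and s: "s \<in> monoid_structures K X" and t: "t \<in> monoid_structures K Y"
    and b: "b \<in> bialgebra_structures K X" and c: "c \<in> bialgebra_structures K Y"
    and sb: "corresponding K X s b" and tc: "corresponding K Y t c"
    and h: "h \<in> monoid_homs K X s Y t"
  shows "pullback K X Y h \<in> bialgebra_homs K Y c X b"
proof -
  note X = affineD(1)[OF affX] and Y = affineD(1)[OF affY]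
  note bD = bialgebra_structuresD[OF b] and cD = bialgebra_structuresD[OF c]
  note sD = monoid_structuresD[OF s] and tD = monoid_structuresD[OF t]
  note sb = correspondingD[OF X s b sb] and tc = correspondingD[OF Y t c tc]
  have h_hom: "h \<in> set_homs (algs K) X Y" using h by (simp add: monoid_homs_def)
  have h_mult: "h S (fst s S (x, y)) = fst t S (h S x, h S y)" and h_one: "h S (snd s S ()) = snd t S ()"
    if "algebra K S" "x \<in> obj X S" "y \<in> obj X S" for S x y
    using h that by (auto simp: monoid_homs_def ball_algs hom_def monoid_at_def)
  let ?p = "pullback K X Y h"
  note pb_alg = pullback_in[OF X Y h_hom]
  then have pb: "?p \<in> module_homs (algs K) (funs K Y) (funs K X)" by (simp add: algebra_homs_iff)
  let ?F = "dual_hom K (funs K Y) (funs K X) ?p"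
  note F = dual_hom_in[OF funs_linear_functor[OF Y] funs_linear_functor[OF X] pb]
  note F_eval = dual_hom_pullback_eval[OF X Y h_hom]
  have eX: "snd s S () \<in> obj X S" if "algebra K S" for S using set_homsD(1)[OF sD(2) that] by simp
  have mult: "?F S (fst b S (funs_dual_pure K X S u v)) = fst c S (funs_dual_pure K Y S (?F S u) (?F S v))"
    if S: "algebra K S" and u: "u \<in> carrier (mobj (funs_dual K X) S)" and v: "v \<in> carrier (mobj (funs_dual K X) S)"
    for S u v
  proof -
    \<comment> \<open>Values lie in the dual of the functions on Y, so the test at points of X is
      taken with that dual as target.\<close>
    note det = affineD(3)[OF affX funs_linear_functor[OF Y]]
    note FS = module_homs_linear[OF F S]
    show ?thesis
    proof (rule evals_determine_bilinear[where
          P = "\<lambda>R \<phi> u v. ?F R (fst b R (funs_dual_pure K X R u v))" and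
          Q = "\<lambda>R \<phi> u v. fst c R (funs_dual_pure K Y R (?F R u) (?F R v))",
          OF X det X det S _ _ _ S id_on_calg[OF S] u v])
      show "bilinear_family K S (funs_dual K X) (funs_dual K X) (funs_dual K Y)
          (\<lambda>R \<phi> u v. ?F R (fst b R (funs_dual_pure K X R u v)))"
        by (rule bilinear_family_compose[OF bilinear_family_compose[OF funs_dual_pure_bilinear[OF X]
                module_homs_linear[OF bD(2) S]] FS])
      show "bilinear_family K S (funs_dual K X) (funs_dual K X) (funs_dual K Y)
          (\<lambda>R \<phi> u v. fst c R (funs_dual_pure K Y R (?F R u) (?F R v)))"
        by (rule bilinear_family_precompose[OF FS FS bilinear_family_compose[OF funs_dual_pure_bilinear[OF Y]
                module_homs_linear[OF cD(2) S]]])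
      show "?F R (fst b R (funs_dual_pure K X R (eval_map K X R x) (eval_map K X R y))) =
          fst c R (funs_dual_pure K Y R (?F R (eval_map K X R x)) (?F R (eval_map K X R y)))"
        if "algebra K R" "x \<in> obj X R" "y \<in> obj X R" for R x y
        using sb tc that F_eval h_mult[OF that] set_homsD(1)[OF h_hom that(1)] set_homsD(1)[OF sD(1) that(1), of "(x, y)"]
        by simp
    qed
  qed
  have one: "?F S (snd b S \<one>\<^bsub>S\<^esub>) = snd c S \<one>\<^bsub>S\<^esub>" if S: "algebra K S" for S
    using sb tc S F_eval[OF S eX[OF S]] h_one[OF S eX[OF S] eX[OF S]] by simp
  have "?F \<in> algebra_homs (algs K) (with_mult (funs_dual K X) b) (with_mult (funs_dual K Y) c)"
    unfolding algebra_homs_iff module_homs_with_mult using F mult one by simp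
  then show ?thesis using pb_alg by (simp add: bialgebra_homs_def)
qed

text \<open>The two halves of the bialgebra condition have separate tasks: multiplicativity of f
  yields the map h on points, and multiplicativity of its transpose makes h a morphism of
  monoids.\<close>

lemma bialgebra_hom_pullback:
  fixes K :: "'u ring" and X :: "('u alg, 'u, 'x) sfun" and Y :: "('u alg, 'u, 'y) sfun"
  assumes affX: "affine K X" and affY: "affine K Y"
    and s: "s \<in> monoid_structures K X" and t: "t \<in> monoid_structures K Y"
    and b: "b \<in> bialgebra_structures K X" and c: "c \<in> bialgebra_structures K Y"
    and sb: "corresponding K X s b" and tc: "corresponding K Y t c"
    and f: "f \<in> bialgebra_homs K Y c X b"
  obtains h where "h \<in> monoid_homs K X s Y t" "pullback K X Y h = f"
proof -
  note X = affineD(1)[OF affX] and Y = affineD(1)[OF affY]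
  note bD = bialgebra_structuresD[OF b] and cD = bialgebra_structuresD[OF c]
  note sD = monoid_structuresD[OF s] and tD = monoid_structuresD[OF t]
  note sb = correspondingD[OF X s b sb] and tc = correspondingD[OF Y t c tc]
  note inj = affine_eval_inject[OF affY]
  let ?F = "dual_hom K (funs K Y) (funs K X) f"
  have f_alg: "f \<in> algebra_homs (algs K) (funs K Y) (funs K X)"
    and F_alg: "?F \<in> algebra_homs (algs K) (with_mult (funs_dual K X) b) (with_mult (funs_dual K Y) c)"
    using f by (simp_all add: bialgebra_homs_def)
  have f_mod: "f \<in> module_homs (algs K) (funs K Y) (funs K X)" using f_alg by (simp add: algebra_homs_iff)
  note F_mod = dual_hom_in[OF funs_linear_functor[OF Y] funs_linear_functor[OF X] f_mod]
  have F_mult: "?F S (fst b S (funs_dual_pure K X S u v)) = fst c S (funs_dual_pure K Y S (?F S u) (?F S v))"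
    if "algebra K S" "u \<in> carrier (mobj (funs_dual K X) S)" "v \<in> carrier (mobj (funs_dual K X) S)" for S u v
    using F_alg that by (simp add: algebra_homs_iff)
  have F_one: "?F S (snd b S \<one>\<^bsub>S\<^esub>) = snd c S \<one>\<^bsub>S\<^esub>" if "algebra K S" for S
    using F_alg that by (simp add: algebra_homs_iff)
  have F_Spec: "?F S (eval_map K X S x) \<in> obj (Spec K (funs K Y)) S" if S: "algebra K S" and x: "x \<in> obj X S" for S x
  proof -
    note ev = eval_map_in[OF X S x]
    have "eval_map K X S x \<in> obj (Spec K (funs K X)) S" by (rule eval_map_in_Spec[OF X S x])
    \<comment> \<open>Composing a multiplicative form with f keeps it multiplicative, and f
      preserves 1.\<close>
    then show ?thesis
      using module_homsD(1)[OF F_mod S ev] ev S f_alg module_homsD(1)[OF f_mod] funs_closed[OF Y]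
      by (simp add: Spec_iff algebra_homs_iff del: eval_map_apply)
  qed
  define h where "h = (\<lambda>S\<in>Obj (algs K). \<lambda>x\<in>obj X S. point_of K Y S (?F S (eval_map K X S x)))"
  have h_in: "h S x \<in> obj Y S" and h_ev: "eval_map K Y S (h S x) = ?F S (eval_map K X S x)"
    if "algebra K S" "x \<in> obj X S" for S x
    using point_of[OF affY that(1) F_Spec[OF that]] that by (simp_all add: h_def)
  have h_mor: "h R (mor X S R \<phi> x) = mor Y S R \<phi> (h S x)"
    if S: "algebra K S" and x: "x \<in> obj X S" and R: "algebra K R" "\<phi> \<in> calg_homs K S R" for S x R \<phi>
  proof (rule inj[OF R(1)])
    note xR = set_functorD(1)[OF X S R x]
    show "h R (mor X S R \<phi> x) \<in> obj Y R" by (rule h_in[OF R(1) xR])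
    show "mor Y S R \<phi> (h S x) \<in> obj Y R" by (rule set_functorD(1)[OF Y S R h_in[OF S x]])
    show "eval_map K Y R (h R (mor X S R \<phi> x)) = eval_map K Y R (mor Y S R \<phi> (h S x))"
      using module_homsD(2)[OF F_mod S eval_map_in[OF X S x] R] eval_map_base_change[OF X S R x]
        eval_map_base_change[OF Y S R h_in[OF S x]] h_ev[OF S x] h_ev[OF R(1) xR] by simp
  qed
  have h_hom: "h \<in> set_homs (algs K) X Y"
    using h_in h_mor unfolding set_homs_def ball_algs by (auto simp: h_def)
  have h_mult: "h S (fst s S (x, y)) = fst t S (h S x, h S y)"
    if S: "algebra K S" and xy: "x \<in> obj X S" "y \<in> obj X S" for S x y
  proof (rule inj[OF S])
    have sxy: "fst s S (x, y) \<in> obj X S" using set_homsD(1)[OF sD(1) S, of "(x, y)"] xy by simp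
    show "h S (fst s S (x, y)) \<in> obj Y S" by (rule h_in[OF S sxy])
    show "fst t S (h S x, h S y) \<in> obj Y S"
      using set_homsD(1)[OF tD(1) S, of "(h S x, h S y)"] h_in[OF S] xy by simp
    have "eval_map K Y S (h S (fst s S (x, y))) =
        ?F S (fst b S (funs_dual_pure K X S (eval_map K X S x) (eval_map K X S y)))"
      using h_ev[OF S sxy] sb S xy by simp
    also have "\<dots> = fst c S (funs_dual_pure K Y S (eval_map K Y S (h S x)) (eval_map K Y S (h S y)))"
      using F_mult[OF S eval_map_in[OF X S xy(1)] eval_map_in[OF X S xy(2)]] h_ev[OF S xy(1)] h_ev[OF S xy(2)] by simp
    also have "\<dots> = eval_map K Y S (fst t S (h S x, h S y))"
      using tc(1)[OF S h_in[OF S xy(1)] h_in[OF S xy(2)]] .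
    finally show "eval_map K Y S (h S (fst s S (x, y))) = eval_map K Y S (fst t S (h S x, h S y))" .
  qed
  have h_one: "h S (snd s S ()) = snd t S ()" if S: "algebra K S" for S
  proof (rule inj[OF S])
    have e: "snd s S () \<in> obj X S" using set_homsD(1)[OF sD(2) S] by simp
    show "h S (snd s S ()) \<in> obj Y S" by (rule h_in[OF S e])
    show "snd t S () \<in> obj Y S" using set_homsD(1)[OF tD(2) S] by simp
    show "eval_map K Y S (h S (snd s S ())) = eval_map K Y S (snd t S ())"
      using h_ev[OF S e] sb tc S F_one[OF S] by simp
  qed
  have "h \<in> monoid_homs K X s Y t"
    using h_hom h_mult h_one h_in unfolding monoid_homs_def ball_algs
    by (simp add: hom_def monoid_at_def)
  moreover have "pullback K X Y h = f"
  proof (rule module_homs_eqI[OF _ f_mod])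
    have pb: "pullback K X Y h \<in> module_homs (algs K) (funs K Y) (funs K X)"
      using pullback_in[OF X Y h_hom] by (simp add: algebra_homs_iff)
    then show "pullback K X Y h \<in> module_homs (algs K) (funs K Y) (funs K X)" .
    fix S g assume S: "algebra K S" and g: "g \<in> carrier (mobj (funs K Y) S)"
    \<comment> \<open>Functions are compared at points x: f(g)(x) is ev_x applied to f(g), that is,
      the transpose of f at ev_x applied to g, that is, g(h(x)).\<close>
    show "pullback K X Y h S g = f S g"
    proof (rule funs_eqI[OF module_homsD(1)[OF pb S g] module_homsD(1)[OF f_mod S g] S])
      fix R \<phi> x assume R: "algebra K R" "\<phi> \<in> calg_homs K S R" and x: "x \<in> obj X R"
      note gR = funs_base_change[OF g R S] and ev = eval_map_in[OF X R(1) x]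
      have "pullback K X Y h S g (R, \<phi>) x = eval_map K Y R (h R x) (R, id_on R) (base_change K S R \<phi> g)"
        using S g R x gR h_in[OF R(1) x] set_functorD(2)[OF Y R(1)] by simp
      also have "\<dots> = eval_map K X R x (R, id_on R) (f R (base_change K S R \<phi> g))"
        unfolding h_ev[OF R(1) x] using R ev gR by simp
      also have "\<dots> = f S g (R, \<phi>) x"
        using module_homsD(2)[OF f_mod S g R] module_homsD(1)[OF f_mod R(1) gR] R x set_functorD(2)[OF X R(1) x] by simp
      finally show "pullback K X Y h S g (R, \<phi>) x = f S g (R, \<phi>) x" .
    qed
  qed
  ultimately show thesis by (rule that)
qed

lemma pullback_bij:
  assumes affX: "affine K X" and affY: "affine K Y"
    and s: "s \<in> monoid_structures K X" and t: "t \<in> monoid_structures K Y"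
    and b: "b \<in> bialgebra_structures K X" and c: "c \<in> bialgebra_structures K Y"
    and sb: "corresponding K X s b" and tc: "corresponding K Y t c"
  shows "bij_betw (pullback K X Y) (monoid_homs K X s Y t) (bialgebra_homs K Y c X b)"
  unfolding bij_betw_def
proof
  note X = affineD(1)[OF affX] and Y = affineD(1)[OF affY]
  show "inj_on (pullback K X Y) (monoid_homs K X s Y t)"
  proof (rule inj_onI)
    fix h h' assume "h \<in> monoid_homs K X s Y t" "h' \<in> monoid_homs K X s Y t"
      and eq: "pullback K X Y h = pullback K X Y h'"
    then have h: "h \<in> set_homs (algs K) X Y" and h': "h' \<in> set_homs (algs K) X Y"
      by (simp_all add: monoid_homs_def)
    \<comment> \<open>The transpose of the pullback recovers the evaluation at h x, and evaluations
      separate the points of Y.\<close>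
    show "h = h'"
    proof (rule set_homs_eqI[OF h h'])
      fix S x assume S: "algebra K S" and x: "x \<in> obj X S"
      show "h S x = h' S x"
        using dual_hom_pullback_eval[OF X Y h S x] dual_hom_pullback_eval[OF X Y h' S x] eq
          affine_eval_inject[OF affY S set_homsD(1)[OF h S x] set_homsD(1)[OF h' S x]] by simp
    qed
  qed
  show "pullback K X Y ` monoid_homs K X s Y t = bialgebra_homs K Y c X b"
  proof
    show "pullback K X Y ` monoid_homs K X s Y t \<subseteq> bialgebra_homs K Y c X b"
      using pullback_in_bialgebra_homs[OF assms] by blast
    show "bialgebra_homs K Y c X b \<subseteq> pullback K X Y ` monoid_homs K X s Y t"
      using bialgebra_hom_pullback[OF assms] by (metis imageI subsetI)
  qed
qed

theorem theorem0p4: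
  fixes K :: "'u ring"
    and G :: "('u alg, 'u, 'x) sfun"
    and G1 :: "('u alg, 'u, 'y) sfun"
    and G2 :: "('u alg, 'u, 'z) sfun"
  assumes "field K"
  shows
    "(affine K G \<longrightarrow>
       (\<forall>s\<in>monoid_structures K G. \<exists>!b. b \<in> bialgebra_structures K G \<and> corresponding K G s b) \<and>
       (\<forall>b\<in>bialgebra_structures K G. \<exists>!s. s \<in> monoid_structures K G \<and> corresponding K G s b)) \<and>
     (affine K G1 \<and> affine K G2 \<longrightarrow>
       (\<forall>s1\<in>monoid_structures K G1. \<forall>s2\<in>monoid_structures K G2.
        \<forall>b1\<in>bialgebra_structures K G1. \<forall>b2\<in>bialgebra_structures K G2.
          corresponding K G1 s1 b1 \<and> corresponding K G2 s2 b2 \<longrightarrow>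
          bij_betw (pullback K G1 G2)
            (monoid_homs K G1 s1 G2 s2)
            (bialgebra_homs K G2 b2 G1 b1)))"
  by (intro conjI impI ballI bialgebra_of_monoid monoid_of_bialgebra pullback_bij) simp_all

end
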